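(* Let $G=(V,E,\lambda)$ be an $n$-vertex weighted $2$-tree, where $\lambda: E \rightarrow \{ w \}$ for some $w\in\mathbb{R}^+$. There exists an $O(n)$-time algorithm that tests whether $G$ admits a planar straight-line realization and, in the positive case, constructs such a realization.
   Context: A $2$-tree is defined recursively: a $3$-cycle is a $2$-tree, and if $G$ is a $2$-tree containing an edge $(u,w)$, then adding a new vertex $v$ and edges $(v,u),(v,w)$ yields a $2$-tree. A weighted graph $G=(V,E,\lambda)$ has a length function $\lambda:E\to\mathbb{R}^+$. A planar straight-line realization of $G$ is a planar straight-line drawing of $G$ (no two edges crossing) in which each edge $e$ is a segment of Euclidean length $\lambda(e)$. Running times are in the real RAM model. *)

theory Defs
  imports "HOL-Analysis.Analysis" "HOL-Library.Landau_Symbols"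
begin

section \<open>2-trees and planar straight-line realizations\<close>

text \<open>An undirected simple graph is a vertex set together with a set of two-element vertex sets.\<close>

inductive two_tree :: "'a set \<Rightarrow> 'a set set \<Rightarrow> bool" where
  triangle: "\<lbrakk>a \<noteq> b; b \<noteq> c; a \<noteq> c\<rbrakk> \<Longrightarrow> two_tree {a, b, c} {{a, b}, {b, c}, {a, c}}"
| extend: "\<lbrakk>two_tree V E; {u, w} \<in> E; v \<notin> V\<rbrakk>
    \<Longrightarrow> two_tree (insert v V) (E \<union> {{v, u}, {v, w}})"

text \<open>For \<open>e = {u, v}\<close> this is the closed segment between \<open>p u\<close> and \<open>p v\<close>
  (\<open>segment_convex_hull\<close>).\<close>

definition edge_segment :: "('a \<Rightarrow> real \<times> real) \<Rightarrow> 'a set \<Rightarrow> (real \<times> real) set" where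
  "edge_segment p e = convex hull (p ` e)"

text \<open>Distinct edges may meet only in the images of their common end vertices, and an edge passes
  through no vertex other than its own ends.\<close>

definition planar_straight_line_drawing ::
    "'a set \<Rightarrow> 'a set set \<Rightarrow> ('a \<Rightarrow> real \<times> real) \<Rightarrow> bool" where
  "planar_straight_line_drawing V E p \<longleftrightarrow>
     inj_on p V \<and>
     (\<forall>v\<in>V. \<forall>e\<in>E. p v \<in> edge_segment p e \<longrightarrow> v \<in> e) \<and>
     (\<forall>e\<in>E. \<forall>f\<in>E. e \<noteq> f \<longrightarrow> edge_segment p e \<inter> edge_segment p f = p ` (e \<inter> f))"

text \<open>The metric on \<^typ>\<open>real \<times> real\<close> is the Euclidean one.\<close>

definition planar_realization ::
    "'a set \<Rightarrow> 'a set set \<Rightarrow> ('a set \<Rightarrow> real) \<Rightarrow> ('a \<Rightarrow> real \<times> real) \<Rightarrow> bool" where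
  "planar_realization V E len p \<longleftrightarrow>
     planar_straight_line_drawing V E p \<and>
     (\<forall>u v. {u, v} \<in> E \<longrightarrow> dist (p u) (p v) = len {u, v})"


section \<open>The real RAM\<close>

text \<open>
  A random access machine in which every memory cell holds one real number. Arithmetic, square
  roots, comparisons, indirect addressing, and reading or writing one real on the input or output
  tape take one step each. There is no rounding operation, and program constants are integers.
  In each instruction the first argument names the target cell where there is one;
  \<open>Load i j\<close> is \<open>M[i] := M[M[j]]\<close>, \<open>Store i j\<close> is \<open>M[M[i]] := M[j]\<close>, and the last argument of
  a jump is the target position in the program.
\<close>

datatype instr =
    Const nat int
  | Copy nat nat
  | Add nat nat nat
  | Sub nat nat nat
  | Mul nat nat nat
  | Div nat nat nat
  | Sqrt nat nat
  | Load nat nat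
  | Store nat nat
  | Read nat
  | Write nat
  | Jump nat
  | JumpLess nat nat nat
  | JumpEq nat nat nat
  | Halt

type_synonym program = "instr list"

record config =
  pc :: nat
  mem :: "nat \<Rightarrow> real"
  in_tape :: "real list"
  out_tape :: "real list"

definition put :: "nat \<Rightarrow> real \<Rightarrow> config \<Rightarrow> config" where
  "put i x c = c\<lparr>pc := Suc (pc c), mem := (mem c)(i := x)\<rparr>"

text \<open>\<^const>\<open>None\<close> means that no step is possible: either the machine has halted, or it is stuck
  on a division by zero, the root of a negative number, an address that is not a natural number,
  or the end of the input.\<close>

fun exec :: "instr \<Rightarrow> config \<Rightarrow> config option" where
  "exec (Const i k) c = Some (put i (of_int k) c)"
| "exec (Copy i j) c = Some (put i (mem c j) c)"
| "exec (Add i j k) c = Some (put i (mem c j + mem c k) c)"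
| "exec (Sub i j k) c = Some (put i (mem c j - mem c k) c)"
| "exec (Mul i j k) c = Some (put i (mem c j * mem c k) c)"
| "exec (Div i j k) c = (if mem c k = 0 then None else Some (put i (mem c j / mem c k) c))"
| "exec (Sqrt i j) c = (if mem c j < 0 then None else Some (put i (sqrt (mem c j)) c))"
| "exec (Load i j) c =
     (if mem c j \<in> \<nat> then Some (put i (mem c (nat \<lfloor>mem c j\<rfloor>)) c) else None)"
| "exec (Store i j) c =
     (if mem c i \<in> \<nat> then Some (put (nat \<lfloor>mem c i\<rfloor>) (mem c j) c) else None)"
| "exec (Read i) c =
     (case in_tape c of [] \<Rightarrow> None | x # xs \<Rightarrow> Some (put i x (c\<lparr>in_tape := xs\<rparr>)))"
| "exec (Write i) c = Some (c\<lparr>pc := Suc (pc c), out_tape := out_tape c @ [mem c i]\<rparr>)"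
| "exec (Jump l) c = Some (c\<lparr>pc := l\<rparr>)"
| "exec (JumpLess i j l) c = Some (c\<lparr>pc := (if mem c i < mem c j then l else Suc (pc c))\<rparr>)"
| "exec (JumpEq i j l) c = Some (c\<lparr>pc := (if mem c i = mem c j then l else Suc (pc c))\<rparr>)"
| "exec Halt c = None"

definition step :: "program \<Rightarrow> config \<Rightarrow> config \<Rightarrow> bool" where
  "step P c c' \<longleftrightarrow> pc c < length P \<and> exec (P ! pc c) c = Some c'"

definition initial :: "real list \<Rightarrow> config" where
  "initial xs = \<lparr>pc = 0, mem = (\<lambda>_. 0), in_tape = xs, out_tape = []\<rparr>"

definition halted :: "program \<Rightarrow> config \<Rightarrow> bool" where
  "halted P c \<longleftrightarrow> pc c < length P \<and> P ! pc c = Halt"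

text \<open>\<open>P\<close> started on input \<open>xs\<close> halts regularly after exactly \<open>t\<close> steps with output \<open>ys\<close>.\<close>

definition computes_in :: "program \<Rightarrow> real list \<Rightarrow> nat \<Rightarrow> real list \<Rightarrow> bool" where
  "computes_in P xs t ys \<longleftrightarrow>
     (\<exists>c. (step P ^^ t) (initial xs) c \<and> halted P c \<and> out_tape c = ys)"


section \<open>Encoding of instances and answers\<close>

text \<open>The vertices of an instance are \<open>0, \<dots>, n - 1\<close>. The edges are listed in any order, each exactly
  once and with its ends in either order.\<close>

definition edge_listing :: "nat set set \<Rightarrow> (nat \<times> nat) list \<Rightarrow> bool" where
  "edge_listing E es \<longleftrightarrow>
     distinct (map (\<lambda>(u, v). {u, v}) es) \<and> set (map (\<lambda>(u, v). {u, v}) es) = E"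

definition encode_graph :: "nat \<Rightarrow> (nat set \<Rightarrow> real) \<Rightarrow> (nat \<times> nat) list \<Rightarrow> real list" where
  "encode_graph n len es =
     real n # real (length es) # concat (map (\<lambda>(u, v). [real u, real v, len {u, v}]) es)"

definition answer_no :: "real list" where
  "answer_no = [0]"

definition answer_yes :: "nat \<Rightarrow> (nat \<Rightarrow> real \<times> real) \<Rightarrow> real list" where
  "answer_yes n p = 1 # concat (map (\<lambda>v. [fst (p v), snd (p v)]) [0..<n])"

end

theory Submission
  imports Defs
begin

text \<open>
  In a drawing with all edges of the same length, a vertex \<open>v\<close> attached to an edge \<open>ab\<close> that already
  lies in a triangle \<open>abz\<close> can only be placed at the reflection \<open>a + b - z\<close> of \<open>z\<close>. Hence all
  vertices lie on a triangular lattice and the drawing is unique up to an affine map. Conversely,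
  an injective placement on the lattice that maps edges to unit vectors is planar, since distinct
  unit segments of the lattice meet only in common end points. So it suffices to place the vertices
  one by one on the free one of the two apexes over their edge, and to answer no if both are taken.

  A construction order is the reverse of an elimination of vertices of degree 2. Instead of
  adjacency lists, every vertex stores the number, the sum and the sum of squares of its remaining
  neighbours; when two neighbours are left, they are found by solving a quadratic equation.
\<close>

section \<open>A structured language for the real RAM\<close>

text \<open>The time bound concerns one concrete machine program, so the algorithm is written in a
  small structured language with a verified compiler. Loop bodies have constant cost there, and
  linear time reduces to counting iterations.

  What makes constant cost per round possible is that any vertex of degree 2 may be eliminated, not
  only the one attached last: a plain queue suffices and nothing has to be searched. Degree, sum and
  sum of squares are updated by subtraction, whereas deletion from adjacency lists would require
  links between the two copies of an edge.

  Uniqueness is stated up to an affine map and not up to an isometry because the rule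
  \<open>a + b - z\<close> is preserved by every affine map; no angles have to be tracked from one
  vertex to the next. The refusal rests on distinct positions and edge lengths alone: if both apexes
  are taken, two vertices would be forced onto the same point. Crossings therefore have to be
  excluded only for the one drawing that is printed, and there the coordinates are integers and the
  question becomes one about small determinants.\<close>

datatype var = vN | vM | vI | vU | vV | vL | vR | vA | vB | vT | vX | vY | vDX | vDY | vOk

datatype arr = aDeg | aSum | aSqs | aQueue | aFst | aSnd | aX | aY | aGrid

datatype bin = OpAdd | OpSub | OpMul | OpDiv

datatype expr =
    Lit int
  | Var var
  | At arr expr
  | Bin bin expr expr
  | Root expr

abbreviation plus_expr (infixl "[+]" 65) where "e [+] f \<equiv> Bin OpAdd e f"
abbreviation minus_expr (infixl "[-]" 65) where "e [-] f \<equiv> Bin OpSub e f"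
abbreviation times_expr (infixl "[*]" 70) where "e [*] f \<equiv> Bin OpMul e f"
abbreviation over_expr (infixl "['/]" 70) where "e [/] f \<equiv> Bin OpDiv e f"

datatype com =
    Skip
  | Set var expr
  | SetAt arr expr expr
  | Input var
  | Output expr
  | Seq com com  (infixr ";;" 60)
  | IfEq expr expr com com
  | WhileLess expr expr com

record state =
  vars :: "var \<Rightarrow> real"
  arrs :: "arr \<Rightarrow> nat \<Rightarrow> real"
  inp :: "real list"
  outp :: "real list"

fun bin_eval :: "bin \<Rightarrow> real \<Rightarrow> real \<Rightarrow> real" where
  "bin_eval OpAdd x y = x + y"
| "bin_eval OpSub x y = x - y"
| "bin_eval OpMul x y = x * y"
| "bin_eval OpDiv x y = x / y"

fun eval :: "expr \<Rightarrow> state \<Rightarrow> real" where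
  "eval (Lit k) s = of_int k"
| "eval (Var x) s = vars s x"
| "eval (At a e) s = arrs s a (nat \<lfloor>eval e s\<rfloor>)"
| "eval (Bin b e f) s = bin_eval b (eval e s) (eval f s)"
| "eval (Root e) s = sqrt (eval e s)"

fun safe :: "expr \<Rightarrow> state \<Rightarrow> bool" where
  "safe (Lit k) s = True"
| "safe (Var x) s = True"
| "safe (At a e) s = (safe e s \<and> eval e s \<in> \<nat>)"
| "safe (Bin b e f) s = (safe e s \<and> safe f s \<and> (b = OpDiv \<longrightarrow> eval f s \<noteq> 0))"
| "safe (Root e) s = (safe e s \<and> 0 \<le> eval e s)"

fun var_index :: "var \<Rightarrow> nat" where
  "var_index vN = 0" | "var_index vM = 1" | "var_index vI = 2" | "var_index vU = 3"
| "var_index vV = 4" | "var_index vL = 5" | "var_index vR = 6" | "var_index vA = 7"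
| "var_index vB = 8" | "var_index vT = 9" | "var_index vX = 10" | "var_index vY = 11"
| "var_index vDX = 12" | "var_index vDY = 13" | "var_index vOk = 14"

fun arr_index :: "arr \<Rightarrow> nat" where
  "arr_index aDeg = 2" | "arr_index aSum = 3" | "arr_index aSqs = 4" | "arr_index aQueue = 5"
| "arr_index aFst = 6" | "arr_index aSnd = 7" | "arr_index aX = 8" | "arr_index aY = 9"
| "arr_index aGrid = 10"

text \<open>The memory is divided into residue classes modulo 16: class 0 holds the variables, class 1
  the intermediate values of expressions, and every array has a class of its own.\<close>

definition var_cell :: "var \<Rightarrow> nat" where
  "var_cell x = 16 * var_index x"

definition tmp_cell :: "nat \<Rightarrow> nat" where
  "tmp_cell d = 16 * d + 1"

definition arr_cell :: "arr \<Rightarrow> nat \<Rightarrow> nat" where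
  "arr_cell a k = 16 * k + arr_index a"

lemma var_index_inject [simp]: "var_index x = var_index y \<longleftrightarrow> x = y"
  by (cases x; cases y) simp_all

lemma arr_index_inject [simp]: "arr_index a = arr_index b \<longleftrightarrow> a = b"
  by (cases a; cases b) simp_all

lemma arr_index_bounds: "2 \<le> arr_index a" "arr_index a < 16"
  by (cases a; simp)+

lemma arr_index_mod: "(16 * k + arr_index a) mod 16 = arr_index a"
  using arr_index_bounds[of a] by simp

lemma cell_inject [simp]:
  "var_cell x = var_cell y \<longleftrightarrow> x = y"
  "tmp_cell d = tmp_cell e \<longleftrightarrow> d = e"
  "arr_cell a k = arr_cell b l \<longleftrightarrow> a = b \<and> k = l"
proof -
  show "arr_cell a k = arr_cell b l \<longleftrightarrow> a = b \<and> k = l"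
  proof
    assume *: "arr_cell a k = arr_cell b l"
    then have "a = b"
      unfolding arr_cell_def by (metis arr_index_mod arr_index_inject)
    with * show "a = b \<and> k = l"
      by (simp add: arr_cell_def)
  qed simp
qed (simp_all add: var_cell_def tmp_cell_def)

lemma cell_distinct [simp]:
  "var_cell x \<noteq> tmp_cell d" "tmp_cell d \<noteq> var_cell x"
  "var_cell x \<noteq> arr_cell a k" "arr_cell a k \<noteq> var_cell x"
  "tmp_cell d \<noteq> arr_cell a k" "arr_cell a k \<noteq> tmp_cell d"
proof -
  show 1: "var_cell x \<noteq> tmp_cell d"
    unfolding var_cell_def tmp_cell_def by presburger
  show 2: "var_cell x \<noteq> arr_cell a k"
    using arr_index_mod[of k a] arr_index_bounds[of a]
    unfolding var_cell_def arr_cell_def by (metis mod_mult_self1_is_0 not_numeral_le_zero)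
  show 3: "tmp_cell d \<noteq> arr_cell a k"
  proof
    assume "tmp_cell d = arr_cell a k"
    then have "(16 * d + 1) mod 16 = (16 * k + arr_index a) mod 16"
      by (simp only: tmp_cell_def arr_cell_def)
    then show False
      using arr_index_bounds[of a] by simp
  qed
  show "tmp_cell d \<noteq> var_cell x" "arr_cell a k \<noteq> var_cell x" "arr_cell a k \<noteq> tmp_cell d"
    using 1 2 3 by metis+
qed


subsection \<open>Compilation\<close>

fun bin_instr :: "bin \<Rightarrow> nat \<Rightarrow> nat \<Rightarrow> nat \<Rightarrow> instr" where
  "bin_instr OpAdd = Add"
| "bin_instr OpSub = Sub"
| "bin_instr OpMul = Mul"
| "bin_instr OpDiv = Div"

text \<open>Turns the index in \<open>tmp_cell d\<close> into a memory address in place. Constants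
  enter arithmetic only through a cell, hence the scratch cell one level up.\<close>

definition address_code :: "arr \<Rightarrow> nat \<Rightarrow> program" where
  "address_code a d =
     [Const (tmp_cell (Suc d)) 16,
      Mul (tmp_cell d) (tmp_cell d) (tmp_cell (Suc d)),
      Const (tmp_cell (Suc d)) (int (arr_index a)),
      Add (tmp_cell d) (tmp_cell d) (tmp_cell (Suc d))]"

lemma length_address_code [simp]: "length (address_code a d) = 4"
  by (simp add: address_code_def)

text \<open>The argument \<open>d\<close> is a stack depth: the value ends up in
  \<open>tmp_cell d\<close>, and lower temporaries survive.\<close>

fun comp_expr :: "expr \<Rightarrow> nat \<Rightarrow> program" where
  "comp_expr (Lit k) d = [Const (tmp_cell d) k]"
| "comp_expr (Var x) d = [Copy (tmp_cell d) (var_cell x)]"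
| "comp_expr (At a e) d = comp_expr e d @
     address_code a d @ [Load (tmp_cell d) (tmp_cell d)]"
| "comp_expr (Bin b e f) d = comp_expr e d @ comp_expr f (Suc d) @
     [bin_instr b (tmp_cell d) (tmp_cell d) (tmp_cell (Suc d))]"
| "comp_expr (Root e) d = comp_expr e d @ [Sqrt (tmp_cell d) (tmp_cell d)]"

text \<open>Jump targets are absolute, so the load address \<open>l\<close> is a parameter. The else
  branch comes before the then branch because it is reached by falling through
  \<open>JumpEq\<close>.\<close>

fun comp_com :: "com \<Rightarrow> nat \<Rightarrow> program" where
  "comp_com Skip l = []"
| "comp_com (Set x e) l = comp_expr e 0 @ [Copy (var_cell x) (tmp_cell 0)]"
| "comp_com (SetAt a e f) l = comp_expr e 0 @
     address_code a 0 @ comp_expr f 1 @ [Store (tmp_cell 0) (tmp_cell 1)]"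
| "comp_com (Input x) l = [Read (var_cell x)]"
| "comp_com (Output e) l = comp_expr e 0 @ [Write (tmp_cell 0)]"
| "comp_com (Seq c d) l = (let C = comp_com c l in C @ comp_com d (l + length C))"
| "comp_com (IfEq e f c d) l =
     (let B = comp_expr e 0 @ comp_expr f 1;
          D = comp_com d (l + length B + 1);
          k = l + length B + 1 + length D + 1;
          C = comp_com c k
      in B @ [JumpEq (tmp_cell 0) (tmp_cell 1) k] @ D @ [Jump (k + length C)] @ C)"
| "comp_com (WhileLess e f c) l =
     (let B = comp_expr e 0 @ comp_expr f 1;
          k = l + length B + 2;
          C = comp_com c k
      in B @ [JumpLess (tmp_cell 0) (tmp_cell 1) k, Jump (k + length C + 1)] @ C @ [Jump l])"

section \<open>Code fragments inside a program, step counts and memory contents\<close>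

fun code_at :: "program \<Rightarrow> nat \<Rightarrow> program \<Rightarrow> bool" where
  "code_at P l [] = True"
| "code_at P l (i # is) = (l < length P \<and> P ! l = i \<and> code_at P (Suc l) is)"

lemma code_at_append [simp]:
  "code_at P l (xs @ ys) \<longleftrightarrow> code_at P l xs \<and> code_at P (l + length xs) ys"
  by (induction xs arbitrary: l) auto

lemma code_at_extend: "code_at (xs @ ys @ zs) (length xs) ys"
proof (induction ys arbitrary: xs)
  case (Cons y ys)
  from Cons[of "xs @ [y]"] show ?case
    by (simp add: nth_append)
qed simp

declare relpowp.simps [simp del]

lemma relpowp_one [simp]: "R ^^ Suc 0 = R" for R :: "'a \<Rightarrow> 'a \<Rightarrow> bool"
  by (simp add: relpowp.simps eq_OO)

lemma steps_trans:
  "(step P ^^ t) c c' \<Longrightarrow> (step P ^^ u) c' c'' \<Longrightarrow> (step P ^^ (t + u)) c c''"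
  by (auto simp: relpowp_add)

lemma steps_Cons:
  "step P c c' \<Longrightarrow> (step P ^^ t) c' c'' \<Longrightarrow> (step P ^^ Suc t) c c''"
  by (rule relpowp_Suc_I2)

text \<open>Temporary cells are left unconstrained, so evaluating an expression does not change
  which state the memory represents.\<close>

definition reads :: "state \<Rightarrow> (nat \<Rightarrow> real) \<Rightarrow> bool" where
  "reads s m \<longleftrightarrow> (\<forall>x. m (var_cell x) = vars s x) \<and> (\<forall>a k. m (arr_cell a k) = arrs s a k)"

definition same_below :: "nat \<Rightarrow> (nat \<Rightarrow> real) \<Rightarrow> (nat \<Rightarrow> real) \<Rightarrow> bool" where
  "same_below d m m' \<longleftrightarrow>
     (\<forall>x. m' (var_cell x) = m (var_cell x)) \<and> (\<forall>a k. m' (arr_cell a k) = m (arr_cell a k)) \<and>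
     (\<forall>e<d. m' (tmp_cell e) = m (tmp_cell e))"

lemma same_below_refl [simp]: "same_below d m m"
  by (simp add: same_below_def)

lemma same_below_trans:
  "same_below d m m' \<Longrightarrow> same_below e m' m'' \<Longrightarrow> d \<le> e \<Longrightarrow> same_below d m m''"
  by (simp add: same_below_def)

lemma same_below_upd [simp]:
  "d \<le> e \<Longrightarrow> same_below d m (m'(tmp_cell e := x)) \<longleftrightarrow> same_below d m m'"
  by (auto simp: same_below_def)

lemma same_below_reads: "same_below d m m' \<Longrightarrow> reads s m \<Longrightarrow> reads s m'"
  by (simp add: same_below_def reads_def)

lemma same_below_tmp: "same_below d m m' \<Longrightarrow> e < d \<Longrightarrow> m' (tmp_cell e) = m (tmp_cell e)"
  by (simp add: same_below_def)

abbreviation conf :: "nat \<Rightarrow> (nat \<Rightarrow> real) \<Rightarrow> real list \<Rightarrow> real list \<Rightarrow> config" where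
  "conf l m i ou \<equiv> \<lparr>pc = l, mem = m, in_tape = i, out_tape = ou\<rparr>"

lemma address_arith:
  "x \<in> \<nat> \<Longrightarrow> x * 16 + real (arr_index a) \<in> \<nat>"
  "x \<in> \<nat> \<Longrightarrow> nat \<lfloor>x * 16 + real (arr_index a)\<rfloor> = arr_cell a (nat \<lfloor>x\<rfloor>)"
proof -
  assume "x \<in> \<nat>"
  then obtain k where x: "x = real k"
    by (auto elim: Nats_cases)
  have *: "x * 16 + real (arr_index a) = real (16 * k + arr_index a)"
    by (simp add: x)
  show "x * 16 + real (arr_index a) \<in> \<nat>"
    unfolding * by (rule of_nat_in_Nats)
  show "nat \<lfloor>x * 16 + real (arr_index a)\<rfloor> = arr_cell a (nat \<lfloor>x\<rfloor>)"
    unfolding * floor_of_nat by (simp add: arr_cell_def x)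
qed

lemma address_code_correct:
  assumes "code_at P l (address_code a d)"
  shows "(step P ^^ 4) (conf l m i ou) (conf (l + 4)
    (m(tmp_cell (Suc d) := real (arr_index a),
       tmp_cell d := m (tmp_cell d) * 16 + real (arr_index a))) i ou)"
proof -
  let ?m1 = "m(tmp_cell (Suc d) := 16)"
  let ?m2 = "?m1(tmp_cell d := m (tmp_cell d) * 16)"
  let ?m3 = "?m2(tmp_cell (Suc d) := real (arr_index a))"
  let ?m4 = "?m3(tmp_cell d := m (tmp_cell d) * 16 + real (arr_index a))"
  have "step P (conf l m i ou) (conf (Suc l) ?m1 i ou)"
    "step P (conf (Suc l) ?m1 i ou) (conf (Suc (Suc l)) ?m2 i ou)"
    "step P (conf (Suc (Suc l)) ?m2 i ou) (conf (Suc (Suc (Suc l))) ?m3 i ou)"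
    "step P (conf (Suc (Suc (Suc l))) ?m3 i ou) (conf (Suc (Suc (Suc (Suc l)))) ?m4 i ou)"
    using assms by (simp_all add: address_code_def step_def put_def)
  then have "(step P ^^ Suc (Suc (Suc (Suc 0)))) (conf l m i ou)
      (conf (Suc (Suc (Suc (Suc l)))) ?m4 i ou)"
    by (auto intro!: steps_Cons simp: relpowp.simps eq_OO)
  moreover have "?m4 = m(tmp_cell (Suc d) := real (arr_index a),
       tmp_cell d := m (tmp_cell d) * 16 + real (arr_index a))"
    by auto
  ultimately show ?thesis
    by (simp add: numeral_eq_Suc)
qed

text \<open>Expressions compile to code without jumps, so the number of steps is the length of the code.\<close>

lemma expr_runI:
  assumes "(step P ^^ t) (conf l m i ou) (conf l' m' i ou)"
    and "t = n" "l' = l + n" "m' (tmp_cell d) = x" "same_below d m m'"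
  shows "\<exists>m'. (step P ^^ n) (conf l m i ou) (conf (l + n) m' i ou) \<and>
    m' (tmp_cell d) = x \<and> same_below d m m'"
  using assms by blast

text \<open>\<open>same_below d\<close> is the stack discipline that carries the induction: in the
  \<open>Bin\<close> case it keeps the left value in \<open>tmp_cell d\<close> while the right
  operand is computed one level higher.\<close>

lemma comp_expr_correct:
  assumes "code_at P l (comp_expr e d)" "reads s m" "safe e s"
  shows "\<exists>m'. (step P ^^ length (comp_expr e d)) (conf l m i ou)
                (conf (l + length (comp_expr e d)) m' i ou) \<and>
              m' (tmp_cell d) = eval e s \<and> same_below d m m'"
  using assms
proof (induction e arbitrary: d l m)
  case (Lit k)
  let ?m = "m(tmp_cell d := real_of_int k)"
  have "(step P ^^ 1) (conf l m i ou) (conf (l + 1) ?m i ou)"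
    using Lit by (auto simp: step_def put_def)
  then show ?case
    by (rule expr_runI) simp_all
next
  case (Var x)
  let ?m = "m(tmp_cell d := vars s x)"
  have "(step P ^^ 1) (conf l m i ou) (conf (l + 1) ?m i ou)"
    using Var by (auto simp: step_def put_def reads_def)
  then show ?case
    by (rule expr_runI) simp_all
next
  case (At a e)
  let ?L = "length (comp_expr e d)"
  from At obtain m1 where 1:
    "(step P ^^ ?L) (conf l m i ou) (conf (l + ?L) m1 i ou)"
    "m1 (tmp_cell d) = eval e s" "same_below d m m1"
    by fastforce
  let ?x = "eval e s"
  let ?y = "?x * 16 + real (arr_index a)"
  let ?m2 = "m1(tmp_cell (Suc d) := real (arr_index a), tmp_cell d := ?y)"
  let ?m3 = "?m2(tmp_cell d := arrs s a (nat \<lfloor>?x\<rfloor>))"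
  have nat: "?x \<in> \<nat>"
    using At.prems(3) by simp
  have rd: "reads s m1"
    using 1(3) At.prems(2) by (rule same_below_reads)
  have 2: "(step P ^^ 4) (conf (l + ?L) m1 i ou) (conf (l + ?L + 4) ?m2 i ou)"
    using address_code_correct[of P "l + ?L" a d m1 i ou] At.prems(1) 1(2) by simp
  have "?m2 (arr_cell a (nat \<lfloor>?x\<rfloor>)) = arrs s a (nat \<lfloor>?x\<rfloor>)"
    using rd by (simp add: reads_def)
  moreover have "?m2 (tmp_cell d) = ?y"
    by simp
  ultimately have "exec (Load (tmp_cell d) (tmp_cell d)) (conf (l + ?L + 4) ?m2 i ou) =
      Some (conf (l + ?L + 5) ?m3 i ou)"
    unfolding exec.simps config.simps address_arith[OF nat, of a] if_True put_def
    using address_arith[OF nat, of a] by (simp only: config.simps if_True) simp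
  then have "(step P ^^ 1) (conf (l + ?L + 4) ?m2 i ou) (conf (l + ?L + 5) ?m3 i ou)"
    using At.prems(1) by (simp add: step_def)
  from steps_trans[OF 1(1) steps_trans[OF 2 this]] show ?case
    by (rule expr_runI) (simp_all add: 1(3))
next
  case (Bin b e f)
  let ?L = "length (comp_expr e d)"
  let ?K = "length (comp_expr f (Suc d))"
  from Bin.prems obtain m1 where 1:
    "(step P ^^ ?L) (conf l m i ou) (conf (l + ?L) m1 i ou)"
    "m1 (tmp_cell d) = eval e s" "same_below d m m1"
    using Bin.IH(1)[of l d m] by auto
  from Bin.prems same_below_reads[OF 1(3)] obtain m2 where 2:
    "(step P ^^ ?K) (conf (l + ?L) m1 i ou) (conf (l + ?L + ?K) m2 i ou)"
    "m2 (tmp_cell (Suc d)) = eval f s" "same_below (Suc d) m1 m2"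
    using Bin.IH(2)[of "l + ?L" "Suc d" m1] by auto
  have 3: "(step P ^^ 1) (conf (l + ?L + ?K) m2 i ou)
      (conf (l + ?L + ?K + 1) (m2(tmp_cell d := bin_eval b (eval e s) (eval f s))) i ou)"
    using Bin.prems(1,3) 1(2) 2(2) same_below_tmp[OF 2(3), of d]
    by (cases b) (auto simp: step_def put_def)
  from steps_trans[OF 1(1) steps_trans[OF 2(1) 3]] show ?case
    by (rule expr_runI) (simp_all add: same_below_trans[OF 1(3) 2(3)])
next
  case (Root e)
  let ?L = "length (comp_expr e d)"
  from Root obtain m1 where 1:
    "(step P ^^ ?L) (conf l m i ou) (conf (l + ?L) m1 i ou)"
    "m1 (tmp_cell d) = eval e s" "same_below d m m1"
    by fastforce
  have 3: "(step P ^^ 1) (conf (l + ?L) m1 i ou)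
      (conf (l + ?L + 1) (m1(tmp_cell d := sqrt (eval e s))) i ou)"
    using Root.prems(1,3) 1(2) by (auto simp: step_def put_def)
  from steps_trans[OF 1(1) 3] show ?case
    by (rule expr_runI) (simp_all add: 1(3))
qed

subsection \<open>Time-bounded total correctness\<close>

definition represents :: "state \<Rightarrow> config \<Rightarrow> bool" where
  "represents s c \<longleftrightarrow> reads s (mem c) \<and> in_tape c = inp s \<and> out_tape c = outp s"

text \<open>Quantifying over the program and the load address makes correctness independent of the
  surroundings, so that commands can be nested. \<open>T\<close> is only an upper bound, since
  branches and loops take varying numbers of steps.\<close>

definition reaches :: "com \<Rightarrow> nat \<Rightarrow> state \<Rightarrow> (state \<Rightarrow> bool) \<Rightarrow> bool" where
  "reaches c T s Q \<longleftrightarrow>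
     (\<forall>P l k. code_at P l (comp_com c l) \<longrightarrow> pc k = l \<longrightarrow> represents s k \<longrightarrow>
        (\<exists>t k' s'. t \<le> T \<and> (step P ^^ t) k k' \<and> pc k' = l + length (comp_com c l) \<and>
                  represents s' k' \<and> Q s'))"

lemma runI:
  assumes "(step P ^^ t) c (conf l m i ou)" "t \<le> T"
    "l = l'" "i = inp s" "ou = outp s" "reads s m" "Q s"
  shows "\<exists>t m' s'. t \<le> T \<and> (step P ^^ t) c (conf l' m' (inp s') (outp s')) \<and> reads s' m' \<and> Q s'"
  using assms by blast

lemma reachesI:
  assumes "\<And>P l m i ou. code_at P l (comp_com c l) \<Longrightarrow> reads s m \<Longrightarrow> i = inp s \<Longrightarrow> ou = outp s \<Longrightarrow>
    \<exists>t m' s'. t \<le> T \<and>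
      (step P ^^ t) (conf l m i ou) (conf (l + length (comp_com c l)) m' (inp s') (outp s')) \<and>
      reads s' m' \<and> Q s'"
  shows "reaches c T s Q"
  unfolding reaches_def
proof (intro allI impI)
  fix P l k
  assume a: "code_at P l (comp_com c l)" "pc k = l" "represents s k"
  from a(2,3) have k: "k = conf l (mem k) (inp s) (outp s)"
    by (cases k) (simp add: represents_def)
  have "reads s (mem k)"
    using a(3) by (simp add: represents_def)
  from assms[OF a(1) this refl refl] obtain t m' s' where
    *: "t \<le> T" "(step P ^^ t) k (conf (l + length (comp_com c l)) m' (inp s') (outp s'))"
      "reads s' m'" "Q s'"
    by (subst (asm) k[symmetric]) blast
  let ?k = "conf (l + length (comp_com c l)) m' (inp s') (outp s')"
  have "represents s' ?k" "pc ?k = l + length (comp_com c l)"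
    using *(3) by (simp_all add: represents_def)
  with * show "\<exists>t k' s'. t \<le> T \<and> (step P ^^ t) k k' \<and> pc k' = l + length (comp_com c l) \<and>
      represents s' k' \<and> Q s'"
    by blast
qed

lemma reachesD:
  assumes "reaches c T s Q" "code_at P l (comp_com c l)" "reads s m"
  obtains t m' s' where "t \<le> T"
    "(step P ^^ t) (conf l m (inp s) (outp s)) (conf (l + length (comp_com c l)) m' (inp s') (outp s'))"
    "reads s' m'" "Q s'"
proof -
  have "represents s (conf l m (inp s) (outp s))"
    using assms(3) by (simp add: represents_def)
  with assms(1,2) obtain t k' s' where *: "t \<le> T" "(step P ^^ t) (conf l m (inp s) (outp s)) k'"
    "pc k' = l + length (comp_com c l)" "represents s' k'" "Q s'"
    using assms(1)[unfolded reaches_def, rule_format, OF assms(2), of "conf l m (inp s) (outp s)"]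
    by auto
  have "k' = conf (l + length (comp_com c l)) (mem k') (inp s') (outp s')" "reads s' (mem k')"
    using *(3,4) by (cases k'; simp add: represents_def)+
  with * show ?thesis
    by (metis that)
qed

lemma reaches_mono:
  "reaches c T s Q \<Longrightarrow> T \<le> T' \<Longrightarrow> (\<And>s'. Q s' \<Longrightarrow> Q' s') \<Longrightarrow> reaches c T' s Q'"
  unfolding reaches_def
proof (intro allI impI)
  fix P l k
  assume *: "\<forall>P l k. code_at P l (comp_com c l) \<longrightarrow> pc k = l \<longrightarrow> represents s k \<longrightarrow>
      (\<exists>t k' s'. t \<le> T \<and> (step P ^^ t) k k' \<and> pc k' = l + length (comp_com c l) \<and>
                represents s' k' \<and> Q s')"
    "T \<le> T'" "\<And>s'. Q s' \<Longrightarrow> Q' s'"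
    and a: "code_at P l (comp_com c l)" "pc k = l" "represents s k"
  from *(1)[rule_format, OF a] obtain t k' s' where "t \<le> T" "(step P ^^ t) k k'"
    "pc k' = l + length (comp_com c l)" "represents s' k'" "Q s'"
    by blast
  with *(2,3) show "\<exists>t k' s'. t \<le> T' \<and> (step P ^^ t) k k' \<and>
      pc k' = l + length (comp_com c l) \<and> represents s' k' \<and> Q' s'"
    by (meson order_trans)
qed

text \<open>With the correctness of \<open>d\<close> as the postcondition of \<open>c\<close>, no
  intermediate assertion has to be supplied.\<close>

lemma reaches_Seq:
  assumes "reaches c T s (\<lambda>s'. reaches d U s' Q)"
  shows "reaches (c ;; d) (T + U) s Q"
proof (rule reachesI)
  fix P l m i ou
  assume a: "code_at P l (comp_com (c ;; d) l)" "reads s m" "i = inp s" "ou = outp s"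
  from a(1) have code: "code_at P l (comp_com c l)"
    "code_at P (l + length (comp_com c l)) (comp_com d (l + length (comp_com c l)))"
    by (simp_all add: Let_def)
  from reachesD[OF assms code(1) a(2)] obtain t m1 s1 where 1: "t \<le> T"
    "(step P ^^ t) (conf l m i ou) (conf (l + length (comp_com c l)) m1 (inp s1) (outp s1))"
    "reads s1 m1" "reaches d U s1 Q"
    unfolding a(3,4) by blast
  from reachesD[OF 1(4) code(2) 1(3)] obtain u m2 s2 where 2: "u \<le> U"
    "(step P ^^ u) (conf (l + length (comp_com c l)) m1 (inp s1) (outp s1))
      (conf (l + length (comp_com c l) + length (comp_com d (l + length (comp_com c l)))) m2 (inp s2) (outp s2))"
    "reads s2 m2" "Q s2"
    by blast
  from steps_trans[OF 1(2) 2(2)]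
  show "\<exists>t m' s'. t \<le> T + U \<and> (step P ^^ t) (conf l m i ou)
      (conf (l + length (comp_com (c ;; d) l)) m' (inp s') (outp s')) \<and> reads s' m' \<and> Q s'"
    by (rule runI) (use 1(1) 2(1,3,4) in \<open>simp_all add: Let_def\<close>)
qed

lemma reaches_Skip: "Q s \<Longrightarrow> reaches Skip 0 s Q"
  by (rule reachesI) (auto simp: relpowp.simps)

lemma reads_var_upd: "reads s m \<Longrightarrow> reads (s\<lparr>vars := (vars s)(x := r)\<rparr>) (m(var_cell x := r))"
  by (auto simp: reads_def)

lemma reads_inp_outp [simp]: "reads (s\<lparr>inp := i\<rparr>) m = reads s m" "reads (s\<lparr>outp := i\<rparr>) m = reads s m"
  by (simp_all add: reads_def)

lemma reaches_Set:
  assumes "safe e s" "Q (s\<lparr>vars := (vars s)(x := eval e s)\<rparr>)"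
  shows "reaches (Set x e) (length (comp_expr e 0) + 1) s Q"
proof (rule reachesI)
  fix P l m i ou
  assume a: "code_at P l (comp_com (Set x e) l)" "reads s m" "i = inp s" "ou = outp s"
  let ?L = "length (comp_expr e 0)"
  from a comp_expr_correct[of P l e 0 s m i ou] assms(1) obtain m1 where 1:
    "(step P ^^ ?L) (conf l m i ou) (conf (l + ?L) m1 i ou)"
    "m1 (tmp_cell 0) = eval e s" "same_below 0 m m1"
    by auto
  have 2: "(step P ^^ 1) (conf (l + ?L) m1 i ou)
    (conf (l + ?L + 1) (m1(var_cell x := eval e s)) i ou)"
    using a(1) 1(2) by (auto simp: step_def put_def)
  have 3: "reads s m1"
    using 1(3) a(2) by (rule same_below_reads)
  let ?s = "s\<lparr>vars := (vars s)(x := eval e s)\<rparr>"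
  from steps_trans[OF 1(1) 2]
  show "\<exists>t m' s'. t \<le> ?L + 1 \<and> (step P ^^ t) (conf l m i ou)
      (conf (l + length (comp_com (Set x e) l)) m' (inp s') (outp s')) \<and> reads s' m' \<and> Q s'"
    by (rule runI[where s = ?s]) (use assms(2) reads_var_upd[OF 3] a(3,4) in simp_all)
qed

lemma reaches_Input:
  assumes "inp s = r # i'" "Q (s\<lparr>vars := (vars s)(x := r), inp := i'\<rparr>)"
  shows "reaches (Input x) 1 s Q"
proof (rule reachesI)
  fix P l m i ou
  assume a: "code_at P l (comp_com (Input x) l)" "reads s m" "i = inp s" "ou = outp s"
  let ?s = "s\<lparr>vars := (vars s)(x := r), inp := i'\<rparr>"
  have "(step P ^^ 1) (conf l m i ou) (conf (l + 1) (m(var_cell x := r)) i' ou)"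
    using a assms(1) by (auto simp: step_def put_def)
  then show "\<exists>t m' s'. t \<le> 1 \<and> (step P ^^ t) (conf l m i ou)
      (conf (l + length (comp_com (Input x) l)) m' (inp s') (outp s')) \<and> reads s' m' \<and> Q s'"
    by (rule runI[where s = ?s]) (use assms(2) reads_var_upd[OF a(2)] a(4) in \<open>simp_all add: reads_def\<close>)
qed

lemma reaches_Output:
  assumes "safe e s" "Q (s\<lparr>outp := outp s @ [eval e s]\<rparr>)"
  shows "reaches (Output e) (length (comp_expr e 0) + 1) s Q"
proof (rule reachesI)
  fix P l m i ou
  assume a: "code_at P l (comp_com (Output e) l)" "reads s m" "i = inp s" "ou = outp s"
  let ?L = "length (comp_expr e 0)"
  from a comp_expr_correct[of P l e 0 s m i ou] assms(1) obtain m1 where 1: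
    "(step P ^^ ?L) (conf l m i ou) (conf (l + ?L) m1 i ou)"
    "m1 (tmp_cell 0) = eval e s" "same_below 0 m m1"
    by auto
  have 2: "(step P ^^ 1) (conf (l + ?L) m1 i ou) (conf (l + ?L + 1) m1 i (ou @ [eval e s]))"
    using a(1) 1(2) by (auto simp: step_def)
  have 3: "reads s m1"
    using 1(3) a(2) by (rule same_below_reads)
  let ?s = "s\<lparr>outp := outp s @ [eval e s]\<rparr>"
  from steps_trans[OF 1(1) 2]
  show "\<exists>t m' s'. t \<le> ?L + 1 \<and> (step P ^^ t) (conf l m i ou)
      (conf (l + length (comp_com (Output e) l)) m' (inp s') (outp s')) \<and> reads s' m' \<and> Q s'"
    by (rule runI[where s = ?s]) (use assms(2) 3 a(3,4) in simp_all)
qed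

lemma comp_expr_pair:
  assumes "code_at P l (comp_expr e 0 @ comp_expr f 1)" "reads s m" "safe e s" "safe f s"
  shows "\<exists>m'. (step P ^^ length (comp_expr e 0 @ comp_expr f 1)) (conf l m i ou)
      (conf (l + length (comp_expr e 0 @ comp_expr f 1)) m' i ou) \<and>
    m' (tmp_cell 0) = eval e s \<and> m' (tmp_cell 1) = eval f s \<and> reads s m'"
proof -
  let ?L = "length (comp_expr e 0)"
  let ?K = "length (comp_expr f 1)"
  from assms comp_expr_correct[of P l e 0 s m i ou] obtain m1 where 1:
    "(step P ^^ ?L) (conf l m i ou) (conf (l + ?L) m1 i ou)"
    "m1 (tmp_cell 0) = eval e s" "same_below 0 m m1"
    by auto
  from assms comp_expr_correct[of P "l + ?L" f 1 s m1 i ou] same_below_reads[OF 1(3)]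
  obtain m2 where 2:
    "(step P ^^ ?K) (conf (l + ?L) m1 i ou) (conf (l + ?L + ?K) m2 i ou)"
    "m2 (tmp_cell 1) = eval f s" "same_below 1 m1 m2"
    by auto
  have "reads s m2"
    using same_below_reads[OF 2(3)] same_below_reads[OF 1(3)] assms(2) by blast
  with steps_trans[OF 1(1) 2(1)] 1(2) 2(2) same_below_tmp[OF 2(3), of 0] show ?thesis
    by (intro exI[of _ m2]) (simp add: add.assoc)
qed

text \<open>The address waits in \<open>tmp_cell 0\<close> while the value is computed at depth 1.
  The constant 5 counts four address instructions and the store.\<close>

lemma reaches_SetAt:
  assumes "safe e s" "eval e s \<in> \<nat>" "safe f s"
    "Q (s\<lparr>arrs := (arrs s)(a := (arrs s a)(nat \<lfloor>eval e s\<rfloor> := eval f s))\<rparr>)"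
  shows "reaches (SetAt a e f) (length (comp_expr e 0) + length (comp_expr f 1) + 5) s Q"
proof (rule reachesI)
  fix P l m i ou
  assume a: "code_at P l (comp_com (SetAt a e f) l)" "reads s m" "i = inp s" "ou = outp s"
  let ?L = "length (comp_expr e 0)"
  let ?K = "length (comp_expr f 1)"
  let ?x = "eval e s"
  from a comp_expr_correct[of P l e 0 s m i ou] assms(1) obtain m1 where 1:
    "(step P ^^ ?L) (conf l m i ou) (conf (l + ?L) m1 i ou)"
    "m1 (tmp_cell 0) = ?x" "same_below 0 m m1"
    by auto
  let ?y = "?x * 16 + real (arr_index a)"
  let ?m5 = "m1(tmp_cell 1 := real (arr_index a), tmp_cell 0 := ?y)"
  have 2: "(step P ^^ 4) (conf (l + ?L) m1 i ou) (conf (l + ?L + 4) ?m5 i ou)"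
    using address_code_correct[of P "l + ?L" a 0 m1 i ou] a(1) 1(2) by simp
  have rd: "reads s ?m5"
    using same_below_reads[OF 1(3) a(2)] by (simp add: reads_def)
  have "code_at P (l + ?L + 4) (comp_expr f 1)"
    using a(1) by (simp add: eval_nat_numeral)
  from comp_expr_correct[OF this rd assms(3), of i ou] obtain m6 where 3:
    "(step P ^^ ?K) (conf (l + ?L + 4) ?m5 i ou) (conf (l + ?L + 4 + ?K) m6 i ou)"
    "m6 (tmp_cell 1) = eval f s" "same_below 1 ?m5 m6"
    by blast
  have rd6: "reads s m6"
    using 3(3) rd by (rule same_below_reads)
  have addr: "m6 (tmp_cell 0) = ?x * 16 + real (arr_index a)"
    using same_below_tmp[OF 3(3), of 0] by simp
  let ?m7 = "m6(arr_cell a (nat \<lfloor>?x\<rfloor>) := eval f s)"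
  have "exec (Store (tmp_cell 0) (tmp_cell 1)) (conf (l + ?L + 4 + ?K) m6 i ou) =
      Some (conf (l + ?L + 4 + ?K + 1) ?m7 i ou)"
    unfolding exec.simps using address_arith[OF assms(2), of a] addr 3(2)
    by (simp only: config.simps if_True put_def) simp
  then have 4: "(step P ^^ 1) (conf (l + ?L + 4 + ?K) m6 i ou) (conf (l + ?L + 4 + ?K + 1) ?m7 i ou)"
    using a(1) by (simp add: step_def add.assoc)
  let ?s = "s\<lparr>arrs := (arrs s)(a := (arrs s a)(nat \<lfloor>?x\<rfloor> := eval f s))\<rparr>"
  have rd7: "reads ?s ?m7"
    using rd6 by (auto simp: reads_def)
  from steps_trans[OF 1(1) steps_trans[OF 2 steps_trans[OF 3(1) 4]]]
  show "\<exists>t m' s'. t \<le> ?L + ?K + 5 \<and> (step P ^^ t) (conf l m i ou)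
      (conf (l + length (comp_com (SetAt a e f) l)) m' (inp s') (outp s')) \<and> reads s' m' \<and> Q s'"
    by (rule runI[where s = ?s]) (use rd7 assms(4) a(3,4) in simp_all)
qed

lemma reaches_IfEq:
  assumes "safe e s" "safe f s"
    "eval e s = eval f s \<Longrightarrow> reaches c T s Q" "eval e s \<noteq> eval f s \<Longrightarrow> reaches d T s Q"
  shows "reaches (IfEq e f c d) (length (comp_expr e 0) + length (comp_expr f 1) + T + 2) s Q"
proof (rule reachesI)
  fix P l m i ou
  let ?B = "comp_expr e 0 @ comp_expr f 1"
  let ?b = "l + length ?B"
  let ?D = "comp_com d (?b + 1)"
  let ?k = "?b + 1 + length ?D + 1"
  let ?C = "comp_com c ?k"
  assume a: "code_at P l (comp_com (IfEq e f c d) l)" "reads s m" "i = inp s" "ou = outp s"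
  have L: "l + length (comp_com (IfEq e f c d) l) = ?k + length ?C"
    by (simp add: Let_def algebra_simps)
  have code: "code_at P l ?B" "code_at P ?b [JumpEq (tmp_cell 0) (tmp_cell 1) ?k]"
    "code_at P (?b + 1) ?D" "code_at P (?b + 1 + length ?D) [Jump (?k + length ?C)]"
    "code_at P ?k ?C"
    using a(1) by (simp_all add: Let_def algebra_simps)
  from comp_expr_pair[OF code(1) a(2) assms(1,2), of i ou] obtain m1 where 1:
    "(step P ^^ length ?B) (conf l m i ou) (conf ?b m1 i ou)"
    "m1 (tmp_cell 0) = eval e s" "m1 (tmp_cell 1) = eval f s" "reads s m1"
    by blast
  show "\<exists>t m' s'. t \<le> length (comp_expr e 0) + length (comp_expr f 1) + T + 2 \<and>
      (step P ^^ t) (conf l m i ou)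
        (conf (l + length (comp_com (IfEq e f c d) l)) m' (inp s') (outp s')) \<and> reads s' m' \<and> Q s'"
  proof (cases "eval e s = eval f s")
    case True
    then have 2: "(step P ^^ 1) (conf ?b m1 i ou) (conf ?k m1 i ou)"
      using code(2) 1(2,3) by (auto simp: step_def)
    from reachesD[OF assms(3)[OF True] code(5) 1(4)] obtain t m2 s2 where 3: "t \<le> T"
      "(step P ^^ t) (conf ?k m1 i ou) (conf (?k + length ?C) m2 (inp s2) (outp s2))"
      "reads s2 m2" "Q s2"
      unfolding a(3,4) by blast
    from steps_trans[OF 1(1) steps_trans[OF 2 3(2)]] show ?thesis
      unfolding L by (rule runI) (use 3(1,3,4) in simp_all)
  next
    case False
    then have 2: "(step P ^^ 1) (conf ?b m1 i ou) (conf (?b + 1) m1 i ou)"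
      using code(2) 1(2,3) by (auto simp: step_def)
    from reachesD[OF assms(4)[OF False] code(3) 1(4)] obtain t m2 s2 where 3: "t \<le> T"
      "(step P ^^ t) (conf (?b + 1) m1 i ou) (conf (?b + 1 + length ?D) m2 (inp s2) (outp s2))"
      "reads s2 m2" "Q s2"
      unfolding a(3,4) by blast
    have 4: "(step P ^^ 1) (conf (?b + 1 + length ?D) m2 (inp s2) (outp s2))
        (conf (?k + length ?C) m2 (inp s2) (outp s2))"
      using code(4) by (auto simp: step_def)
    from steps_trans[OF 1(1) steps_trans[OF 2 steps_trans[OF 3(2) 4]]] show ?thesis
      unfolding L by (rule runI) (use 3(1,3,4) in simp_all)
  qed
qed

text \<open>The 2 is the same on both paths: an iteration pays the conditional jump and the jump
  back, the exit pays the conditional jump and the jump out.\<close>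

definition guard_cost :: "expr \<Rightarrow> expr \<Rightarrow> nat" where
  "guard_cost e f = length (comp_expr e 0) + length (comp_expr f 1) + 2"

text \<open>Every iteration pays for one guard, and one more guard ends the loop. The measure may
  drop by more than one, which permits an early exit.\<close>

lemma reaches_WhileLess:
  fixes r :: "state \<Rightarrow> nat"
  assumes "I s"
    and "\<And>s. I s \<Longrightarrow> safe e s \<and> safe f s"
    and "\<And>s. I s \<Longrightarrow> eval e s < eval f s \<Longrightarrow> reaches c T s (\<lambda>s'. I s' \<and> r s' < r s)"
    and "\<And>s. I s \<Longrightarrow> \<not> eval e s < eval f s \<Longrightarrow> Q s"
  shows "reaches (WhileLess e f c) (r s * (T + guard_cost e f) + guard_cost e f) s Q"
  using assms(1)
proof (induction "r s" arbitrary: s rule: less_induct)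
  case less
  show ?case
  proof (rule reachesI)
    fix P l m i ou
    let ?W = "WhileLess e f c"
    let ?G = "guard_cost e f"
    let ?B = "comp_expr e 0 @ comp_expr f 1"
    let ?b = "l + length ?B"
    let ?k = "?b + 2"
    let ?C = "comp_com c ?k"
    assume a: "code_at P l (comp_com ?W l)" "reads s m" "i = inp s" "ou = outp s"
    have L: "l + length (comp_com ?W l) = ?k + length ?C + 1"
      by (simp add: Let_def algebra_simps)
    have code: "code_at P l ?B"
      "code_at P ?b [JumpLess (tmp_cell 0) (tmp_cell 1) ?k, Jump (?k + length ?C + 1)]"
      "code_at P ?k ?C" "code_at P (?k + length ?C) [Jump l]"
      using a(1) by (simp_all add: Let_def algebra_simps)
    from assms(2)[OF less.prems] comp_expr_pair[OF code(1) a(2), of i ou] obtain m1 where 1: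
      "(step P ^^ length ?B) (conf l m i ou) (conf ?b m1 i ou)"
      "m1 (tmp_cell 0) = eval e s" "m1 (tmp_cell 1) = eval f s" "reads s m1"
      by blast
    have G: "length ?B + 2 = ?G"
      by (simp add: guard_cost_def)
    show "\<exists>t m' s'. t \<le> r s * (T + ?G) + ?G \<and> (step P ^^ t) (conf l m i ou)
        (conf (l + length (comp_com ?W l)) m' (inp s') (outp s')) \<and> reads s' m' \<and> Q s'"
    proof (cases "eval e s < eval f s")
      case False
      then have 2: "(step P ^^ 2) (conf ?b m1 i ou) (conf (?k + length ?C + 1) m1 i ou)"
        using code(2) 1(2,3)
        by (auto simp: numeral_eq_Suc step_def relpowp.simps(1) intro!: steps_Cons)
      from steps_trans[OF 1(1) 2] show ?thesis
        unfolding L G by (rule runI[where s = s]) (use assms(4)[OF less.prems False] 1(4) a(3,4) in simp_all)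
    next
      case True
      then have 2: "(step P ^^ 1) (conf ?b m1 i ou) (conf ?k m1 i ou)"
        using code(2) 1(2,3) by (auto simp: step_def)
      from reachesD[OF assms(3)[OF less.prems True] code(3) 1(4)] obtain t m2 s2 where 3: "t \<le> T"
        "(step P ^^ t) (conf ?k m1 i ou) (conf (?k + length ?C) m2 (inp s2) (outp s2))"
        "reads s2 m2" "I s2" "r s2 < r s"
        unfolding a(3,4) by blast
      have 4: "(step P ^^ 1) (conf (?k + length ?C) m2 (inp s2) (outp s2))
          (conf l m2 (inp s2) (outp s2))"
        using code(4) by (auto simp: step_def)
      from reachesD[OF less.hyps[OF 3(5,4)] a(1) 3(3)] obtain u m3 s3 where
        5: "u \<le> r s2 * (T + ?G) + ?G"
        "(step P ^^ u) (conf l m2 (inp s2) (outp s2))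
          (conf (l + length (comp_com ?W l)) m3 (inp s3) (outp s3))"
        "reads s3 m3" "Q s3"
        by blast
      let ?t = "length ?B + (1 + (t + (1 + u)))"
      \<comment> \<open>The drop of the measure by at least one pays for the iteration just
        executed.\<close>
      have "Suc (r s2) * (T + ?G) \<le> r s * (T + ?G)"
        using 3(5) by (intro mult_right_mono) auto
      then have "?t \<le> r s * (T + ?G) + ?G"
        using 3(1) 5(1) G by simp
      with steps_trans[OF 1(1) steps_trans[OF 2 steps_trans[OF 3(2) steps_trans[OF 4 5(2)]]]] 5(3,4)
      show ?thesis
        by blast
    qed
  qed
qed

section \<open>Cost and weakest preconditions of loop-free code\<close>

fun cost :: "com \<Rightarrow> nat" where
  "cost Skip = 0"
| "cost (Set x e) = length (comp_expr e 0) + 1"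
| "cost (SetAt a e f) = length (comp_expr e 0) + length (comp_expr f 1) + 5"
| "cost (Input x) = 1"
| "cost (Output e) = length (comp_expr e 0) + 1"
| "cost (Seq c d) = cost c + cost d"
| "cost (IfEq e f c d) =
     length (comp_expr e 0) + length (comp_expr f 1) + max (cost c) (cost d) + 2"
| "cost (WhileLess e f c) = 0"

text \<open>Weakest preconditions and \<^const>\<open>cost\<close> are meant for code without loops; loops are
  assigned the precondition \<^const>\<open>False\<close>.\<close>

fun wp :: "com \<Rightarrow> (state \<Rightarrow> bool) \<Rightarrow> state \<Rightarrow> bool" where
  "wp Skip Q s = Q s"
| "wp (Set x e) Q s = (safe e s \<and> Q (s\<lparr>vars := (vars s)(x := eval e s)\<rparr>))"
| "wp (SetAt a e f) Q s = (safe e s \<and> eval e s \<in> \<nat> \<and> safe f s \<and>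
     Q (s\<lparr>arrs := (arrs s)(a := (arrs s a)(nat \<lfloor>eval e s\<rfloor> := eval f s))\<rparr>))"
| "wp (Input x) Q s =
     (case inp s of [] \<Rightarrow> False | r # i \<Rightarrow> Q (s\<lparr>vars := (vars s)(x := r), inp := i\<rparr>))"
| "wp (Output e) Q s = (safe e s \<and> Q (s\<lparr>outp := outp s @ [eval e s]\<rparr>))"
| "wp (Seq c d) Q s = wp c (wp d Q) s"
| "wp (IfEq e f c d) Q s = (safe e s \<and> safe f s \<and>
     (if eval e s = eval f s then wp c Q s else wp d Q s))"
| "wp (WhileLess e f c) Q s = False"

text \<open>Turns the verification of a loop body into symbolic execution by simplification. The
  case of a loop is vacuous; loops go through \<open>reaches_WhileLess\<close>.\<close>

lemma reaches_wp: "wp c Q s \<Longrightarrow> reaches c (cost c) s Q"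
proof (induction c arbitrary: Q s)
  case (Seq c d)
  have "reaches c (cost c) s (wp d Q)"
    using Seq by simp
  then have "reaches c (cost c) s (\<lambda>s'. reaches d (cost d) s' Q)"
    by (rule reaches_mono) (auto intro: Seq.IH(2))
  then show ?case
    by (simp add: reaches_Seq)
next
  case (IfEq e f c d)
  have "reaches c (max (cost c) (cost d)) s Q" if "wp c Q s"
    using IfEq.IH(1)[OF that] by (rule reaches_mono) auto
  moreover have "reaches d (max (cost c) (cost d)) s Q" if "wp d Q s"
    using IfEq.IH(2)[OF that] by (rule reaches_mono) auto
  ultimately show ?case
    using IfEq.prems unfolding cost.simps wp.simps by (intro reaches_IfEq) auto
qed (auto intro: reaches_Skip reaches_Set[simplified] reaches_SetAt[simplified]
      reaches_Input[simplified] reaches_Output[simplified] split: list.splits)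

definition start :: "real list \<Rightarrow> state" where
  "start xs = \<lparr>vars = (\<lambda>_. 0), arrs = (\<lambda>_ _. 0), inp = xs, outp = []\<rparr>"

lemma reaches_computes_in:
  assumes "reaches c T (start xs) Q"
  shows "\<exists>t s. t \<le> T \<and> computes_in (comp_com c 0 @ [Halt]) xs t (outp s) \<and> Q s"
proof -
  let ?P = "comp_com c 0 @ [Halt]"
  have "code_at ?P 0 (comp_com c 0)"
    using code_at_extend[of "[]" "comp_com c 0" "[Halt]"] by simp
  moreover have "reads (start xs) (\<lambda>_. 0)"
    by (simp add: start_def reads_def)
  ultimately obtain t m' s' where t: "t \<le> T" and
    *: "(step ?P ^^ t) (conf 0 (\<lambda>_. 0) xs []) (conf (length (comp_com c 0)) m' (inp s') (outp s'))"
      "Q s'"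
    by (rule reachesD[OF assms]) (auto simp: start_def)
  have "halted ?P (conf (length (comp_com c 0)) m' (inp s') (outp s'))"
    by (simp add: halted_def)
  with *(1) have "computes_in ?P xs t (outp s')"
    unfolding computes_in_def initial_def by fastforce
  with t *(2) show ?thesis
    by blast
qed


section \<open>The triangular lattice\<close>

text \<open>Lattice points are pairs of integer coordinates with respect to two vectors of equal length at
  an angle of 60 degrees; \<open>x\<^sup>2 + x y + y\<^sup>2\<close> is the squared length in units of the edge.\<close>

definition unit_vec :: "int \<Rightarrow> int \<Rightarrow> bool" where
  "unit_vec x y \<longleftrightarrow> x * x + x * y + y * y = 1"

text \<open>Four times the form is \<open>(2 * x + y)\<^sup>2 + 3 * y\<^sup>2\<close>, and likewise
  with \<open>x\<close> and \<open>y\<close> exchanged, so both coordinates lie between -1 and 1.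
  The form is the norm of the Eisenstein integers and the six solutions are their units.\<close>

lemma unit_vec_iff:
  "unit_vec x y \<longleftrightarrow> (x, y) \<in> {(1, 0), (0, 1), (-1, 1), (-1, 0), (0, -1), (1, -1)}"
proof
  assume u: "unit_vec x y"
  have "(2 * x + y)\<^sup>2 + 3 * y\<^sup>2 = 4" "(2 * y + x)\<^sup>2 + 3 * x\<^sup>2 = 4"
    using u by (simp_all add: unit_vec_def power2_eq_square algebra_simps)
  then have "3 * y\<^sup>2 \<le> 4" "3 * x\<^sup>2 \<le> 4"
    by (metis zero_le_power2 le_add_same_cancel2)+
  then have "y\<^sup>2 \<le> 1\<^sup>2" "x\<^sup>2 \<le> 1\<^sup>2"
    by simp_all
  then have "\<bar>y\<bar> \<le> 1" "\<bar>x\<bar> \<le> 1"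
    by (metis abs_le_square_iff abs_1)+
  then have "y = -1 \<or> y = 0 \<or> y = 1" "x = -1 \<or> x = 0 \<or> x = 1"
    by linarith+
  then show "(x, y) \<in> {(1, 0), (0, 1), (-1, 1), (-1, 0), (0, -1), (1, -1)}"
    using u by (auto simp: unit_vec_def)
qed (auto simp: unit_vec_def)

lemma unit_vec_minus: "unit_vec (x - x') (y - y') \<longleftrightarrow> unit_vec (x' - x) (y' - y)"
  by (simp add: unit_vec_def algebra_simps)

text \<open>The two solutions are \<open>(dx, dy)\<close> rotated by 60 degrees in either direction,
  the apexes of the two equilateral triangles over one side.\<close>

lemma common_neighbour_cases:
  assumes "unit_vec dx dy" "unit_vec x y" "unit_vec (x - dx) (y - dy)"
  shows "(x = - dy \<and> y = dx + dy) \<or> (x = dx + dy \<and> y = - dx)"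
proof -
  consider "dx = 1" "dy = 0" | "dx = 0" "dy = 1" | "dx = -1" "dy = 1" | "dx = -1" "dy = 0"
    | "dx = 0" "dy = -1" | "dx = 1" "dy = -1"
    using assms(1) unfolding unit_vec_iff by auto
  then show ?thesis
    by cases (use assms(2,3) in \<open>auto simp: unit_vec_iff\<close>)
qed

lemma unit_vec_apex:
  assumes "unit_vec dx dy"
  shows "unit_vec (- dy) (dx + dy)" "unit_vec (- dy - dx) dx"
    "unit_vec (dx + dy) (- dx)" "unit_vec dy (- dx - dy)"
  using assms by (simp_all add: unit_vec_def algebra_simps)

lemma int_in_unit_interval:
  fixes t :: real
  assumes "0 \<le> t" "t \<le> 1" "t \<in> \<int>"
  shows "t = 0 \<or> t = 1"
proof -
  from assms(3) obtain k where "t = of_int k"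
    by (elim Ints_cases)
  with assms(1,2) show ?thesis
    by auto
qed

text \<open>A unit vector has a coordinate 1 or -1, so \<open>t\<close> is an integer up to sign and
  cannot lie strictly between 0 and 1.\<close>

lemma lattice_vertex_on_edge:
  fixes t :: real
  assumes "unit_vec dx dy" "0 \<le> t" "t \<le> 1"
    and "of_int x = t * of_int dx" "of_int y = t * of_int dy"
  shows "t = 0 \<or> t = 1"
proof (rule int_in_unit_interval)
  have "t = of_int x \<or> t = of_int (- x) \<or> t = of_int y \<or> t = of_int (- y)"
    using assms(1,4,5) unfolding unit_vec_iff by auto
  then show "t \<in> \<int>"
    by (metis Ints_of_int)
qed (use assms in auto)

lemma unit_vec_cross:
  assumes "unit_vec dx dy" "unit_vec gx gy"
  obtains "dx * gy - dy * gx = 1" | "dx * gy - dy * gx = -1"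
    | "gx = dx" "gy = dy" | "gx = - dx" "gy = - dy"
  using assms unfolding unit_vec_iff by auto

text \<open>For non-parallel directions the determinant is 1 or -1, and Cramer's rule makes
  \<open>t\<close> and \<open>s\<close> integers. For parallel ones the difference or the sum of
  \<open>t\<close> and \<open>s\<close> is an integer: one value means that the segments coincide,
  the others that they touch at end points.\<close>

lemma lattice_edges_meet:
  fixes t s :: real
  assumes d: "unit_vec dx dy" and g: "unit_vec gx gy"
    and t: "0 \<le> t" "t \<le> 1" and s: "0 \<le> s" "s \<le> 1"
    and eq: "t * of_int dx = of_int x + s * of_int gx" "t * of_int dy = of_int y + s * of_int gy"
  shows "(t = 0 \<or> t = 1) \<and> (s = 0 \<or> s = 1) \<or>
    x = 0 \<and> y = 0 \<and> gx = dx \<and> gy = dy \<or>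
    x = dx \<and> y = dy \<and> gx = - dx \<and> gy = - dy"
proof -
  let ?D = "dx * gy - dy * gx"
  have tD: "t * of_int ?D = of_int (x * gy - y * gx)"
  proof -
    have "t * of_int ?D = (t * of_int dx) * of_int gy - (t * of_int dy) * of_int gx"
      by (simp add: algebra_simps)
    also have "\<dots> = of_int (x * gy - y * gx)"
      unfolding eq by (simp add: algebra_simps)
    finally show ?thesis .
  qed
  have sD: "s * of_int ?D = of_int (x * dy - y * dx)"
  proof -
    have "s * of_int ?D =
        (t * of_int dy - s * of_int gy - of_int y) * (- of_int dx) - of_int y * of_int dx
        + (t * of_int dx - s * of_int gx - of_int x) * of_int dy + of_int x * of_int dy"
      by (simp add: algebra_simps)
    also have "\<dots> = of_int (x * dy - y * dx)"
      unfolding eq by (simp add: algebra_simps)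
    finally show ?thesis .
  qed
  from d g show ?thesis
  proof (cases rule: unit_vec_cross)
    case 1
    then have "t \<in> \<int>" "s \<in> \<int>"
      using tD sD by (metis Ints_of_int mult.right_neutral of_int_1)+
    with t s show ?thesis
      using int_in_unit_interval by blast
  next
    case 2
    then have "t = of_int (- (x * gy - y * gx))" "s = of_int (- (x * dy - y * dx))"
      using tD sD by simp_all
    then have "t \<in> \<int>" "s \<in> \<int>"
      by (metis Ints_of_int)+
    with t s show ?thesis
      using int_in_unit_interval by blast
  next
    case 3
    have e: "of_int x = (t - s) * of_int dx" "of_int y = (t - s) * of_int dy"
      using eq 3 by (simp_all add: algebra_simps)
    obtain k where k: "t - s = of_int k"
    proof -
      have "t - s = of_int x \<or> t - s = of_int (- x) \<or> t - s = of_int y \<or> t - s = of_int (- y)"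
        using d e unfolding unit_vec_iff by auto
      then show ?thesis
        using that by blast
    qed
    with t s have "k = -1 \<or> k = 0 \<or> k = 1"
      by linarith
    then show ?thesis
      using e k 3 t s by auto
  next
    case 4
    have e: "of_int x = (t + s) * of_int dx" "of_int y = (t + s) * of_int dy"
      using eq 4 by (simp_all add: algebra_simps)
    obtain k where k: "t + s = of_int k"
    proof -
      have "t + s = of_int x \<or> t + s = of_int (- x) \<or> t + s = of_int y \<or> t + s = of_int (- y)"
        using d e unfolding unit_vec_iff by auto
      then show ?thesis
        using that by blast
    qed
    with t s have "k = 0 \<or> k = 1 \<or> k = 2"
      by linarith
    then show ?thesis
      using e k 4 t s by auto
  qed
qed

text \<open>The coordinates are real, so that inner points of edges have this form as well and
  intersections can be computed in coordinates.\<close>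

definition lattice_point :: "real \<Rightarrow> real \<Rightarrow> real \<Rightarrow> real \<times> real" where
  "lattice_point w x y = (w * (x + y / 2), w * y * (sqrt 3 / 2))"

lemma lattice_point_inject [simp]: "w > 0 \<Longrightarrow> lattice_point w x y = lattice_point w x' y' \<longleftrightarrow> x = x' \<and> y = y'"
  by (auto simp: lattice_point_def)

lemma dist_lattice_point:
  assumes "w > 0" "unit_vec (x' - x) (y' - y)"
  shows "dist (lattice_point w (of_int x) (of_int y)) (lattice_point w (of_int x') (of_int y')) = w"
proof -
  define dx dy where "dx = real_of_int (x' - x)" and "dy = real_of_int (y' - y)"
  have "dx * dx + dx * dy + dy * dy = of_int ((x' - x) * (x' - x) + (x' - x) * (y' - y) + (y' - y) * (y' - y))"
    by (simp add: dx_def dy_def)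
  with assms(2) have u: "dx * dx + dx * dy + dy * dy = 1"
    by (simp add: unit_vec_def)
  have "dist (lattice_point w (of_int x) (of_int y)) (lattice_point w (of_int x') (of_int y')) =
      sqrt ((w * (dx + dy / 2))\<^sup>2 + (w * dy * (sqrt 3 / 2))\<^sup>2)"
    unfolding lattice_point_def dist_Pair_Pair dist_real_def power2_abs dx_def dy_def
    by (simp add: power2_eq_square algebra_simps diff_divide_distrib)
  also have "(w * (dx + dy / 2))\<^sup>2 + (w * dy * (sqrt 3 / 2))\<^sup>2 = w\<^sup>2 * (dx * dx + dx * dy + dy * dy)"
    by (simp add: power_mult_distrib power_divide) (simp add: power2_eq_square field_simps)
  finally show ?thesis
    using u assms(1) by simp
qed

lemma lattice_point_segment:
  assumes "z \<in> closed_segment (lattice_point w x y) (lattice_point w x' y')"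
  obtains t where "0 \<le> t" "t \<le> 1" "z = lattice_point w (x + t * (x' - x)) (y + t * (y' - y))"
proof -
  from assms obtain t where "0 \<le> t" "t \<le> 1"
    "z = (1 - t) *\<^sub>R lattice_point w x y + t *\<^sub>R lattice_point w x' y'"
    by (auto simp: in_segment)
  then show ?thesis
    by (intro that[of t]) (auto simp: lattice_point_def algebra_simps diff_divide_distrib add_divide_distrib)
qed

lemma edge_segment_eq: "edge_segment p {u, v} = closed_segment (p u) (p v)"
  by (simp add: edge_segment_def segment_convex_hull)


subsection \<open>Lattice drawings\<close>

definition lattice_drawing ::
    "'a set \<Rightarrow> 'a set set \<Rightarrow> ('a \<Rightarrow> int) \<Rightarrow> ('a \<Rightarrow> int) \<Rightarrow> bool" where
  "lattice_drawing V E x y \<longleftrightarrow>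
     inj_on (\<lambda>v. (x v, y v)) V \<and> (\<forall>u v. {u, v} \<in> E \<longrightarrow> unit_vec (x v - x u) (y v - y u))"

text \<open>Since \<open>lattice_point w\<close> is injective, incidences become the coordinate
  equations of \<open>lattice_vertex_on_edge\<close> and \<open>lattice_edges_meet\<close>.
  Injectivity of the placement then turns equal positions into equal vertices, and coinciding
  segments into equal edges.\<close>

lemma lattice_drawing_planar_realization:
  fixes x y :: "'a \<Rightarrow> int"
  assumes dr: "lattice_drawing V E x y" and w: "w > 0"
    and E: "\<And>e. e \<in> E \<Longrightarrow> e \<subseteq> V \<and> card e = 2" and len: "\<And>e. e \<in> E \<Longrightarrow> len e = w"
  shows "planar_realization V E len (\<lambda>v. lattice_point w (of_int (x v)) (of_int (y v)))"
proof -
  let ?p = "\<lambda>v. lattice_point w (of_int (x v)) (of_int (y v))"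
  have inj: "u = v" if "u \<in> V" "v \<in> V" "x u = x v" "y u = y v" for u v
    using dr that by (auto simp: lattice_drawing_def inj_on_def)
  have unit: "unit_vec (x v - x u) (y v - y u)" if "{u, v} \<in> E" for u v
    using dr that by (auto simp: lattice_drawing_def)
  have "inj_on ?p V"
    using w inj by (auto intro!: inj_onI)
  moreover have "v \<in> e" if v: "v \<in> V" and e: "e \<in> E" and ve: "?p v \<in> edge_segment ?p e" for v e
  proof -
    from E[OF e] obtain a b where ab: "e = {a, b}" "a \<in> V" "b \<in> V"
      by (auto simp: card_2_iff)
    from ve obtain t :: real where t: "0 \<le> t" "t \<le> 1" "?p v =
        lattice_point w (of_int (x a) + t * (of_int (x b) - of_int (x a)))
          (of_int (y a) + t * (of_int (y b) - of_int (y a)))"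
      unfolding ab(1) edge_segment_eq by (rule lattice_point_segment)
    then have eq: "of_int (x v - x a) = t * of_int (x b - x a)"
        "of_int (y v - y a) = t * of_int (y b - y a)"
      using w by simp_all
    from lattice_vertex_on_edge[OF unit t(1,2) eq] e ab(1) have "t = 0 \<or> t = 1"
      by simp
    then have "v = a \<or> v = b"
      using eq inj[OF v ab(2)] inj[OF v ab(3)] by auto
    then show ?thesis
      using ab(1) by simp
  qed
  moreover have "edge_segment ?p e \<inter> edge_segment ?p f = ?p ` (e \<inter> f)"
    if e: "e \<in> E" and f: "f \<in> E" and ne: "e \<noteq> f" for e f
  proof
    show "?p ` (e \<inter> f) \<subseteq> edge_segment ?p e \<inter> edge_segment ?p f"
      by (auto simp: edge_segment_def intro: hull_inc)
    show "edge_segment ?p e \<inter> edge_segment ?p f \<subseteq> ?p ` (e \<inter> f)"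
    proof
      fix z
      assume z: "z \<in> edge_segment ?p e \<inter> edge_segment ?p f"
      from E[OF e] obtain a b where ab: "e = {a, b}" "a \<in> V" "b \<in> V"
        by (auto simp: card_2_iff)
      from E[OF f] obtain c d where cd: "f = {c, d}" "c \<in> V" "d \<in> V"
        by (auto simp: card_2_iff)
      from z obtain t :: real where t: "0 \<le> t" "t \<le> 1"
        "z = lattice_point w (of_int (x a) + t * (of_int (x b) - of_int (x a)))
          (of_int (y a) + t * (of_int (y b) - of_int (y a)))"
        unfolding ab(1) edge_segment_eq by (auto elim: lattice_point_segment)
      from z obtain s :: real where s: "0 \<le> s" "s \<le> 1"
        "z = lattice_point w (of_int (x c) + s * (of_int (x d) - of_int (x c)))
          (of_int (y c) + s * (of_int (y d) - of_int (y c)))"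
        unfolding cd(1) edge_segment_eq by (auto elim: lattice_point_segment)
      have eq: "t * of_int (x b - x a) = of_int (x c - x a) + s * of_int (x d - x c)"
        "t * of_int (y b - y a) = of_int (y c - y a) + s * of_int (y d - y c)"
        using t(3) s(3) w by auto
      have "unit_vec (x b - x a) (y b - y a)" "unit_vec (x d - x c) (y d - y c)"
        using unit e f ab(1) cd(1) by auto
      from lattice_edges_meet[OF this t(1,2) s(1,2) eq]
      consider "t = 0 \<or> t = 1" "s = 0 \<or> s = 1"
        | "x c = x a" "y c = y a" "x d = x b" "y d = y b"
        | "x c = x b" "y c = y b" "x d = x a" "y d = y a"
        by force
      then show "z \<in> ?p ` (e \<inter> f)"
      proof cases
        case 1
        then have "z \<in> ?p ` e" "z \<in> ?p ` f"
          using t(3) s(3) ab(1) cd(1) by auto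
        then obtain u v where uv: "u \<in> e" "v \<in> f" "z = ?p u" "z = ?p v"
          by blast
        then have "?p u = ?p v" "u \<in> V" "v \<in> V"
          using E[OF e] E[OF f] by auto
        then have "u = v"
          using w inj by simp
        with uv show ?thesis
          by blast
      next
        case 2
        then have "e = f"
          using inj ab cd by metis
        with ne show ?thesis by simp
      next
        case 3
        then have "e = f"
          using inj ab cd by (metis insert_commute)
        with ne show ?thesis by simp
      qed
    qed
  qed
  moreover have "dist (?p u) (?p v) = len {u, v}" if "{u, v} \<in> E" for u v
    using dist_lattice_point[OF w unit[OF that]] len[OF that] by simp
  ultimately show ?thesis
    by (auto simp: planar_realization_def planar_straight_line_drawing_def)
qed


subsection \<open>Rigidity\<close>

text \<open>\<open>D\<close> is the determinant of \<open>b\<close> and \<open>e\<close>, nonzero by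
  Lagrange's identity; Cramer's rule does the rest.\<close>

lemma orthogonal_complement_trivial:
  fixes b e z :: "real \<times> real"
  assumes "b \<noteq> 0" "e \<noteq> 0" "e \<bullet> b = 0" "z \<bullet> b = 0" "z \<bullet> e = 0"
  shows "z = 0"
proof -
  obtain b1 b2 e1 e2 z1 z2 where c: "b = (b1, b2)" "e = (e1, e2)" "z = (z1, z2)"
    by (cases b, cases e, cases z)
  define D where "D = b1 * e2 - b2 * e1"
  have "D\<^sup>2 = (b1\<^sup>2 + b2\<^sup>2) * (e1\<^sup>2 + e2\<^sup>2) - (e \<bullet> b)\<^sup>2"
    by (simp add: c D_def power2_eq_square algebra_simps)
  moreover have "b1\<^sup>2 + b2\<^sup>2 \<noteq> 0" "e1\<^sup>2 + e2\<^sup>2 \<noteq> 0"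
    using assms(1,2) by (auto simp: c zero_prod_def sum_power2_eq_zero_iff)
  ultimately have D: "D \<noteq> 0"
    using assms(3) by auto
  have "z1 * D = (z \<bullet> b) * e2 - (z \<bullet> e) * b2" "z2 * D = (z \<bullet> e) * b1 - (z \<bullet> b) * e1"
    by (simp_all add: c D_def algebra_simps)
  with assms(4,5) have "z1 * D = 0" "z2 * D = 0"
    by simp_all
  with D show ?thesis
    by (simp add: c zero_prod_def)
qed

text \<open>Relative to \<open>A\<close>, both \<open>c\<close> and \<open>d\<close> have the inner
  product \<open>w\<^sup>2 / 2\<close> with \<open>b\<close>. So \<open>c + d - b\<close> is
  orthogonal to \<open>b\<close>, and also to \<open>c - d\<close> because \<open>c\<close> and
  \<open>d\<close> are equally long. These two directions are orthogonal and span the plane.\<close>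

lemma rhombus:
  fixes A B C D :: "real \<times> real"
  assumes "w > 0" "dist A B = w" "dist C A = w" "dist C B = w" "dist D A = w" "dist D B = w" "C \<noteq> D"
  shows "D = A + B - C"
proof -
  define b c d where "b = B - A" and "c = C - A" and "d = D - A"
  have sq: "b \<bullet> b = w\<^sup>2" "c \<bullet> c = w\<^sup>2" "d \<bullet> d = w\<^sup>2"
    "(c - b) \<bullet> (c - b) = w\<^sup>2" "(d - b) \<bullet> (d - b) = w\<^sup>2"
    using assms(2-6) by (simp_all add: b_def c_def d_def dist_norm norm_minus_commute power2_norm_eq_inner[symmetric])
  have "c + d - b = 0"
  proof (rule orthogonal_complement_trivial)
    show "b \<noteq> 0" using sq(1) assms(1) by auto
    show "c - d \<noteq> 0" using assms(7) by (simp add: c_def d_def)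
    show "(c - d) \<bullet> b = 0" "(c + d - b) \<bullet> b = 0" "(c + d - b) \<bullet> (c - d) = 0"
      using sq by (simp_all add: inner_diff_left inner_diff_right inner_add_left inner_add_right inner_commute)
  qed
  then show ?thesis
    by (simp add: b_def c_def d_def algebra_simps)
qed


section \<open>Elimination orders of 2-trees\<close>

text \<open>Starting from a single edge instead of a triangle makes every step of an elimination, down to
  the last edge, uniform.\<close>

inductive edge_tree :: "'a set \<Rightarrow> 'a set set \<Rightarrow> bool" where
  edge: "a \<noteq> b \<Longrightarrow> edge_tree {a, b} {{a, b}}"
| grow: "\<lbrakk>edge_tree V E; {u, w} \<in> E; v \<notin> V\<rbrakk> \<Longrightarrow> edge_tree (insert v V) (E \<union> {{v, u}, {v, w}})"

definition nbrs :: "'a set set \<Rightarrow> 'a \<Rightarrow> 'a set" where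
  "nbrs E v = {u. {v, u} \<in> E}"

lemma edge_tree_finite: "edge_tree V E \<Longrightarrow> finite V \<and> finite E"
  by (induction rule: edge_tree.induct) auto

lemma edge_tree_edge: "edge_tree V E \<Longrightarrow> e \<in> E \<Longrightarrow> e \<subseteq> V \<and> card e = 2"
proof (induction arbitrary: e rule: edge_tree.induct)
  case (grow V E u w v)
  from grow.IH[OF grow.hyps(2)] have "u \<in> V" "w \<in> V"
    by auto
  with grow show ?case
    by (auto simp: card_insert_if)
qed auto

lemma edge_tree_pair:
  assumes "edge_tree V E" "{u, w} \<in> E"
  shows "u \<in> V" "w \<in> V" "u \<noteq> w"
  using edge_tree_edge[OF assms] by auto

lemma card_edge_tree: "edge_tree V E \<Longrightarrow> 2 \<le> card V \<and> card E + 3 = 2 * card V"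
proof (induction rule: edge_tree.induct)
  case (grow V E u w v)
  note uw = edge_tree_pair[OF grow.hyps(1,2)] and fin = edge_tree_finite[OF grow.hyps(1)]
  have "{v, u} \<notin> E" "{v, w} \<notin> E"
    using edge_tree_pair[OF grow.hyps(1)] grow.hyps(3) by blast+
  moreover have "{v, u} \<noteq> {v, w}"
    using uw grow.hyps(3) by (auto simp: doubleton_eq_iff)
  ultimately have "card (E \<union> {{v, u}, {v, w}}) = card E + 2"
    using fin by (simp add: insert_commute)
  with grow fin show ?case
    by simp
qed (auto simp: card_insert_if)

lemma two_tree_edge_tree: "two_tree V E \<Longrightarrow> edge_tree V E \<and> 3 \<le> card V"
proof (induction rule: two_tree.induct)
  case (triangle a b c)
  have "edge_tree (insert c {a, b}) ({{a, b}} \<union> {{c, a}, {c, b}})"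
    using triangle by (intro edge_tree.grow edge_tree.edge) auto
  moreover have "insert c {a, b} = {a, b, c}" "{{a, b}} \<union> {{c, a}, {c, b}} = {{a, b}, {b, c}, {a, c}}"
    by (auto simp: insert_commute)
  ultimately show ?case
    using triangle by simp
next
  case (extend V E u w v)
  then have "edge_tree (insert v V) (E \<union> {{v, u}, {v, w}})"
    by (intro edge_tree.grow) auto
  with extend show ?case
    using edge_tree_finite[of V E] by auto
qed

lemma nbrs_sym: "u \<in> nbrs E v \<longleftrightarrow> v \<in> nbrs E u"
  by (simp add: nbrs_def insert_commute)

lemma nbrs_subset: "edge_tree V E \<Longrightarrow> nbrs E v \<subseteq> V"
  by (auto simp: nbrs_def dest: edge_tree_pair(2))

lemma finite_nbrs: "edge_tree V E \<Longrightarrow> finite (nbrs E v)"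
  using edge_tree_finite nbrs_subset finite_subset by metis

lemma nbrs_self:
  assumes "edge_tree V E"
  shows "v \<notin> nbrs E v"
proof
  assume "v \<in> nbrs E v"
  then have "{v, v} \<in> E"
    unfolding nbrs_def by (rule CollectD)
  from edge_tree_pair(3)[OF assms this] show False
    by simp
qed

lemma nbrs_grow:
  assumes "edge_tree V E" "{u, w} \<in> E" "v \<notin> V"
  shows "nbrs (E \<union> {{v, u}, {v, w}}) v = {u, w}"
    and "x \<noteq> v \<Longrightarrow> nbrs (E \<union> {{v, u}, {v, w}}) x = nbrs E x \<union> (if x = u \<or> x = w then {v} else {})"
  using edge_tree_pair[OF assms(1)] assms(2,3) by (auto simp: nbrs_def doubleton_eq_iff)

lemma edge_tree_two:
  assumes "edge_tree V E" "card V = 2"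
  obtains a b where "a \<noteq> b" "V = {a, b}" "E = {{a, b}}"
  using assms
proof (cases rule: edge_tree.cases)
  case (grow V' E' u w v')
  with assms card_edge_tree[of V' E'] edge_tree_finite[of V' E'] show ?thesis
    by auto
qed

lemma card_nbrs_edge:
  assumes "edge_tree V E" "card V = 2" "v \<in> V"
  shows "card (nbrs E v) = 1"
proof -
  from edge_tree_two[OF assms(1,2)] obtain a b where "a \<noteq> b" "V = {a, b}" "E = {{a, b}}"
    by metis
  with assms(3) have "nbrs E v = (if v = a then {b} else {a})"
    by (auto simp: nbrs_def doubleton_eq_iff)
  then show ?thesis by simp
qed

lemma card_nbrs_pos: "edge_tree V E \<Longrightarrow> v \<in> V \<Longrightarrow> 1 \<le> card (nbrs E v)"
proof (induction rule: edge_tree.induct)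
  case (edge a b)
  then show ?case
    using card_nbrs_edge[OF edge_tree.edge[OF edge(1)], of v] by (simp add: card_insert_if)
next
  case (grow V E u w x)
  have fin: "finite (nbrs E v)"
    using finite_nbrs[OF grow.hyps(1)] .
  show ?case
  proof (cases "v = x")
    case True
    with nbrs_grow(1)[OF grow.hyps] show ?thesis
      by (simp add: card_insert_if)
  next
    case False
    with nbrs_grow(2)[OF grow.hyps False] grow fin show ?thesis
      by (auto simp: card_insert_if)
  qed
qed

text \<open>A vertex added by \<open>grow\<close> arrives with two neighbours; the ends of the
  initial edge start with one and get their second from the first vertex attached.\<close>

lemma card_nbrs_ge_2: "edge_tree V E \<Longrightarrow> 3 \<le> card V \<Longrightarrow> v \<in> V \<Longrightarrow> 2 \<le> card (nbrs E v)"
proof (induction rule: edge_tree.induct)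
  case (grow V E u w x)
  note uw = edge_tree_pair[OF grow.hyps(1,2)]
  have fin: "finite (nbrs E v)" "x \<notin> nbrs E v" "finite V"
    using finite_nbrs[OF grow.hyps(1)] nbrs_subset[OF grow.hyps(1), of v] grow.hyps(3)
      edge_tree_finite[OF grow.hyps(1)] by auto
  show ?case
  proof (cases "v = x")
    case True
    with nbrs_grow(1)[OF grow.hyps] uw show ?thesis
      by simp
  next
    case False
    then have v: "v \<in> V"
      using grow.prems by simp
    note nb = nbrs_grow(2)[OF grow.hyps False]
    show ?thesis
    proof (cases "3 \<le> card V")
      case True
      with grow.IH[OF True v] nb fin show ?thesis
        by simp
    next
      case False
      with card_edge_tree[OF grow.hyps(1)] have "card V = 2"
        by simp
      with edge_tree_two[OF grow.hyps(1)] obtain a b where "V = {a, b}"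
        by metis
      with uw v have "v = u \<or> v = w"
        by auto
      with nb fin card_nbrs_pos[OF grow.hyps(1) v] show ?thesis
        by simp
    qed
  qed
qed (simp add: card_insert_if)

lemma ex_degree_2:
  assumes "edge_tree V E" "3 \<le> card V"
  shows "\<exists>v\<in>V. card (nbrs E v) = 2"
  using assms(1)
proof (cases rule: edge_tree.cases)
  case (edge a b)
  with assms(2) show ?thesis
    by (simp add: card_insert_if)
next
  case (grow V' E' u w v)
  with nbrs_grow(1)[OF grow(3-5)] edge_tree_pair[OF grow(3,4)] show ?thesis
    by (intro bexI[of _ v]) auto
qed

text \<open>An edge at a new vertex forms a triangle with the other end of the edge it was attached
  to; the initial edge gets its triangle from the first vertex attached.\<close>

lemma edge_in_triangle: "edge_tree V E \<Longrightarrow> 3 \<le> card V \<Longrightarrow> {a, b} \<in> E \<Longrightarrow> \<exists>x. {a, x} \<in> E \<and> {b, x} \<in> E"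
proof (induction arbitrary: a b rule: edge_tree.induct)
  case (grow V E u w v)
  show ?case
  proof (cases "{a, b} \<in> E")
    case True
    show ?thesis
    proof (cases "3 \<le> card V")
      case False
      with card_edge_tree[OF grow.hyps(1)] have "card V = 2"
        by simp
      with edge_tree_two[OF grow.hyps(1)] obtain c d where "E = {{c, d}}"
        by metis
      with True grow.hyps(2) have "{a, b} = {u, w}"
        by auto
      then show ?thesis
        by (intro exI[of _ v]) (auto simp: doubleton_eq_iff insert_commute)
    qed (use grow.IH True in blast)
  next
    case False
    with grow.prems have "{a, b} = {v, u} \<or> {a, b} = {v, w}"
      by auto
    then consider "a = v" "b = u" | "a = u" "b = v" | "a = v" "b = w" | "a = w" "b = v"
      by (auto simp: doubleton_eq_iff)
    then show ?thesis
    proof cases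
      case 1
      then show ?thesis using grow.hyps(2) by (intro exI[of _ w]) (auto simp: insert_commute)
    next
      case 2
      then show ?thesis using grow.hyps(2) by (intro exI[of _ w]) (auto simp: insert_commute)
    next
      case 3
      then show ?thesis using grow.hyps(2) by (intro exI[of _ u]) (auto simp: insert_commute)
    next
      case 4
      then show ?thesis using grow.hyps(2) by (intro exI[of _ u]) (auto simp: insert_commute)
    qed
  qed
qed (simp add: card_insert_if)

text \<open>This frees the elimination from the unknown construction order. If \<open>v\<close> is
  older than the last vertex \<open>x\<close>, then \<open>x\<close> does not hang on
  \<open>v\<close>, so deleting \<open>v\<close> commutes with adding \<open>x\<close>. The
  exception is the triangle, which is treated directly.\<close>

lemma edge_tree_remove:
  "edge_tree V E \<Longrightarrow> 3 \<le> card V \<Longrightarrow> v \<in> V \<Longrightarrow> nbrs E v = {a, b} \<Longrightarrow> a \<noteq> b \<Longrightarrow>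
    edge_tree (V - {v}) {e \<in> E. v \<notin> e} \<and> {a, b} \<in> E"
proof (induction rule: edge_tree.induct)
  case (grow V E u w x)
  let ?E = "E \<union> {{x, u}, {x, w}}"
  note uw = edge_tree_pair[OF grow.hyps(1,2)]
  have x: "x \<notin> e" if "e \<in> E" for e
    using edge_tree_edge[OF grow.hyps(1) that] grow.hyps(3) by auto
  show ?case
  proof (cases "v = x")
    case True
    have "{u, w} = {a, b}"
      using nbrs_grow(1)[OF grow.hyps] grow.prems(3) True by simp
    moreover have "insert x V - {v} = V" "{e \<in> ?E. v \<notin> e} = E"
      using True grow.hyps(3) x by auto
    ultimately show ?thesis
      using grow.hyps(1,2) by auto
  next
    case False
    then have v: "v \<in> V"
      using grow.prems by simp
    note nb = nbrs_grow(2)[OF grow.hyps False]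
    have fin: "finite (nbrs E v)" "x \<notin> nbrs E v"
      using finite_nbrs[OF grow.hyps(1)] nbrs_subset[OF grow.hyps(1), of v] grow.hyps(3) by auto
    show ?thesis
    proof (cases "3 \<le> card V")
      case True
      have "card (nbrs ?E v) = 2"
        unfolding grow.prems(3) using grow.prems(4) by simp
      \<comment> \<open>\<open>v\<close> had two neighbours before \<open>x\<close> came, so an edge
        to \<open>x\<close> would give it a third.\<close>
      then have vuw: "v \<noteq> u" "v \<noteq> w"
        using card_nbrs_ge_2[OF grow.hyps(1) True v] nb fin by auto
      then have "nbrs E v = {a, b}"
        using nb grow.prems(3) by simp
      with grow.IH[OF True v _ grow.prems(4)]
      have IH: "edge_tree (V - {v}) {e \<in> E. v \<notin> e}" "{a, b} \<in> E"
        by auto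
      have "edge_tree (insert x (V - {v})) ({e \<in> E. v \<notin> e} \<union> {{x, u}, {x, w}})"
        using grow.hyps vuw by (intro edge_tree.grow IH(1)) auto
      moreover have "insert x V - {v} = insert x (V - {v})"
        "{e \<in> ?E. v \<notin> e} = {e \<in> E. v \<notin> e} \<union> {{x, u}, {x, w}}"
        using False vuw by auto
      ultimately show ?thesis
        using IH(2) by simp
    next
      case F3: False
      with card_edge_tree[OF grow.hyps(1)] have "card V = 2"
        by simp
      with edge_tree_two[OF grow.hyps(1)] obtain c d where cd: "c \<noteq> d" "V = {c, d}" "E = {{c, d}}"
        by metis
      \<comment> \<open>The tree is a triangle on \<open>v\<close>, \<open>x\<close> and
        \<open>y\<close>; what remains is the edge opposite to \<open>v\<close>.\<close>
      define y where "y = (if v = u then w else u)"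
      have y: "V = {v, y}" "E = {{v, y}}" "v \<noteq> y" "{u, w} = {v, y}"
        using uw v cd grow.hyps(2) by (auto simp: y_def doubleton_eq_iff)
      have xy: "x \<noteq> y" "x \<noteq> v"
        using y(1) grow.hyps(3) by auto
      have E: "?E = {{v, y}, {x, v}, {x, y}}"
        using y(2,4) by (auto simp: doubleton_eq_iff)
      have "nbrs ?E v = {x, y}"
        unfolding E using xy y(3) by (auto simp: nbrs_def doubleton_eq_iff)
      with grow.prems(3) have "{a, b} = {x, y}"
        by simp
      moreover have "insert x V - {v} = {x, y}" "{e \<in> ?E. v \<notin> e} = {{x, y}}"
        unfolding E using y xy by auto
      moreover have "{x, y} \<in> ?E"
        unfolding E by simp
      ultimately show ?thesis
        using edge_tree.edge[OF xy(1)] by (simp only:)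
    qed
  qed
qed (simp add: card_insert_if)

section \<open>Sequences of vertex eliminations\<close>

definition without :: "'a set set \<Rightarrow> 'a set \<Rightarrow> 'a set set" where
  "without E S = {e \<in> E. e \<inter> S = {}}"

text \<open>Read backwards, \<open>q\<close> is a construction order in which \<open>q i\<close> is
  attached to the edge from \<open>f i\<close> to \<open>g i\<close>.\<close>

definition peeling ::
    "'a set \<Rightarrow> 'a set set \<Rightarrow> (nat \<Rightarrow> 'a) \<Rightarrow> (nat \<Rightarrow> 'a) \<Rightarrow> (nat \<Rightarrow> 'a) \<Rightarrow> nat \<Rightarrow> bool" where
  "peeling V E q f g k \<longleftrightarrow>
     (\<forall>i<k. q i \<in> V - q ` {..<i} \<and> f i \<noteq> g i \<and>
        nbrs (without E (q ` {..<i})) (q i) = {f i, g i})"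

lemma without_insert: "without E (insert v S) = {e \<in> without E S. v \<notin> e}"
  by (auto simp: without_def)

lemma without_empty [simp]: "without E {} = E"
  by (simp add: without_def)

lemma peeling_Suc:
  "peeling V E q f g (Suc k) \<longleftrightarrow> peeling V E q f g k \<and>
     q k \<in> V - q ` {..<k} \<and> f k \<noteq> g k \<and> nbrs (without E (q ` {..<k})) (q k) = {f k, g k}"
  by (auto simp: peeling_def less_Suc_eq)

text \<open>The bound on \<open>k\<close> guarantees three vertices before each removal, as
  \<open>edge_tree_remove\<close> demands.\<close>

lemma peeling_edge_tree:
  assumes "edge_tree V E" "peeling V E q f g k" "k + 2 \<le> card V"
  shows "edge_tree (V - q ` {..<k}) (without E (q ` {..<k}))"
    and "card (V - q ` {..<k}) = card V - k"
  using assms(2,3)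
proof (induction k)
  case (Suc k)
  let ?V = "V - q ` {..<k}" and ?E = "without E (q ` {..<k})"
  {
    case 1
    with Suc have IH: "edge_tree ?V ?E" "card ?V = card V - k"
      by (auto simp: peeling_Suc)
    with 1 have "3 \<le> card ?V"
      by simp
    with IH(1) 1 have "edge_tree (?V - {q k}) {e \<in> ?E. q k \<notin> e}"
      using edge_tree_remove[of ?V ?E "q k" "f k" "g k"] by (simp add: peeling_Suc)
    moreover have "V - q ` {..<Suc k} = ?V - {q k}"
      by (auto simp: lessThan_Suc)
    ultimately show ?case
      by (simp add: lessThan_Suc without_insert)
  next
    case 2
    with Suc have "card ?V = card V - k" "q k \<in> ?V"
      by (auto simp: peeling_Suc)
    then have "card (?V - {q k}) = card V - Suc k"
      by simp
    moreover have "V - q ` {..<Suc k} = ?V - {q k}"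
      by (auto simp: lessThan_Suc)
    ultimately show ?case
      by simp
  }
qed (use assms(1) in simp_all)

lemma peeling_edge:
  assumes "edge_tree V E" "peeling V E q f g k" "Suc i + 2 \<le> card V" "i < k"
  shows "{f i, g i} \<in> without E (q ` {..<Suc i})"
proof -
  have p: "peeling V E q f g i" "q i \<in> V - q ` {..<i}" "f i \<noteq> g i"
    "nbrs (without E (q ` {..<i})) (q i) = {f i, g i}"
    using assms(2,4) by (auto simp: peeling_def)
  have T: "edge_tree (V - q ` {..<i}) (without E (q ` {..<i}))" "3 \<le> card (V - q ` {..<i})"
    using peeling_edge_tree[OF assms(1) p(1)] assms(3) by simp_all
  have "{f i, g i} \<in> without E (q ` {..<i})"
    using edge_tree_remove[OF T p(2,4,3)] by simp
  moreover have "q i \<notin> {f i, g i}"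
    using nbrs_self[OF T(1), of "q i"] p(4) by simp
  ultimately show ?thesis
    by (simp add: lessThan_Suc without_insert)
qed


section \<open>Existence and uniqueness of the placement on the lattice\<close>

definition unit_map :: "'a set \<Rightarrow> 'a set set \<Rightarrow> real \<Rightarrow> ('a \<Rightarrow> real \<times> real) \<Rightarrow> bool" where
  "unit_map V E w p \<longleftrightarrow> inj_on p V \<and> (\<forall>u v. {u, v} \<in> E \<longrightarrow> dist (p u) (p v) = w)"

text \<open>Up to an affine map of the lattice into the plane, the drawing of \<open>S\<close> is the only one that a
  planar realization of the whole graph can contain.\<close>

definition placement ::
    "'a set \<Rightarrow> 'a set set \<Rightarrow> real \<Rightarrow> 'a set \<Rightarrow> 'a set set \<Rightarrow> ('a \<Rightarrow> int) \<Rightarrow> ('a \<Rightarrow> int) \<Rightarrow> bool" where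
  "placement V E w S F x y \<longleftrightarrow> lattice_drawing S F x y \<and>
     (\<forall>p. unit_map V E w p \<longrightarrow>
        (\<exists>c d e. \<forall>v\<in>S. p v = c + of_int (x v) *\<^sub>R d + of_int (y v) *\<^sub>R e))"

text \<open>The point obtained by rotating \<open>B\<close> about \<open>A\<close> by 60 degrees, in
  lattice coordinates; \<open>right_apex\<close> is the rotation the other way.\<close>

definition left_apex :: "int \<times> int \<Rightarrow> int \<times> int \<Rightarrow> int \<times> int" where
  "left_apex A B = (fst A - (snd B - snd A), snd A + (fst B - fst A) + (snd B - snd A))"

definition right_apex :: "int \<times> int \<Rightarrow> int \<times> int \<Rightarrow> int \<times> int" where
  "right_apex A B = (fst A + (fst B - fst A) + (snd B - snd A), snd A - (fst B - fst A))"

lemma apex_sum: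
  "fst (left_apex A B) + fst (right_apex A B) = fst A + fst B"
  "snd (left_apex A B) + snd (right_apex A B) = snd A + snd B"
  by (simp_all add: left_apex_def right_apex_def)

text \<open>Lattice counterpart of \<open>rhombus\<close>: a known apex determines the other one by
  the same formula as in the plane.\<close>

lemma distinct_apexes_sum:
  assumes "C = left_apex A B \<or> C = right_apex A B" "D = left_apex A B \<or> D = right_apex A B" "C \<noteq> D"
  shows "fst C + fst D = fst A + fst B" "snd C + snd D = snd A + snd B"
  using assms apex_sum[of A B] by (elim disjE; simp add: add.commute)+

lemma unit_vec_to_apex:
  assumes "unit_vec (fst B - fst A) (snd B - snd A)" "C = left_apex A B \<or> C = right_apex A B"
  shows "unit_vec (fst C - fst A) (snd C - snd A)" "unit_vec (fst C - fst B) (snd C - snd B)"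
  using assms(2) unit_vec_apex[OF assms(1)]
  by (auto simp: left_apex_def right_apex_def unit_vec_def algebra_simps)

lemma common_neighbour_apex:
  assumes "unit_vec (fst B - fst A) (snd B - snd A)"
    "unit_vec (fst C - fst A) (snd C - snd A)" "unit_vec (fst C - fst B) (snd C - snd B)"
  shows "C = left_apex A B \<or> C = right_apex A B"
proof -
  have "unit_vec (fst C - fst A - (fst B - fst A)) (snd C - snd A - (snd B - snd A))"
    using assms(3) by simp
  from common_neighbour_cases[OF assms(1,2) this] show ?thesis
    by (auto simp: left_apex_def right_apex_def prod_eq_iff)
qed

text \<open>The moment at which \<open>v\<close> is put back onto the edge from \<open>a\<close> to
  \<open>b\<close>, with \<open>S\<close> already drawn. \<open>flat\<close> concerns the initial
  edge alone: it lies along the first lattice direction, so the second direction is not yet tied to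
  the plane.\<close>

locale placement_step =
  fixes V :: "'a set" and E w S F x y v a b
  assumes pl: "placement V E w S F x y" and w: "w > 0"
    and tree: "edge_tree S F" and sub: "S \<subseteq> V" "F \<subseteq> E"
    and flat: "card S = 2 \<Longrightarrow> s \<in> S \<Longrightarrow> y s = 0"
    and v: "v \<in> V - S" and ab: "{a, b} \<in> F" "{v, a} \<in> E" "{v, b} \<in> E"
begin

abbreviation "pos s \<equiv> (x s, y s)"

abbreviation "apex C \<equiv> C = left_apex (pos a) (pos b) \<or> C = right_apex (pos a) (pos b)"

lemma unit: "{s, t} \<in> F \<Longrightarrow> unit_vec (x t - x s) (y t - y s)"
  using pl by (simp add: placement_def lattice_drawing_def)

lemma in_S: "a \<in> S" "b \<in> S" "a \<noteq> b"
  using edge_tree_pair[OF tree ab(1)] .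

lemma two_cases: "card S = 2 \<or> 3 \<le> card S"
  using card_edge_tree[OF tree] by linarith

lemma S_two: "card S = 2 \<Longrightarrow> S = {a, b}"
  using edge_tree_two[OF tree] in_S by blast

lemma opposite:
  assumes "3 \<le> card S"
  obtains z where "z \<in> S" "{a, z} \<in> F" "{b, z} \<in> F" "apex (pos z)"
proof -
  from edge_in_triangle[OF tree assms ab(1)] obtain z where z: "{a, z} \<in> F" "{b, z} \<in> F"
    by blast
  then have "apex (pos z)"
    using unit[OF ab(1)] unit[OF z(1)] unit[OF z(2)] by (intro common_neighbour_apex) auto
  with z that show ?thesis
    using edge_tree_pair(2)[OF tree z(1)] by blast
qed

text \<open>Both \<open>z\<close> and \<open>v\<close> complete an equilateral triangle over
  \<open>a\<close> and \<open>b\<close>, and injectivity of \<open>p\<close> keeps them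
  apart.\<close>

lemma forced:
  assumes p: "unit_map V E w p" and z: "z \<in> S" "{a, z} \<in> F" "{b, z} \<in> F"
  shows "p v = p a + p b - p z"
proof (rule rhombus)
  show "w > 0" by (rule w)
  have d: "dist (p s) (p t) = w" if "{s, t} \<in> E" for s t
    using p that by (simp add: unit_map_def)
  have "{a, b} \<in> E" "{z, a} \<in> E" "{z, b} \<in> E"
    using ab z sub by (auto simp: insert_commute)
  then show "dist (p a) (p b) = w" "dist (p z) (p a) = w" "dist (p z) (p b) = w"
    "dist (p v) (p a) = w" "dist (p v) (p b) = w"
    using d ab by blast+
  show "p z \<noteq> p v"
    using p v z(1) sub(1) by (auto simp: unit_map_def dest: inj_onD)
qed

text \<open>The forced position of \<open>v\<close> is the affine image of an apex that already
  holds another vertex, which contradicts injectivity.\<close>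

lemma blocked:
  assumes "left_apex (pos a) (pos b) \<in> pos ` S" "right_apex (pos a) (pos b) \<in> pos ` S"
  shows "\<not> unit_map V E w p"
proof
  assume p: "unit_map V E w p"
  \<comment> \<open>On a single edge no apex is occupied, because an apex differs from both
    ends.\<close>
  have "3 \<le> card S"
  proof (rule ccontr)
    assume "\<not> 3 \<le> card S"
    then have "S = {a, b}"
      using two_cases S_two by auto
    with assms(1) have "left_apex (pos a) (pos b) = pos a \<or> left_apex (pos a) (pos b) = pos b"
      by auto
    then show False
      using unit_vec_to_apex[of "pos b" "pos a" "left_apex (pos a) (pos b)"] unit[OF ab(1)]
      by (auto simp: unit_vec_def)
  qed
  then obtain z where z: "z \<in> S" "{a, z} \<in> F" "{b, z} \<in> F" "apex (pos z)"
    by (rule opposite)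
  \<comment> \<open>One apex holds \<open>z\<close>; \<open>u\<close> is the vertex at the other
    one.\<close>
  obtain u where u: "u \<in> S" "x u = x a + x b - x z" "y u = y a + y b - y z"
    using z(4) assms apex_sum[of "pos a" "pos b"] by (auto simp: algebra_simps)
  from pl p obtain c d e where
    e: "\<And>s. s \<in> S \<Longrightarrow> p s = c + of_int (x s) *\<^sub>R d + of_int (y s) *\<^sub>R e"
    by (auto simp: placement_def)
  have "p v = c + of_int (x a + x b - x z) *\<^sub>R d + of_int (y a + y b - y z) *\<^sub>R e"
    using forced[OF p z(1-3)] e[OF in_S(1)] e[OF in_S(2)] e[OF z(1)]
    by (simp add: algebra_simps)
  also have "\<dots> = p u"
    using e[OF u(1)] u(2,3) by simp
  finally have "p v = p u" .
  then show False
    using p v u(1) sub(1) by (auto simp: unit_map_def dest: inj_onD)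
qed

text \<open>Once a triangle is drawn, the same affine map also describes \<open>v\<close>, since it
  respects \<open>a + b - z\<close>. The third vertex of all is different: it fixes the second
  direction of the map.\<close>

lemma extend:
  assumes C: "apex (c, d)" "(c, d) \<notin> pos ` S"
    and F': "\<And>s t. {s, t} \<in> F' \<Longrightarrow> {s, t} \<in> F \<or> s = v \<and> t \<in> {a, b} \<or> t = v \<and> s \<in> {a, b}"
  shows "placement V E w (insert v S) F' (x(v := c)) (y(v := d))"
  unfolding placement_def
proof (intro conjI allI impI)
  have old: "(x(v := c)) s = x s" "(y(v := d)) s = y s" if "s \<in> S" for s
    using that v by auto
  have nab: "a \<noteq> v" "b \<noteq> v"
    using in_S v by auto
  have un: "unit_vec (c - x a) (d - y a)" "unit_vec (c - x b) (d - y b)"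
    using unit_vec_to_apex[of "pos b" "pos a" "(c, d)"] unit[OF ab(1)] C(1) by auto
  have "inj_on pos S"
    using pl by (simp add: placement_def lattice_drawing_def)
  then have "inj_on (\<lambda>s. ((x(v := c)) s, (y(v := d)) s)) S"
    using old by (simp add: inj_on_def)
  moreover have "(c, d) \<notin> (\<lambda>s. ((x(v := c)) s, (y(v := d)) s)) ` S"
    using C(2) old by force
  ultimately have "inj_on (\<lambda>s. ((x(v := c)) s, (y(v := d)) s)) (insert v S)"
    using v by simp
  moreover have "unit_vec ((x(v := c)) t - (x(v := c)) s) ((y(v := d)) t - (y(v := d)) s)"
    if "{s, t} \<in> F'" for s t
    using F'[OF that]
  proof (elim disjE conjE)
    assume st: "{s, t} \<in> F"
    have "s \<noteq> v" "t \<noteq> v"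
      using edge_tree_pair[OF tree st] v by auto
    then show ?thesis
      using unit[OF st] by simp
  next
    assume "s = v" "t \<in> {a, b}"
    then show ?thesis
      using un nab by (auto simp: unit_vec_minus[of _ c])
  next
    assume "t = v" "s \<in> {a, b}"
    then show ?thesis
      using un nab by auto
  qed
  ultimately show "lattice_drawing (insert v S) F' (x(v := c)) (y(v := d))"
    by (simp add: lattice_drawing_def)
  fix p
  assume p: "unit_map V E w p"
  from pl p obtain g e f where
    e: "\<And>s. s \<in> S \<Longrightarrow> p s = g + of_int (x s) *\<^sub>R e + of_int (y s) *\<^sub>R f"
    by (auto simp: placement_def)
  have "\<exists>f. \<forall>s\<in>insert v S.
      p s = g + of_int ((x(v := c)) s) *\<^sub>R e + of_int ((y(v := d)) s) *\<^sub>R f"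
    using two_cases
  proof
    assume "3 \<le> card S"
    then obtain z where z: "z \<in> S" "{a, z} \<in> F" "{b, z} \<in> F" "apex (pos z)"
      by (rule opposite)
    have "(c, d) \<noteq> pos z"
      using C(2) z(1) by auto
    from distinct_apexes_sum[OF C(1) z(4) this]
    have cd: "c = x a + x b - x z" "d = y a + y b - y z"
      by simp_all
    have "p v = g + of_int c *\<^sub>R e + of_int d *\<^sub>R f"
      using forced[OF p z(1-3)] e[OF in_S(1)] e[OF in_S(2)] e[OF z(1)]
      by (simp add: cd algebra_simps)
    with e old show ?thesis
      by (intro exI[of _ f]) auto
  next
    assume 2: "card S = 2"
    have flat2: "y s = 0" if "s \<in> S" for s
      using flat[OF 2 that] .
    have "unit_vec (x b - x a) 0"
      using unit[OF ab(1)] flat2 in_S by simp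
    \<comment> \<open>Both apexes over a horizontal edge have a nonzero second coordinate, so the
      equation for \<open>p v\<close> can be solved for the second direction. On \<open>S\<close>
      that direction has coefficient 0 and may be replaced.\<close>
    then have "d \<noteq> 0"
      using C(1) flat2 in_S by (auto simp: left_apex_def right_apex_def unit_vec_def)
    then have "p v = g + of_int c *\<^sub>R e + of_int d *\<^sub>R ((1 / of_int d) *\<^sub>R (p v - g - of_int c *\<^sub>R e))"
      by simp
    moreover have "p s = g + of_int (x s) *\<^sub>R e" if "s \<in> S" for s
      using e[OF that] flat2[OF that] by simp
    ultimately show ?thesis
      using old flat2 by (intro exI[of _ "(1 / of_int d) *\<^sub>R (p v - g - of_int c *\<^sub>R e)"]) auto
  qed
  then show "\<exists>g e f. \<forall>s\<in>insert v S.
      p s = g + of_int ((x(v := c)) s) *\<^sub>R e + of_int ((y(v := d)) s) *\<^sub>R f"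
    by blast
qed

end

lemma placement_edge:
  assumes "a \<noteq> b" "w > 0"
  shows "placement V E w {a, b} {{a, b}} (\<lambda>s. if s = b then 1 else 0) (\<lambda>_. 0)"
  unfolding placement_def
proof (intro conjI allI impI)
  show "lattice_drawing {a, b} {{a, b}} (\<lambda>s. if s = b then 1 else 0) (\<lambda>_. 0)"
    using assms(1) by (auto simp: lattice_drawing_def unit_vec_def doubleton_eq_iff)
  fix p :: "'a \<Rightarrow> real \<times> real"
  show "\<exists>c d e. \<forall>v\<in>{a, b}. p v = c + of_int (if v = b then 1 else 0) *\<^sub>R d + of_int 0 *\<^sub>R e"
    \<comment> \<open>The vector 0 for the second direction is a placeholder that
      \<open>extend\<close> replaces at the third vertex.\<close>
    using assms(1) by (intro exI[of _ "p a"] exI[of _ "p b - p a"] exI[of _ 0]) auto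
qed

text \<open>The only link from realizations to the refusal: if no unit map exists, neither does a
  realization.\<close>

lemma planar_realization_unit_map:
  "planar_realization V E len p \<Longrightarrow> \<forall>e\<in>E. len e = w \<Longrightarrow> unit_map V E w p"
  by (simp add: planar_realization_def planar_straight_line_drawing_def unit_map_def)


section \<open>The algorithm\<close>

lemma reaches_for:
  assumes "Inv 0 s"
    and "\<And>k s. Inv k s \<Longrightarrow> k \<le> N \<and> vars s vI = real k \<and> safe f s \<and> eval f s = real N"
    and "\<And>k s. Inv k s \<Longrightarrow> k < N \<Longrightarrow> wp c (Inv (Suc k)) s"
  shows "reaches (WhileLess (Var vI) f c) (N * (cost c + guard_cost (Var vI) f) + guard_cost (Var vI) f)
    s (Inv N)"
proof -
  have "reaches (WhileLess (Var vI) f c) ((N - nat \<lfloor>vars s vI\<rfloor>) * (cost c + guard_cost (Var vI) f) +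
      guard_cost (Var vI) f) s (Inv N)"
  proof (rule reaches_WhileLess[where I = "\<lambda>s. \<exists>k. Inv k s" and r = "\<lambda>s. N - nat \<lfloor>vars s vI\<rfloor>"])
    show "\<exists>k. Inv k s"
      using assms(1) by blast
  next
    fix s assume "\<exists>k. Inv k s"
    then show "safe (Var vI) s \<and> safe f s"
      using assms(2) by auto
  next
    fix s assume "\<exists>k. Inv k s" and lt: "eval (Var vI) s < eval f s"
    then obtain k where k: "Inv k s"
      by blast
    with assms(2)[OF k] lt have kN: "k < N"
      by simp
    show "reaches c (cost c) s (\<lambda>s'. (\<exists>k. Inv k s') \<and> N - nat \<lfloor>vars s' vI\<rfloor> < N - nat \<lfloor>vars s vI\<rfloor>)"
    proof (rule reaches_mono[OF reaches_wp[OF assms(3)[OF k kN]] order_refl], intro conjI)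
      fix s' assume s': "Inv (Suc k) s'"
      then show "\<exists>k. Inv k s'"
        by blast
      show "N - nat \<lfloor>vars s' vI\<rfloor> < N - nat \<lfloor>vars s vI\<rfloor>"
        using assms(2)[OF s'] assms(2)[OF k] kN by simp
    qed
  next
    fix s assume "\<exists>k. Inv k s" and ge: "\<not> eval (Var vI) s < eval f s"
    then obtain k where k: "Inv k s"
      by blast
    with assms(2)[OF k] ge have "k = N"
      by simp
    with k show "Inv N s"
      by simp
  qed
  moreover have "vars s vI = 0"
    using assms(2)[OF assms(1)] by simp
  ultimately show ?thesis
    by simp
qed

definition incr :: "var \<Rightarrow> com" where
  "incr x = Set x (Var x [+] Lit 1)"


subsection \<open>Reading the graph\<close>

definition link :: "var \<Rightarrow> var \<Rightarrow> com" where
  "link x y =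
     SetAt aDeg (Var x) (At aDeg (Var x) [+] Lit 1) ;;
     SetAt aSum (Var x) (At aSum (Var x) [+] Var y) ;;
     SetAt aSqs (Var x) (At aSqs (Var x) [+] Var y [*] Var y)"

definition read_edge :: com where
  "read_edge = Input vU ;; Input vV ;; Input vL ;; link vU vV ;; link vV vU ;; incr vI"

definition read_graph :: com where
  "read_graph = (Input vN ;; Input vM) ;; WhileLess (Var vI) (Var vM) read_edge"

definition stats :: "nat set \<Rightarrow> nat set set \<Rightarrow> state \<Rightarrow> bool" where
  "stats S E s \<longleftrightarrow> (\<forall>v\<in>S. arrs s aDeg v = real (card (nbrs E v)) \<and>
     arrs s aSum v = (\<Sum>u\<in>nbrs E v. real u) \<and> arrs s aSqs v = (\<Sum>u\<in>nbrs E v. real u * real u))"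

lemma nbrs_insert_edge:
  assumes "a \<noteq> b"
  shows "nbrs (insert {a, b} E) v =
    (if v = a then insert b (nbrs E v) else if v = b then insert a (nbrs E v) else nbrs E v)"
  using assms by (auto simp: nbrs_def doubleton_eq_iff)

lemma finite_nbrs_pairs: "finite E \<Longrightarrow> \<forall>e\<in>E. finite e \<Longrightarrow> finite (nbrs E v)"
  by (rule finite_subset[of _ "\<Union>E"]) (auto simp: nbrs_def)

lemma stats_link:
  fixes s :: state
  assumes "stats UNIV E s" "a \<noteq> b" "{a, b} \<notin> E" "\<And>v. finite (nbrs E v)"
    and "arrs s' aDeg = (arrs s aDeg)(a := arrs s aDeg a + 1, b := arrs s aDeg b + 1)"
    and "arrs s' aSum = (arrs s aSum)(a := arrs s aSum a + real b, b := arrs s aSum b + real a)"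
    and "arrs s' aSqs =
      (arrs s aSqs)(a := arrs s aSqs a + real b * real b, b := arrs s aSqs b + real a * real a)"
  shows "stats UNIV (insert {a, b} E) s'"
proof -
  have "b \<notin> nbrs E a" "a \<notin> nbrs E b"
    using assms(3) by (auto simp: nbrs_def insert_commute)
  with assms show ?thesis
    unfolding stats_def nbrs_insert_edge[OF assms(2)] by auto
qed

locale uniform_two_tree =
  fixes n :: nat and E :: "nat set set" and len :: "nat set \<Rightarrow> real" and w :: real
    and es :: "(nat \<times> nat) list"
  assumes tree: "edge_tree {0..<n} E" and n3: "3 \<le> n" and w: "w > 0"
    and len: "\<forall>e\<in>E. len e = w" and listing: "edge_listing E es"
begin

abbreviation "edges k \<equiv> set (map (\<lambda>(u, v). {u, v}) (take k es))"

lemma length_es: "length es + 3 = 2 * n"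
proof -
  have "length es = card E"
    using listing unfolding edge_listing_def by (metis distinct_card length_map)
  with card_edge_tree[OF tree] show ?thesis
    by simp
qed

lemma edges_all: "edges (length es) = E"
  using listing by (simp add: edge_listing_def)

lemma edges_subset: "edges k \<subseteq> E"
  using listing set_take_subset[of k es] unfolding edge_listing_def by auto

lemma next_edge:
  assumes "k < length es" "es ! k = (a, b)"
  shows "{a, b} \<in> E" "a \<noteq> b" "{a, b} \<notin> edges k" "edges (Suc k) = insert {a, b} (edges k)"
proof -
  let ?m = "map (\<lambda>(u, v). {u, v}) es"
  have "?m ! k = {a, b}"
    using assms by simp
  moreover have "distinct ?m" "set ?m = E"
    using listing by (simp_all add: edge_listing_def)
  ultimately show "{a, b} \<in> E"
    using assms(1) by (metis length_map nth_mem)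
  then show "a \<noteq> b"
    by (rule edge_tree_pair(3)[OF tree])
  have "distinct (take (Suc k) ?m)"
    using \<open>distinct ?m\<close> by simp
  then show "{a, b} \<notin> edges k"
    using assms by (simp add: take_Suc_conv_app_nth flip: take_map)
  show "edges (Suc k) = insert {a, b} (edges k)"
    using assms by (simp add: take_Suc_conv_app_nth)
qed

lemma finite_nbrs_edges: "finite (nbrs (edges k) v)"
  using edge_tree_edge[OF tree] edges_subset[of k]
  by (intro finite_nbrs_pairs) (auto simp: card_2_iff)

text \<open>The common length is known only after one edge has been read, hence the condition
  \<open>0 < k\<close>. The zero arrays and the zero in \<open>vT\<close> are recorded for the later
  phases, which rely on initially empty memory.\<close>

definition reading :: "nat \<Rightarrow> state \<Rightarrow> bool" where
  "reading k s \<longleftrightarrow> k \<le> length es \<and> vars s vI = real k \<and> vars s vM = real (length es) \<and>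
     vars s vN = real n \<and> (0 < k \<longrightarrow> vars s vL = w) \<and>
     inp s = concat (map (\<lambda>(u, v). [real u, real v, len {u, v}]) (drop k es)) \<and> outp s = [] \<and>
     stats UNIV (edges k) s \<and> vars s vT = 0 \<and>
     arrs s aX = (\<lambda>_. 0) \<and> arrs s aY = (\<lambda>_. 0) \<and> arrs s aGrid = (\<lambda>_. 0)"

lemma wp_read_edge:
  assumes "reading k s" "k < length es"
  shows "wp read_edge (reading (Suc k)) s"
proof -
  obtain a b where ab: "es ! k = (a, b)"
    by force
  note e = next_edge[OF assms(2) ab]
  have r: "vars s vI = real k" "vars s vM = real (length es)" "vars s vN = real n" "outp s = []"
    "vars s vT = 0" "arrs s aX = (\<lambda>_. 0)" "arrs s aY = (\<lambda>_. 0)" "arrs s aGrid = (\<lambda>_. 0)"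
    using assms(1) by (simp_all add: reading_def)
  have inp: "inp s = real a # real b # w # concat (map (\<lambda>(u, v). [real u, real v, len {u, v}]) (drop (Suc k) es))"
    using assms ab e(1) len by (simp add: reading_def Cons_nth_drop_Suc[symmetric])
  \<comment> \<open>Stated for an arbitrary final state, so that it fits whatever record term
    symbolic execution leaves.\<close>
  have st: "\<And>s'. arrs s' aDeg = (arrs s aDeg)(a := arrs s aDeg a + 1, b := arrs s aDeg b + 1) \<Longrightarrow>
      arrs s' aSum = (arrs s aSum)(a := arrs s aSum a + real b, b := arrs s aSum b + real a) \<Longrightarrow>
      arrs s' aSqs =
        (arrs s aSqs)(a := arrs s aSqs a + real b * real b, b := arrs s aSqs b + real a * real a) \<Longrightarrow>
      stats UNIV (edges (Suc k)) s'"
    unfolding e(4) using assms(1) e(2,3) finite_nbrs_edges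
    by (intro stats_link[of "edges k" s]) (auto simp: reading_def)
  show ?thesis
    using assms(2) e(2) e(2)[symmetric] r
    by (simp add: read_edge_def link_def incr_def inp) (simp add: reading_def st[simplified])
qed

definition "read_time = 2 + (length es * (cost read_edge + guard_cost (Var vI) (Var vM)) +
  guard_cost (Var vI) (Var vM))"

lemma reaches_read_graph:
  "reaches read_graph read_time (start (encode_graph n len es)) (reading (length es))"
  unfolding read_graph_def read_time_def
proof (rule reaches_Seq)
  have "wp (Input vN ;; Input vM) (reading 0) (start (encode_graph n len es))"
    by (simp add: start_def encode_graph_def reading_def stats_def nbrs_def)
  from reaches_wp[OF this]
  show "reaches (Input vN ;; Input vM) 2 (start (encode_graph n len es))
      (\<lambda>s. reaches (WhileLess (Var vI) (Var vM) read_edge)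
        (length es * (cost read_edge + guard_cost (Var vI) (Var vM)) + guard_cost (Var vI) (Var vM)) s
        (reading (length es)))"
    by (rule reaches_mono) (auto intro!: reaches_for wp_read_edge simp: reading_def)
qed

end


subsection \<open>Elimination\<close>

definition push :: "var \<Rightarrow> com" where
  "push x = SetAt aQueue (Var vT) (Var x) ;; incr vT"

definition enqueue_step :: com where
  "enqueue_step = IfEq (At aDeg (Var vI)) (Lit 2) (push vI) Skip ;; incr vI"

definition enqueue_leaves :: com where
  "enqueue_leaves = Set vI (Lit 0) ;; WhileLess (Var vI) (Var vN) enqueue_step"

text \<open>The test right after the decrement catches the moment when a degree falls from 3 to 2,
  so no vertex enters the queue twice.\<close>

definition unlink :: "var \<Rightarrow> com" where
  "unlink x =
     SetAt aDeg (Var x) (At aDeg (Var x) [-] Lit 1) ;;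
     SetAt aSum (Var x) (At aSum (Var x) [-] Var vV) ;;
     SetAt aSqs (Var x) (At aSqs (Var x) [-] Var vV [*] Var vV) ;;
     IfEq (At aDeg (Var x)) (Lit 2) (push x) Skip"

text \<open>The two remaining neighbours are the roots of a quadratic equation whose coefficients are known
  from their sum and the sum of their squares.\<close>

definition find_nbrs :: com where
  "find_nbrs =
     Set vV (At aQueue (Var vI)) ;;
     Set vR (Root (Lit 2 [*] At aSqs (Var vV) [-] At aSum (Var vV) [*] At aSum (Var vV))) ;;
     Set vA ((At aSum (Var vV) [+] Var vR) [/] Lit 2) ;;
     Set vB ((At aSum (Var vV) [-] Var vR) [/] Lit 2)"

definition remove_step :: com where
  "remove_step = find_nbrs ;;
     SetAt aFst (Var vI) (Var vA) ;; SetAt aSnd (Var vI) (Var vB) ;;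
     unlink vA ;; unlink vB ;; incr vI"

text \<open>After \<open>n - 2\<close> rounds a single edge is left. Its ends are already in the
  queue, at the positions \<open>n - 2\<close> and \<open>n - 1\<close>, where
  \<open>prepare\<close> finds them.\<close>

definition eliminate :: com where
  "eliminate = Set vI (Lit 0) ;; WhileLess (Var vI) (Var vN [-] Lit 2) remove_step"

definition queue :: "nat list \<Rightarrow> state \<Rightarrow> bool" where
  "queue qs s \<longleftrightarrow> vars s vT = real (length qs) \<and> (\<forall>j<length qs. arrs s aQueue j = real (qs ! j))"

lemma queue_snoc:
  assumes "queue qs s" "vars s' vT = vars s vT + 1" "arrs s' aQueue = (arrs s aQueue)(length qs := real v)"
  shows "queue (qs @ [v]) s'"
  using assms by (auto simp: queue_def nth_append less_Suc_eq)

lemma queue_cong: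
  "queue qs s \<Longrightarrow> vars s' vT = vars s vT \<Longrightarrow> arrs s' aQueue = arrs s aQueue \<Longrightarrow> queue qs s'"
  by (simp add: queue_def)

lemma stats_cong:
  "stats S E s \<Longrightarrow> arrs s' aDeg = arrs s aDeg \<Longrightarrow> arrs s' aSum = arrs s aSum \<Longrightarrow>
    arrs s' aSqs = arrs s aSqs \<Longrightarrow> stats S E s'"
  by (simp add: stats_def)

text \<open>Deleting a vertex does not touch its own entries, so \<^const>\<open>stats\<close> is kept for the remaining
  vertices only.\<close>

lemma stats_remove:
  assumes st: "stats S F s" and v: "v \<in> S" and nb: "nbrs F v = {a, b}" "a \<noteq> b"
    and fin: "\<And>u. finite (nbrs F u)" and self: "v \<notin> nbrs F v"
    and "arrs s' aDeg = (arrs s aDeg)(a := arrs s aDeg a - 1, b := arrs s aDeg b - 1)"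
    and "arrs s' aSum = (arrs s aSum)(a := arrs s aSum a - real v, b := arrs s aSum b - real v)"
    and "arrs s' aSqs =
      (arrs s aSqs)(a := arrs s aSqs a - real v * real v, b := arrs s aSqs b - real v * real v)"
  shows "stats (S - {v}) {e \<in> F. v \<notin> e} s'"
  unfolding stats_def
proof
  fix u assume u: "u \<in> S - {v}"
  have eq: "nbrs {e \<in> F. v \<notin> e} u = nbrs F u - {v}"
    using u by (auto simp: nbrs_def)
  have old: "arrs s aDeg u = real (card (nbrs F u))" "arrs s aSum u = (\<Sum>t\<in>nbrs F u. real t)"
    "arrs s aSqs u = (\<Sum>t\<in>nbrs F u. real t * real t)"
    using st u by (auto simp: stats_def)
  have mem: "v \<in> nbrs F u \<longleftrightarrow> u = a \<or> u = b"
    using nb(1) nbrs_sym[of v F u] by auto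
  show "arrs s' aDeg u = real (card (nbrs {e \<in> F. v \<notin> e} u)) \<and>
      arrs s' aSum u = (\<Sum>t\<in>nbrs {e \<in> F. v \<notin> e} u. real t) \<and>
      arrs s' aSqs u = (\<Sum>t\<in>nbrs {e \<in> F. v \<notin> e} u. real t * real t)"
  proof (cases "v \<in> nbrs F u")
    case True
    then have "0 < card (nbrs F u)"
      using fin card_gt_0_iff by blast
    then have "real (card (nbrs F u - {v})) = real (card (nbrs F u)) - 1"
      using True by (simp add: card_Diff_singleton of_nat_diff Suc_leI)
    with True mem assms(7-9) old fin[of u] nb(2) show ?thesis
      unfolding eq by (auto simp: sum_diff1)
  next
    case False
    with mem assms(7-9) old show ?thesis
      unfolding eq by auto
  qed
qed

text \<open>Appending to the queue alters \<open>(!) qs\<close> beyond the peeled positions; this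
  lemma absorbs the change.\<close>

lemma peeling_cong:
  assumes "peeling V E q f g k" "\<And>i. i < k \<Longrightarrow> q' i = q i \<and> f' i = f i \<and> g' i = g i"
  shows "peeling V E q' f' g' k"
proof -
  have "q' ` {..<i} = q ` {..<i}" if "i \<le> k" for i
    using assms(2) that by (intro image_cong) auto
  with assms show ?thesis
    by (simp add: peeling_def)
qed

context uniform_two_tree
begin

definition frame :: "state \<Rightarrow> bool" where
  "frame s \<longleftrightarrow> vars s vN = real n \<and> vars s vL = w \<and> outp s = [] \<and>
     arrs s aX = (\<lambda>_. 0) \<and> arrs s aY = (\<lambda>_. 0) \<and> arrs s aGrid = (\<lambda>_. 0)"

definition enqueuing :: "nat \<Rightarrow> state \<Rightarrow> bool" where
  "enqueuing k s \<longleftrightarrow> k \<le> n \<and> vars s vI = real k \<and> frame s \<and> stats UNIV E s \<and>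
     queue (filter (\<lambda>v. card (nbrs E v) = 2) [0..<k]) s"

lemma wp_enqueue_step:
  assumes "enqueuing k s" "k < n"
  shows "wp enqueue_step (enqueuing (Suc k)) s"
proof -
  let ?q = "filter (\<lambda>v. card (nbrs E v) = 2) [0..<k]"
  have r: "vars s vI = real k" "frame s" "stats UNIV E s" "queue ?q s"
    using assms by (simp_all add: enqueuing_def)
  have deg: "arrs s aDeg k = real (card (nbrs E k))"
    using r(3) by (simp add: stats_def)
  have t: "vars s vT = real (length ?q)"
    using r(4) by (simp add: queue_def)
  have len2: "real (card (nbrs E k)) = 2 \<longleftrightarrow> card (nbrs E k) = 2"
    by linarith
  show ?thesis
  proof (cases "card (nbrs E k) = 2")
    case True
    with assms(2) r t deg show ?thesis
      by (auto simp: enqueue_step_def push_def incr_def enqueuing_def frame_def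
          intro: stats_cong queue_snoc)
  next
    case False
    with assms(2) r deg len2 show ?thesis
      by (auto simp: enqueue_step_def push_def incr_def enqueuing_def frame_def
          intro: stats_cong queue_cong)
  qed
qed

definition "enqueue_time = cost (Set vI (Lit 0)) +
  (n * (cost enqueue_step + guard_cost (Var vI) (Var vN)) + guard_cost (Var vI) (Var vN))"

lemma reaches_enqueue_leaves:
  assumes "reading (length es) s"
  shows "reaches enqueue_leaves enqueue_time s (enqueuing n)"
  unfolding enqueue_leaves_def enqueue_time_def
proof (rule reaches_Seq)
  have "length es > 0"
    using length_es n3 by linarith
  then have "frame s" "stats UNIV E s" "vars s vT = 0"
    using assms edges_all by (auto simp: reading_def frame_def)
  then have "wp (Set vI (Lit 0)) (enqueuing 0) s"
    by (auto simp: enqueuing_def frame_def queue_def intro: stats_cong)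
  from reaches_wp[OF this]
  show "reaches (Set vI (Lit 0)) (cost (Set vI (Lit 0))) s
      (\<lambda>s. reaches (WhileLess (Var vI) (Var vN) enqueue_step)
        (n * (cost enqueue_step + guard_cost (Var vI) (Var vN)) + guard_cost (Var vI) (Var vN)) s
        (enqueuing n))"
    by (rule reaches_mono, simp, intro reaches_for wp_enqueue_step)
      (simp_all add: enqueuing_def frame_def)
qed

abbreviation "rest q k \<equiv> {0..<n} - q ` {..<k}"

abbreviation "rest_edges q k \<equiv> without E (q ` {..<k})"

definition ordering :: "(nat \<Rightarrow> nat) \<Rightarrow> (nat \<Rightarrow> nat) \<Rightarrow> (nat \<Rightarrow> nat) \<Rightarrow> nat \<Rightarrow> state \<Rightarrow> bool" where
  "ordering q f g k s \<longleftrightarrow> peeling {0..<n} E q f g k \<and>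
     (\<forall>j<k. arrs s aFst j = real (f j) \<and> arrs s aSnd j = real (g j))"

text \<open>The unprocessed part of the queue is described by degree at most 2 and not exactly 2,
  because both ends of the final edge have degree 1 while they wait.\<close>

definition eliminating :: "nat \<Rightarrow> state \<Rightarrow> bool" where
  "eliminating k s \<longleftrightarrow> k \<le> n - 2 \<and> vars s vI = real k \<and> frame s \<and>
     (\<exists>qs f g. queue qs s \<and> distinct qs \<and> k \<le> length qs \<and> ordering ((!) qs) f g k s \<and>
        stats (rest ((!) qs) k) (rest_edges ((!) qs) k) s \<and>
        set (drop k qs) = {v \<in> rest ((!) qs) k. card (nbrs (rest_edges ((!) qs) k) v) \<le> 2})"

end


section \<open>The effect of one elimination round on the state\<close>

definition same :: "state \<Rightarrow> state \<Rightarrow> var set \<Rightarrow> arr set \<Rightarrow> bool" where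
  "same s s' Y A \<longleftrightarrow> (\<forall>y. y \<notin> Y \<longrightarrow> vars s' y = vars s y) \<and>
     (\<forall>a. a \<notin> A \<longrightarrow> arrs s' a = arrs s a) \<and> inp s' = inp s \<and> outp s' = outp s"

lemma same_trans: "same s s' Y A \<Longrightarrow> same s' s'' Y' A' \<Longrightarrow> same s s'' (Y \<union> Y') (A \<union> A')"
  by (simp add: same_def)

lemma wp_unlink:
  assumes "vars s x = real a" "vars s vV = real v" "queue qs s" "x \<noteq> vT"
    and "\<And>s'. same s s' {vT} {aDeg, aSum, aSqs, aQueue} \<Longrightarrow>
      arrs s' aDeg = (arrs s aDeg)(a := arrs s aDeg a - 1) \<Longrightarrow>
      arrs s' aSum = (arrs s aSum)(a := arrs s aSum a - real v) \<Longrightarrow>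
      arrs s' aSqs = (arrs s aSqs)(a := arrs s aSqs a - real v * real v) \<Longrightarrow>
      queue (qs @ (if arrs s aDeg a = 3 then [a] else [])) s' \<Longrightarrow> Q s'"
  shows "wp (unlink x) Q s"
proof -
  have t: "vars s vT = real (length qs)"
    using assms(3) by (simp add: queue_def)
  have eq: "arrs s aDeg a - 1 = 2 \<longleftrightarrow> arrs s aDeg a = 3"
    by linarith
  show ?thesis
  proof (cases "arrs s aDeg a = 3")
    case True
    show ?thesis
      using assms(1,2,4) t True
      by (simp add: unlink_def push_def incr_def)
        (rule assms(5); simp add: same_def queue_snoc[OF assms(3)])
  next
    case False
    show ?thesis
      using assms(1,2,4) t False eq
      by (simp add: unlink_def push_def incr_def)
        (rule assms(5); simp add: same_def queue_cong[OF assms(3)])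
  qed
qed

lemma wp_find_nbrs:
  assumes "vars s vI = real k" "arrs s aQueue k = real v" "b < a"
    and "arrs s aSum v = real a + real b" "arrs s aSqs v = real a * real a + real b * real b"
    and "\<And>s'. same s s' {vV, vR, vA, vB} {} \<Longrightarrow> vars s' vV = real v \<Longrightarrow> vars s' vA = real a \<Longrightarrow>
      vars s' vB = real b \<Longrightarrow> Q s'"
  shows "wp find_nbrs Q s"
proof -
  \<comment> \<open>This is the discriminant of the quadratic with the roots \<open>a\<close> and
    \<open>b\<close>; by \<open>b < a\<close> its square root is \<open>a - b\<close>, so
    \<open>vA\<close> receives the larger neighbour.\<close>
  have "2 * (real a * real a + real b * real b) - (real a + real b) * (real a + real b) =
      (real a - real b)\<^sup>2"
    by (simp add: power2_eq_square algebra_simps)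
  then have r: "2 * arrs s aSqs v - arrs s aSum v * arrs s aSum v = (real a - real b)\<^sup>2"
    by (simp only: assms(4,5))
  show ?thesis
    using assms(1,2,3,4) r unfolding find_nbrs_def
    by (simp del: of_nat_add) (rule assms(6); simp add: same_def)
qed

lemma wp_remove_step:
  assumes k: "vars s vI = real k" and qs: "queue qs s" "k < length qs" "qs ! k = v"
    and ab: "b < a" "arrs s aSum v = real a + real b" "arrs s aSqs v = real a * real a + real b * real b"
    and Q: "\<And>s'. same s s' {vI, vT, vV, vR, vA, vB} {aDeg, aSum, aSqs, aQueue, aFst, aSnd} \<Longrightarrow>
      vars s' vI = real (Suc k) \<Longrightarrow>
      arrs s' aFst = (arrs s aFst)(k := real a) \<Longrightarrow> arrs s' aSnd = (arrs s aSnd)(k := real b) \<Longrightarrow>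
      arrs s' aDeg = (arrs s aDeg)(a := arrs s aDeg a - 1, b := arrs s aDeg b - 1) \<Longrightarrow>
      arrs s' aSum = (arrs s aSum)(a := arrs s aSum a - real v, b := arrs s aSum b - real v) \<Longrightarrow>
      arrs s' aSqs =
        (arrs s aSqs)(a := arrs s aSqs a - real v * real v, b := arrs s aSqs b - real v * real v) \<Longrightarrow>
      queue (qs @ (if arrs s aDeg a = 3 then [a] else []) @ (if arrs s aDeg b = 3 then [b] else [])) s' \<Longrightarrow>
      Q s'"
  shows "wp remove_step Q s"
  unfolding remove_step_def wp.simps(6)
proof (rule wp_find_nbrs[OF k _ ab])
  show "arrs s aQueue k = real v"
    using qs by (auto simp: queue_def)
  fix s1
  assume s1: "same s s1 {vV, vR, vA, vB} {}" "vars s1 vV = real v" "vars s1 vA = real a"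
    "vars s1 vB = real b"
  have [simp]: "vars s1 vI = real k"
    using s1(1) k by (simp add: same_def)
  let ?s2 = "s1\<lparr>arrs := (arrs s1)(aFst := (arrs s1 aFst)(k := real a),
      aSnd := (arrs s1 aSnd)(k := real b))\<rparr>"
  have s2: "same s ?s2 {vV, vR, vA, vB} {aFst, aSnd}"
    using s1(1) by (simp add: same_def)
  have q2: "queue qs ?s2"
    using queue_cong[OF qs(1), of ?s2] s1(1) by (simp add: same_def)
  have "wp (unlink vA) (wp (unlink vB) (wp (incr vI) Q)) ?s2"
  proof (rule wp_unlink[OF _ _ q2])
    fix s3
    assume s3: "same ?s2 s3 {vT} {aDeg, aSum, aSqs, aQueue}"
      "arrs s3 aDeg = (arrs ?s2 aDeg)(a := arrs ?s2 aDeg a - 1)"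
      "arrs s3 aSum = (arrs ?s2 aSum)(a := arrs ?s2 aSum a - real v)"
      "arrs s3 aSqs = (arrs ?s2 aSqs)(a := arrs ?s2 aSqs a - real v * real v)"
      "queue (qs @ (if arrs ?s2 aDeg a = 3 then [a] else [])) s3"
    show "wp (unlink vB) (wp (incr vI) Q) s3"
    proof (rule wp_unlink[OF _ _ s3(5)])
      fix s4
      assume s4: "same s3 s4 {vT} {aDeg, aSum, aSqs, aQueue}"
        "arrs s4 aDeg = (arrs s3 aDeg)(b := arrs s3 aDeg b - 1)"
        "arrs s4 aSum = (arrs s3 aSum)(b := arrs s3 aSum b - real v)"
        "arrs s4 aSqs = (arrs s3 aSqs)(b := arrs s3 aSqs b - real v * real v)"
        "queue ((qs @ (if arrs ?s2 aDeg a = 3 then [a] else [])) @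
          (if arrs s3 aDeg b = 3 then [b] else [])) s4"
      let ?s5 = "s4\<lparr>vars := (vars s4)(vI := real k + 1)\<rparr>"
      have "same s s4 {vV, vR, vA, vB, vT} {aFst, aSnd, aDeg, aSum, aSqs, aQueue}"
        using same_trans[OF same_trans[OF s2 s3(1)] s4(1)] by (simp add: insert_commute)
      then have s5: "same s ?s5 {vI, vT, vV, vR, vA, vB} {aDeg, aSum, aSqs, aQueue, aFst, aSnd}"
        by (simp add: same_def)
      have "vars s4 vI = real k"
        using s3(1) s4(1) by (simp add: same_def)
      moreover have "Q ?s5"
      proof (rule Q[OF s5])
        show "queue (qs @ (if arrs s aDeg a = 3 then [a] else []) @ (if arrs s aDeg b = 3 then [b] else [])) ?s5"
          using queue_cong[OF s4(5), of ?s5] s3(2) s1(1) ab(1) by (simp add: same_def)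
      qed (use s1(1) s3 s4 ab(1) in \<open>simp_all add: same_def\<close>)
      ultimately show "wp (incr vI) Q s4"
        by (simp add: incr_def)
    qed (use s1 s3(1) in \<open>simp_all add: same_def\<close>)
  qed (use s1 in simp_all)
  then show "wp (SetAt aFst (Var vI) (Var vA)) (wp (SetAt aSnd (Var vI) (Var vB))
      (wp (unlink vA) (wp (unlink vB) (wp (incr vI) Q)))) s1"
    using s1 by simp
qed

text \<open>Only \<open>a\<close> and \<open>b\<close> lose a neighbour, and each loses exactly one,
  so a vertex newly falls to degree 2 exactly if it had degree 3.\<close>

lemma pending_remove:
  assumes T: "edge_tree S F" and nb: "nbrs F v = {a, b}"
  shows "{u \<in> S - {v}. card (nbrs {e \<in> F. v \<notin> e} u) \<le> 2} =
    ({u \<in> S. card (nbrs F u) \<le> 2} - {v}) \<union> {u \<in> {a, b}. card (nbrs F u) = 3}"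
proof -
  have eq: "nbrs {e \<in> F. v \<notin> e} u = nbrs F u - {v}" if "u \<noteq> v" for u
    using that by (auto simp: nbrs_def)
  have mem: "v \<in> nbrs F u \<longleftrightarrow> u = a \<or> u = b" for u
    using nb nbrs_sym[of v F u] by auto
  have ab: "a \<in> S" "b \<in> S" "a \<noteq> v" "b \<noteq> v"
    using nbrs_subset[OF T, of v] nbrs_self[OF T, of v] nb by auto
  have c: "card (nbrs F u - {v}) = (if u = a \<or> u = b then card (nbrs F u) - 1 else card (nbrs F u))" for u
    using mem[of u] by (simp add: card_Diff_singleton)
  have "u \<in> S - {v} \<and> card (nbrs {e \<in> F. v \<notin> e} u) \<le> 2 \<longleftrightarrow>
      u \<in> {u \<in> S. card (nbrs F u) \<le> 2} - {v} \<or> u \<in> {u \<in> {a, b}. card (nbrs F u) = 3}" for u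
  proof (cases "u = v")
    case True
    with ab show ?thesis
      by auto
  next
    case False
    have arith: "card (nbrs F u) - 1 \<le> 2 \<longleftrightarrow> card (nbrs F u) \<le> 2 \<or> card (nbrs F u) = 3"
      by linarith
    show ?thesis
      unfolding eq[OF False] c using False ab arith by (cases "u = a \<or> u = b") auto
  qed
  then show ?thesis
    by blast
qed

context uniform_two_tree
begin

lemma wp_eliminating:
  assumes "eliminating k s" "k < n - 2"
  shows "wp remove_step (eliminating (Suc k)) s"
proof -
  obtain qs f g where I: "vars s vI = real k" "frame s" "queue qs s" "distinct qs" "k \<le> length qs"
    and ord: "ordering ((!) qs) f g k s"
    and st: "stats (rest ((!) qs) k) (rest_edges ((!) qs) k) s"
    and pend: "set (drop k qs) = {v \<in> rest ((!) qs) k. card (nbrs (rest_edges ((!) qs) k) v) \<le> 2}"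
    using assms(1) unfolding eliminating_def by blast
  define S where "S = rest ((!) qs) k"
  define F where "F = rest_edges ((!) qs) k"
  have peel: "peeling {0..<n} E ((!) qs) f g k"
    using ord by (simp add: ordering_def)
  have T: "edge_tree S F" "3 \<le> card S"
    using peeling_edge_tree[OF tree peel] assms(2) by (simp_all add: S_def F_def)
  \<comment> \<open>The queue cannot run dry: with three vertices left, one has degree 2 and is
    therefore waiting.\<close>
  have "k < length qs"
    using ex_degree_2[OF T] pend by (cases "k < length qs") (auto simp: S_def F_def)
  define v where "v = qs ! k"
  have drop: "drop k qs = v # drop (Suc k) qs"
    using \<open>k < length qs\<close> by (simp add: v_def Cons_nth_drop_Suc)
  then have "v \<in> set (drop k qs)"
    by simp
  then have v: "v \<in> S" "card (nbrs F v) \<le> 2"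
    unfolding pend by (simp_all add: S_def F_def)
  with card_nbrs_ge_2[OF T v(1)] have "card (nbrs F v) = 2"
    by simp
  then obtain a' b' where "nbrs F v = {a', b'}" "a' \<noteq> b'"
    by (auto simp: card_2_iff)
  then obtain a b where ab: "nbrs F v = {a, b}" "b < a"
    by (metis insert_commute nat_neq_iff)
  have ab_S: "a \<in> S" "b \<in> S"
    using nbrs_subset[OF T(1), of v] ab(1) by auto
  have num: "arrs s aSum v = real a + real b" "arrs s aSqs v = real a * real a + real b * real b"
    "arrs s aDeg a = real (card (nbrs F a))" "arrs s aDeg b = real (card (nbrs F b))"
    using st v(1) ab ab_S by (simp_all add: stats_def S_def[symmetric] F_def[symmetric])
  define new where "new = (if arrs s aDeg a = 3 then [a] else []) @ (if arrs s aDeg b = 3 then [b] else [])"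
  have set_new: "set new = {u \<in> {a, b}. card (nbrs F u) = 3}"
    using num(3,4) by (auto simp: new_def)
  define qs' where "qs' = qs @ new"
  have old: "qs' ! i = qs ! i" if "i < length qs" for i
    using that by (simp add: qs'_def nth_append)
  have im: "(!) qs' ` {..<i} = (!) qs ` {..<i}" if "i \<le> length qs" for i
    using old that by (intro image_cong) auto
  have im_Suc: "(!) qs' ` {..<Suc k} = insert v ((!) qs ` {..<k})"
    using im[of "Suc k"] \<open>k < length qs\<close> by (simp add: lessThan_Suc v_def)
  have rest': "rest ((!) qs') (Suc k) = S - {v}" "rest_edges ((!) qs') (Suc k) = {e \<in> F. v \<notin> e}"
    unfolding im_Suc S_def F_def without_insert by auto
  show ?thesis
  proof (rule wp_remove_step[OF I(1,3) \<open>k < length qs\<close> v_def[symmetric] ab(2) num(1,2)])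
    fix s'
    assume s': "same s s' {vI, vT, vV, vR, vA, vB} {aDeg, aSum, aSqs, aQueue, aFst, aSnd}"
      "vars s' vI = real (Suc k)"
      "arrs s' aFst = (arrs s aFst)(k := real a)" "arrs s' aSnd = (arrs s aSnd)(k := real b)"
      "arrs s' aDeg = (arrs s aDeg)(a := arrs s aDeg a - 1, b := arrs s aDeg b - 1)"
      "arrs s' aSum = (arrs s aSum)(a := arrs s aSum a - real v, b := arrs s aSum b - real v)"
      "arrs s' aSqs =
        (arrs s aSqs)(a := arrs s aSqs a - real v * real v, b := arrs s aSqs b - real v * real v)"
      "queue (qs @ (if arrs s aDeg a = 3 then [a] else []) @ (if arrs s aDeg b = 3 then [b] else [])) s'"
    show "eliminating (Suc k) s'"
      unfolding eliminating_def
    proof (intro conjI exI)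
      show "Suc k \<le> n - 2" "vars s' vI = real (Suc k)"
        using assms(2) s'(2) by simp_all
      show "frame s'"
        using I(2) s'(1) by (simp add: frame_def same_def)
      show "queue qs' s'"
        using s'(8) by (simp add: qs'_def new_def)
      show "Suc k \<le> length qs'"
        using \<open>k < length qs\<close> by (simp add: qs'_def)
      \<comment> \<open>Processed vertices are no longer in \<open>S\<close>, and waiting ones have
        degree at most 2, whereas new entries lie in \<open>S\<close> with degree 3.\<close>
      have "set qs \<inter> set new = {}"
      proof -
        have "set qs = set (take k qs) \<union> set (drop k qs)"
          by (metis append_take_drop_id set_append)
        moreover have "set (take k qs) = (!) qs ` {..<k}"
          using \<open>k < length qs\<close> by (simp add: nth_image[symmetric] atLeast0LessThan)
        moreover have "(!) qs ` {..<k} \<inter> set new = {}"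
          using ab_S set_new by (auto simp: S_def)
        moreover have "set (drop k qs) \<inter> set new = {}"
          unfolding pend set_new by (auto simp: F_def)
        ultimately show ?thesis
          by blast
      qed
      then show "distinct qs'"
        using I(4) ab(2) by (auto simp: qs'_def new_def)
      show "ordering ((!) qs') (f(k := a)) (g(k := b)) (Suc k) s'"
        unfolding ordering_def peeling_Suc
      proof (intro conjI)
        show "peeling {0..<n} E ((!) qs') (f(k := a)) (g(k := b)) k"
          by (rule peeling_cong[OF peel]) (use old \<open>k < length qs\<close> in auto)
        have "qs' ! k = v" "(!) qs' ` {..<k} = (!) qs ` {..<k}"
          using old im \<open>k < length qs\<close> by (simp_all add: v_def)
        then show "qs' ! k \<in> rest ((!) qs') k"
          "nbrs (rest_edges ((!) qs') k) (qs' ! k) = {(f(k := a)) k, (g(k := b)) k}"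
          using v(1) ab(1) by (simp_all add: S_def F_def)
        show "(f(k := a)) k \<noteq> (g(k := b)) k"
          using ab(2) by simp
        show "\<forall>j<Suc k. arrs s' aFst j = real ((f(k := a)) j) \<and> arrs s' aSnd j = real ((g(k := b)) j)"
          using ord s'(3,4) by (auto simp: ordering_def less_Suc_eq)
      qed
      show "stats (rest ((!) qs') (Suc k)) (rest_edges ((!) qs') (Suc k)) s'"
        unfolding rest'
        by (rule stats_remove[of S F s v a b])
          (use st v(1) ab s' finite_nbrs[OF T(1)] nbrs_self[OF T(1), of v] in
            \<open>simp_all add: S_def[symmetric] F_def[symmetric]\<close>)
      have "set (drop (Suc k) qs) = set (drop k qs) - {v}"
        using I(4) drop distinct_drop[of qs k] by auto
      then have "set (drop (Suc k) qs') = (set (drop k qs) - {v}) \<union> set new"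
        using \<open>k < length qs\<close> by (simp add: qs'_def)
      then show "set (drop (Suc k) qs') =
          {u \<in> rest ((!) qs') (Suc k). card (nbrs (rest_edges ((!) qs') (Suc k)) u) \<le> 2}"
        unfolding rest' pending_remove[OF T(1) ab(1)] set_new
        unfolding pend S_def[symmetric] F_def[symmetric] .
    qed
  qed
qed

definition "eliminate_time = cost (Set vI (Lit 0)) +
  ((n - 2) * (cost remove_step + guard_cost (Var vI) (Var vN [-] Lit 2)) +
   guard_cost (Var vI) (Var vN [-] Lit 2))"

definition ordered :: "(nat \<Rightarrow> nat) \<Rightarrow> (nat \<Rightarrow> nat) \<Rightarrow> (nat \<Rightarrow> nat) \<Rightarrow> state \<Rightarrow> bool" where
  "ordered q f g s \<longleftrightarrow> inj_on q {..<n} \<and> q ` {..<n} = {0..<n} \<and>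
     (\<forall>j<n. arrs s aQueue j = real (q j)) \<and> ordering q f g (n - 2) s"

lemma reaches_eliminate:
  assumes "enqueuing n s"
  shows "reaches eliminate eliminate_time s (\<lambda>s. frame s \<and> (\<exists>q f g. ordered q f g s))"
  unfolding eliminate_def eliminate_time_def
proof (rule reaches_Seq)
  let ?qs = "filter (\<lambda>v. card (nbrs E v) = 2) [0..<n]"
  let ?s = "s\<lparr>vars := (vars s)(vI := 0)\<rparr>"
  \<comment> \<open>The scan collects degree exactly 2, the invariant speaks of at most 2; no vertex
    starts below 2.\<close>
  have "card (nbrs E v) \<le> 2 \<longleftrightarrow> card (nbrs E v) = 2" if "v < n" for v
    using card_nbrs_ge_2[OF tree, of v] that n3 by auto
  then have "set ?qs = {v \<in> {0..<n}. card (nbrs E v) \<le> 2}"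
    by auto
  moreover have "queue ?qs ?s" "frame ?s" "stats UNIV E ?s"
    using assms by (auto simp: enqueuing_def frame_def intro: queue_cong stats_cong)
  ultimately have "eliminating 0 ?s"
    unfolding eliminating_def
    by (auto intro!: exI[of _ ?qs] simp: ordering_def peeling_def stats_def)
  then have "wp (Set vI (Lit 0)) (eliminating 0) s"
    by simp
  from reaches_wp[OF this]
  show "reaches (Set vI (Lit 0)) (cost (Set vI (Lit 0))) s
      (\<lambda>s. reaches (WhileLess (Var vI) (Var vN [-] Lit 2) remove_step)
        ((n - 2) * (cost remove_step + guard_cost (Var vI) (Var vN [-] Lit 2)) +
         guard_cost (Var vI) (Var vN [-] Lit 2)) s
        (\<lambda>s. frame s \<and> (\<exists>q f g. ordered q f g s)))"
  proof (rule reaches_mono, simp)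
    fix s
    assume "eliminating 0 s"
    then have "reaches (WhileLess (Var vI) (Var vN [-] Lit 2) remove_step)
        ((n - 2) * (cost remove_step + guard_cost (Var vI) (Var vN [-] Lit 2)) +
         guard_cost (Var vI) (Var vN [-] Lit 2)) s (eliminating (n - 2))"
    proof (rule reaches_for)
      fix k s
      assume "eliminating k s"
      then have "k \<le> n - 2" "vars s vI = real k" "vars s vN = real n"
        by (auto simp: eliminating_def frame_def)
      then show "k \<le> n - 2 \<and> vars s vI = real k \<and> safe (Var vN [-] Lit 2) s \<and>
          eval (Var vN [-] Lit 2) s = real (n - 2)"
        using n3 by (simp add: of_nat_diff)
    qed (rule wp_eliminating)
    then show "reaches (WhileLess (Var vI) (Var vN [-] Lit 2) remove_step)
        ((n - 2) * (cost remove_step + guard_cost (Var vI) (Var vN [-] Lit 2)) +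
         guard_cost (Var vI) (Var vN [-] Lit 2)) s (\<lambda>s. frame s \<and> (\<exists>q f g. ordered q f g s))"
    proof (rule reaches_mono, simp)
      fix s
      assume "eliminating (n - 2) s"
      then obtain qs f g where I: "frame s" "queue qs s" "distinct qs" "n - 2 \<le> length qs"
        and ord: "ordering ((!) qs) f g (n - 2) s"
        and pend: "set (drop (n - 2) qs) =
          {v \<in> rest ((!) qs) (n - 2). card (nbrs (rest_edges ((!) qs) (n - 2)) v) \<le> 2}"
        unfolding eliminating_def by blast
      let ?S = "rest ((!) qs) (n - 2)" and ?F = "rest_edges ((!) qs) (n - 2)"
      have "peeling {0..<n} E ((!) qs) f g (n - 2)"
        using ord by (simp add: ordering_def)
      from peeling_edge_tree[OF tree this] n3 have T: "edge_tree ?S ?F" "card ?S = 2"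
        by simp_all
      have tk: "set (take (n - 2) qs) = (!) qs ` {..<n - 2}"
        using I(4) by (simp add: nth_image[symmetric] atLeast0LessThan)
      \<comment> \<open>Both remaining vertices have degree 1 and hence are waiting, so the queue is
        a permutation of all vertices.\<close>
      have "set (drop (n - 2) qs) = ?S"
        unfolding pend using card_nbrs_edge[OF T] by auto
      moreover have "(!) qs ` {..<n - 2} \<subseteq> {0..<n}"
        using ord by (auto simp: ordering_def peeling_def)
      ultimately have qs: "set qs = {0..<n}"
        using tk by (metis Diff_partition append_take_drop_id set_append)
      then have len: "length qs = n"
        using distinct_card[OF I(3)] by simp
      have "inj_on ((!) qs) {..<n}" "(!) qs ` {..<n} = {0..<n}"
        using I(3) len qs by (auto simp: inj_on_nth set_conv_nth)
      moreover have "\<forall>j<n. arrs s aQueue j = real (qs ! j)"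
        using I(2) len by (simp add: queue_def)
      ultimately have "ordered ((!) qs) f g s"
        using ord by (simp add: ordered_def)
      with I(1) show "frame s \<and> (\<exists>q f g. ordered q f g s)"
        by blast
    qed
  qed
qed

end


subsection \<open>Placement\<close>

text \<open>The square of side \<open>2 n + 1\<close> around the origin of the lattice is laid out row by row. Marking
  an occupied point takes constant time, and the memory is initially zero, so the quadratic size of the
  square does not matter.\<close>

definition grid_key :: expr where
  "grid_key = (Var vX [+] Var vN) [*] (Lit 2 [*] Var vN [+] Lit 1) [+] (Var vY [+] Var vN)"

text \<open>The remaining edge goes to the lattice points \<open>(0, 0)\<close> and
  \<open>(1, 0)\<close>. The coordinate arrays still being zero, a single write suffices for its two
  ends.\<close>

definition prepare :: com where
  "prepare =
     Set vA (At aQueue (Var vN [-] Lit 1)) ;; Set vB (At aQueue (Var vN [-] Lit 2)) ;;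
     SetAt aX (Var vB) (Lit 1) ;;
     Set vX (Lit 0) ;; Set vY (Lit 0) ;; SetAt aGrid grid_key (Lit 1) ;;
     Set vX (Lit 1) ;; SetAt aGrid grid_key (Lit 1) ;;
     Set vI (Var vN [-] Lit 2) ;; Set vOk (Lit 1)"

definition first_apex :: com where
  "first_apex =
     Set vI (Var vI [-] Lit 1) ;; Set vV (At aQueue (Var vI)) ;;
     Set vA (At aFst (Var vI)) ;; Set vB (At aSnd (Var vI)) ;;
     Set vDX (At aX (Var vB) [-] At aX (Var vA)) ;; Set vDY (At aY (Var vB) [-] At aY (Var vA)) ;;
     Set vX (At aX (Var vA) [-] Var vDY) ;; Set vY (At aY (Var vA) [+] Var vDX [+] Var vDY)"

definition second_apex :: com where
  "second_apex = IfEq (At aGrid grid_key) (Lit 1)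
     (Set vX (At aX (Var vA) [+] Var vDX [+] Var vDY) ;; Set vY (At aY (Var vA) [-] Var vDX)) Skip"

text \<open>A collision sets \<open>vI\<close> to 0, which makes the guard of the placement loop
  fail at once; \<open>vOk\<close> hands the refusal on to \<open>answer\<close>.\<close>

definition occupy :: com where
  "occupy = IfEq (At aGrid grid_key) (Lit 1) (Set vOk (Lit 0) ;; Set vI (Lit 0))
     (SetAt aGrid grid_key (Lit 1) ;; SetAt aX (Var vV) (Var vX) ;; SetAt aY (Var vV) (Var vY))"

definition place_step :: com where
  "place_step = first_apex ;; second_apex ;; occupy"

definition place :: com where
  "place = prepare ;; WhileLess (Lit 0) (Var vI) place_step"

section \<open>The table of occupied lattice points\<close>

definition grid_index :: "nat \<Rightarrow> int \<Rightarrow> int \<Rightarrow> nat" where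
  "grid_index n c d = nat ((c + int n) * (2 * int n + 1) + (d + int n))"

definition in_grid :: "nat \<Rightarrow> int \<times> int \<Rightarrow> bool" where
  "in_grid n C \<longleftrightarrow> \<bar>fst C\<bar> \<le> int n \<and> \<bar>snd C\<bar> \<le> int n"

lemma grid_index_nonneg:
  assumes "in_grid n (c, d)"
  shows "0 \<le> (c + int n) * (2 * int n + 1) + (d + int n)"
proof -
  have "0 \<le> c + int n" "0 \<le> d + int n"
    using assms by (auto simp: in_grid_def)
  moreover from this(1) have "0 \<le> (c + int n) * (2 * int n + 1)"
    by (rule mult_nonneg_nonneg) simp
  ultimately show ?thesis
    by linarith
qed

text \<open>Shifted by \<open>n\<close>, the second coordinate is a residue modulo the row length
  \<open>2 n + 1\<close>, so it can be recovered from the index, and then so can the row.\<close>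

lemma grid_index_inject:
  assumes "in_grid n (c, d)" "in_grid n (c', d')"
  shows "grid_index n c d = grid_index n c' d' \<longleftrightarrow> c = c' \<and> d = d'"
proof
  define K where "K = 2 * int n + 1"
  assume "grid_index n c d = grid_index n c' d'"
  then have eq: "(c + int n) * K + (d + int n) = (c' + int n) * K + (d' + int n)"
    using grid_index_nonneg[OF assms(1)] grid_index_nonneg[OF assms(2)]
    by (simp add: grid_index_def K_def)
  have d: "0 \<le> d + int n" "d + int n < K" "0 \<le> d' + int n" "d' + int n < K"
    using assms by (auto simp: in_grid_def K_def)
  have "((c + int n) * K + (d + int n)) mod K = d + int n"
    "((c' + int n) * K + (d' + int n)) mod K = d' + int n"
    using d by simp_all
  then have dd: "d = d'"
    unfolding eq by simp
  with eq d show "c = c' \<and> d = d'"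
    by auto
qed simp

lemma eval_grid_key:
  assumes "vars s vN = real n" "vars s vX = of_int c" "vars s vY = of_int d" "in_grid n (c, d)"
  shows "eval grid_key s = real (grid_index n c d)" "safe grid_key s"
proof -
  have "real (grid_index n c d) = of_int ((c + int n) * (2 * int n + 1) + (d + int n))"
    using grid_index_nonneg[OF assms(4)] by (simp add: grid_index_def)
  then show "eval grid_key s = real (grid_index n c d)"
    using assms by (simp add: grid_key_def)
  show "safe grid_key s"
    by (simp add: grid_key_def)
qed

definition marks :: "nat \<Rightarrow> (int \<times> int) set \<Rightarrow> state \<Rightarrow> bool" where
  "marks n P s \<longleftrightarrow> (\<forall>c d. in_grid n (c, d) \<longrightarrow>
     arrs s aGrid (grid_index n c d) = (if (c, d) \<in> P then 1 else 0))"

lemma marks_insert: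
  assumes "marks n P s" "in_grid n (c, d)" "arrs s' aGrid = (arrs s aGrid)(grid_index n c d := 1)"
  shows "marks n (insert (c, d) P) s'"
  using assms grid_index_inject[OF _ assms(2)] by (auto simp: marks_def)

lemma marks_cong: "marks n P s \<Longrightarrow> arrs s' aGrid = arrs s aGrid \<Longrightarrow> marks n P s'"
  by (simp add: marks_def)

lemma unit_vec_bound: "unit_vec x y \<Longrightarrow> \<bar>x\<bar> \<le> 1 \<and> \<bar>y\<bar> \<le> 1"
  unfolding unit_vec_iff by auto

lemma wp_first_apex:
  fixes x y :: "nat \<Rightarrow> int"
  assumes "vars s vI = real (Suc k)" "arrs s aQueue k = real v"
    "arrs s aFst k = real a" "arrs s aSnd k = real b"
    "\<And>u. arrs s aX u = of_int (x u)" "\<And>u. arrs s aY u = of_int (y u)"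
    "L = left_apex (x a, y a) (x b, y b)"
    and Q: "\<And>s'. same s s' {vI, vV, vA, vB, vDX, vDY, vX, vY} {} \<Longrightarrow> vars s' vI = real k \<Longrightarrow>
      vars s' vV = real v \<Longrightarrow> vars s' vA = real a \<Longrightarrow> vars s' vDX = of_int (x b - x a) \<Longrightarrow>
      vars s' vDY = of_int (y b - y a) \<Longrightarrow> vars s' vX = of_int (fst L) \<Longrightarrow>
      vars s' vY = of_int (snd L) \<Longrightarrow> Q s'"
  shows "wp first_apex Q s"
  using assms(1-6) by (simp add: first_apex_def) (rule Q; simp add: same_def assms(7) left_apex_def)

lemma wp_second_apex:
  fixes x y :: "nat \<Rightarrow> int"
  assumes "vars s vN = real n" "marks n P s" "in_grid n L"
    "vars s vA = real a" "vars s vDX = of_int (x b - x a)" "vars s vDY = of_int (y b - y a)"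
    "vars s vX = of_int (fst L)" "vars s vY = of_int (snd L)"
    "\<And>u. arrs s aX u = of_int (x u)" "\<And>u. arrs s aY u = of_int (y u)"
    "R = right_apex (x a, y a) (x b, y b)" "C = (if L \<in> P then R else L)"
    and Q: "\<And>s'. same s s' {vX, vY} {} \<Longrightarrow> vars s' vX = of_int (fst C) \<Longrightarrow>
      vars s' vY = of_int (snd C) \<Longrightarrow> Q s'"
  shows "wp second_apex Q s"
proof -
  have L: "in_grid n (fst L, snd L)"
    using assms(3) by simp
  note key = eval_grid_key[OF assms(1,7,8) L]
  have "arrs s aGrid (grid_index n (fst L) (snd L)) = (if L \<in> P then 1 else 0)"
    using assms(2) L by (simp add: marks_def)
  then show ?thesis
    using assms(4-10) by (simp add: second_apex_def key)
      (auto intro!: Q simp: same_def assms(11,12) right_apex_def)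
qed

lemma wp_occupy:
  assumes "vars s vN = real n" "marks n P s" "in_grid n (c, d)"
    "vars s vX = of_int c" "vars s vY = of_int d" "vars s vV = real v"
    and yes: "\<And>s'. (c, d) \<notin> P \<Longrightarrow> same s s' {} {aGrid, aX, aY} \<Longrightarrow>
      arrs s' aX = (arrs s aX)(v := of_int c) \<Longrightarrow> arrs s' aY = (arrs s aY)(v := of_int d) \<Longrightarrow>
      marks n (insert (c, d) P) s' \<Longrightarrow> Q s'"
    and no: "\<And>s'. (c, d) \<in> P \<Longrightarrow> same s s' {vOk, vI} {} \<Longrightarrow> vars s' vOk = 0 \<Longrightarrow> vars s' vI = 0 \<Longrightarrow>
      Q s'"
  shows "wp occupy Q s"
proof -
  note key = eval_grid_key[OF assms(1,4,5,3)]
  have mark: "arrs s aGrid (grid_index n c d) = (if (c, d) \<in> P then 1 else 0)"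
    using assms(2,3) by (simp add: marks_def)
  show ?thesis
  proof (cases "(c, d) \<in> P")
    case True
    with mark show ?thesis
      by (simp add: occupy_def key) (rule no; simp add: same_def)
  next
    case False
    with mark assms(4-6) show ?thesis
      by (simp add: occupy_def key)
        (rule yes; simp add: same_def marks_insert[OF assms(2,3)])
  qed
qed

text \<open>An apex is one unit vector away from \<open>a\<close>, so each new vertex enlarges the
  bound on the coordinates by at most one. This is why the table reaches only up to \<open>n\<close>
  in each direction.\<close>

lemma (in placement_step) apex_bound:
  assumes "apex C" "\<And>s. s \<in> S \<Longrightarrow> \<bar>x s\<bar> < m \<and> \<bar>y s\<bar> < m"
  shows "\<bar>fst C\<bar> < m + 1 \<and> \<bar>snd C\<bar> < m + 1"
proof -
  have "unit_vec (fst C - x a) (snd C - y a)"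
    using unit_vec_to_apex(1)[of "pos b" "pos a" C] unit[OF ab(1)] assms(1) by simp
  from unit_vec_bound[OF this] assms(2)[OF in_S(1)] show ?thesis
    by linarith
qed

section \<open>The invariant of the placement loop\<close>

context uniform_two_tree
begin

text \<open>Counts down: \<open>q 0\<close> to \<open>q (k - 1)\<close> are still missing and
  \<open>rest q k\<close> is drawn. The bound \<open>n - k\<close> is 2 for the initial edge and
  grows by one per vertex. The last clause feeds the assumption \<open>flat\<close> of
  \<open>placement_step\<close> in the opening round.\<close>

definition placing :: "(nat \<Rightarrow> nat) \<Rightarrow> (nat \<Rightarrow> nat) \<Rightarrow> (nat \<Rightarrow> nat) \<Rightarrow> nat \<Rightarrow> state \<Rightarrow> bool" where
  "placing q f g k s \<longleftrightarrow> k \<le> n - 2 \<and> ordered q f g s \<and>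
     vars s vN = real n \<and> vars s vL = w \<and> outp s = [] \<and> vars s vI = real k \<and> vars s vOk = 1 \<and>
     (\<exists>x y. (\<forall>v. arrs s aX v = of_int (x v) \<and> arrs s aY v = of_int (y v)) \<and>
        placement {0..<n} E w (rest q k) (rest_edges q k) x y \<and>
        marks n ((\<lambda>v. (x v, y v)) ` rest q k) s \<and>
        (\<forall>v\<in>rest q k. \<bar>x v\<bar> < int n - int k \<and> \<bar>y v\<bar> < int n - int k) \<and>
        (k = n - 2 \<longrightarrow> (\<forall>v\<in>rest q k. y v = 0)))"

lemma placingI:
  assumes "k \<le> n - 2" "ordered q f g s" "vars s vN = real n" "vars s vL = w" "outp s = []"
    "vars s vI = real k" "vars s vOk = 1"
    "\<And>v. arrs s aX v = of_int (x v)" "\<And>v. arrs s aY v = of_int (y v)"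
    "placement {0..<n} E w (rest q k) (rest_edges q k) x y"
    "marks n ((\<lambda>v. (x v, y v)) ` rest q k) s"
    "\<And>v. v \<in> rest q k \<Longrightarrow> \<bar>x v\<bar> < int n - int k \<and> \<bar>y v\<bar> < int n - int k"
    "\<And>v. k = n - 2 \<Longrightarrow> v \<in> rest q k \<Longrightarrow> y v = 0"
  shows "placing q f g k s"
  unfolding placing_def using assms by blast

definition failed :: "state \<Rightarrow> bool" where
  "failed s \<longleftrightarrow> outp s = [] \<and> vars s vI = 0 \<and> vars s vOk = 0 \<and>
     (\<forall>p. \<not> unit_map {0..<n} E w p)"

lemma ordered_same:
  "ordered q f g s \<Longrightarrow> same s s' Y A \<Longrightarrow> A \<inter> {aQueue, aFst, aSnd} = {} \<Longrightarrow> ordered q f g s'"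
  by (auto simp: ordered_def ordering_def same_def)

text \<open>Undoing the removal of \<open>q k\<close> is an instance of
  \<open>placement_step\<close>; a free apex leads to \<open>extend\<close>, two occupied ones to
  \<open>blocked\<close>.\<close>

lemma wp_place_step:
  assumes "placing q f g (Suc k) s"
  shows "wp place_step (\<lambda>s'. placing q f g k s' \<or> failed s') s"
proof -
  obtain x y where kn: "Suc k \<le> n - 2" and ord: "ordered q f g s"
    and I: "vars s vN = real n" "vars s vL = w" "outp s = []" "vars s vI = real (Suc k)" "vars s vOk = 1"
    and xy: "\<And>v. arrs s aX v = of_int (x v)" "\<And>v. arrs s aY v = of_int (y v)"
    and pl: "placement {0..<n} E w (rest q (Suc k)) (rest_edges q (Suc k)) x y"
    and mk: "marks n ((\<lambda>v. (x v, y v)) ` rest q (Suc k)) s"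
    and bound: "\<And>v. v \<in> rest q (Suc k) \<Longrightarrow> \<bar>x v\<bar> < int n - int (Suc k) \<and> \<bar>y v\<bar> < int n - int (Suc k)"
    and flat: "\<And>v. Suc k = n - 2 \<Longrightarrow> v \<in> rest q (Suc k) \<Longrightarrow> y v = 0"
    using assms unfolding placing_def by blast
  define S F v a b where "S = rest q (Suc k)" and "F = rest_edges q (Suc k)" and "v = q k"
    and "a = f k" and "b = g k"
  have peel: "peeling {0..<n} E q f g (n - 2)"
    using ord by (simp add: ordered_def ordering_def)
  then have peel_k: "peeling {0..<n} E q f g (Suc k)"
    using kn by (simp add: peeling_def)
  have T: "edge_tree S F" "card S = n - Suc k"
    using peeling_edge_tree[OF tree peel_k] kn by (simp_all add: S_def F_def)
  have v: "v \<in> rest q k" and nb: "nbrs (rest_edges q k) v = {a, b}"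
    using peel_k by (simp_all add: peeling_Suc v_def a_def b_def)
  have im: "q ` {..<Suc k} = insert v (q ` {..<k})"
    by (simp add: lessThan_Suc v_def)
  have S: "rest q k = insert v S" "v \<in> {0..<n} - S"
    using v unfolding S_def im by auto
  have F: "F = {e \<in> rest_edges q k. v \<notin> e}"
    unfolding F_def im without_insert ..
  have va: "{v, a} \<in> rest_edges q k" "{v, b} \<in> rest_edges q k"
    using nb by (auto simp: nbrs_def)
  interpret placement_step "{0..<n}" E w S F x y v a b
  proof
    show "placement {0..<n} E w S F x y"
      using pl by (simp add: S_def F_def)
    show "w > 0" "edge_tree S F" "v \<in> {0..<n} - S"
      by (fact w T S)+
    show "S \<subseteq> {0..<n}" "F \<subseteq> E"
      by (auto simp: S_def F_def without_def)
    show "y u = 0" if "card S = 2" "u \<in> S" for u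
    proof (rule flat)
      show "Suc k = n - 2"
        using that(1) T(2) kn by linarith
      show "u \<in> rest q (Suc k)"
        using that(2) by (simp add: S_def)
    qed
    show "{a, b} \<in> F"
      using peeling_edge[OF tree peel, of k] kn by (simp add: F_def a_def b_def)
    show "{v, a} \<in> E" "{v, b} \<in> E"
      using va by (simp_all add: without_def)
  qed
  have bound': "\<bar>fst C\<bar> < int n - int k \<and> \<bar>snd C\<bar> < int n - int k" if "apex C" for C
    using apex_bound[OF that, of "int n - int (Suc k)"] bound by (simp add: S_def)
  then have in_grid: "in_grid n C" if "apex C" for C
    using that by (fastforce simp: in_grid_def)
  define L R C where "L = left_apex (pos a) (pos b)" and "R = right_apex (pos a) (pos b)"
    and "C = (if L \<in> pos ` S then R else L)"
  have C: "apex C"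
    by (simp add: C_def L_def R_def)
  have mk: "marks n (pos ` S) s"
    using mk by (simp add: S_def)
  have arr: "arrs s aQueue k = real v" "arrs s aFst k = real a" "arrs s aSnd k = real b"
    using ord kn by (auto simp: ordered_def ordering_def v_def a_def b_def)
  show ?thesis
    unfolding place_step_def wp.simps(6)
  proof (rule wp_first_apex[OF I(4) arr xy L_def])
    fix s1
    assume s1: "same s s1 {vI, vV, vA, vB, vDX, vDY, vX, vY} {}" "vars s1 vI = real k"
      "vars s1 vV = real v" "vars s1 vA = real a" "vars s1 vDX = of_int (x b - x a)"
      "vars s1 vDY = of_int (y b - y a)" "vars s1 vX = of_int (fst L)" "vars s1 vY = of_int (snd L)"
    show "wp second_apex (wp occupy (\<lambda>s'. placing q f g k s' \<or> failed s')) s1"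
    proof (rule wp_second_apex[OF _ _ _ s1(4-8) _ _ R_def C_def])
      show "vars s1 vN = real n" "marks n (pos ` S) s1"
        "\<And>u. arrs s1 aX u = of_int (x u)" "\<And>u. arrs s1 aY u = of_int (y u)"
        using s1(1) I(1) xy marks_cong[OF mk, of s1] by (simp_all add: same_def)
      show "in_grid n L"
        by (rule in_grid) (simp add: L_def)
      fix s2
      assume s2: "same s1 s2 {vX, vY} {}" "vars s2 vX = of_int (fst C)" "vars s2 vY = of_int (snd C)"
      have ss2: "same s s2 {vI, vV, vA, vB, vDX, vDY, vX, vY} {}"
        using same_trans[OF s1(1) s2(1)] by (simp add: insert_commute)
      have vI2: "vars s2 vI = real k"
        using s1(2) s2(1) by (simp add: same_def)
      show "wp occupy (\<lambda>s'. placing q f g k s' \<or> failed s') s2"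
      proof (rule wp_occupy[where n = n and P = "pos ` S" and c = "fst C" and d = "snd C" and v = v])
        show "vars s2 vN = real n" "marks n (pos ` S) s2" "vars s2 vV = real v"
          using ss2 I(1) marks_cong[OF mk, of s2] s1(3) s2(1) by (simp_all add: same_def)
        show "in_grid n (fst C, snd C)"
          using in_grid[OF C] by simp
        show "vars s2 vX = of_int (fst C)" "vars s2 vY = of_int (snd C)"
          by fact+
      next
        fix s3
        assume occ: "(fst C, snd C) \<in> pos ` S" and s3: "same s2 s3 {vOk, vI} {}" "vars s3 vOk = 0" "vars s3 vI = 0"
        \<comment> \<open>If the left apex were free, \<open>C\<close> would be that free point; so
          \<open>C\<close> is the right apex and both are taken.\<close>
        have "left_apex (pos a) (pos b) \<in> pos ` S" "right_apex (pos a) (pos b) \<in> pos ` S"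
          using occ by (auto simp: C_def L_def R_def split: if_splits)
        then have "failed s3"
          using blocked s3 ss2 I(3) by (simp add: failed_def same_def)
        then show "placing q f g k s3 \<or> failed s3" ..
      next
        fix s3
        assume free: "(fst C, snd C) \<notin> pos ` S" and s3: "same s2 s3 {} {aGrid, aX, aY}"
          "arrs s3 aX = (arrs s2 aX)(v := of_int (fst C))" "arrs s3 aY = (arrs s2 aY)(v := of_int (snd C))"
          "marks n (insert (fst C, snd C) (pos ` S)) s3"
        let ?x = "x(v := fst C)" and ?y = "y(v := snd C)"
        have ss3: "same s s3 {vI, vV, vA, vB, vDX, vDY, vX, vY} {aGrid, aX, aY}"
          using same_trans[OF ss2 s3(1)] by simp
        have "placing q f g k s3"
        proof (rule placingI[where x = ?x and y = ?y])
          show "k \<le> n - 2"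
            using kn by simp
          show "ordered q f g s3"
            using ordered_same[OF ord ss3] by simp
          show "vars s3 vN = real n" "vars s3 vL = w" "outp s3 = []" "vars s3 vOk = 1" "vars s3 vI = real k"
            using ss3 I s3(1) vI2 by (simp_all add: same_def)
          show "arrs s3 aX u = of_int (?x u)" "arrs s3 aY u = of_int (?y u)" for u
            using s3(2,3) ss2 xy by (simp_all add: same_def)
          show "placement {0..<n} E w (rest q k) (rest_edges q k) ?x ?y"
            unfolding S(1)
          proof (rule extend)
            show "apex (fst C, snd C)" "(fst C, snd C) \<notin> pos ` S"
              using C free by simp_all
            fix s t
            assume st: "{s, t} \<in> rest_edges q k"
            then have "{t, s} \<in> rest_edges q k"
              by (simp add: insert_commute)
            with st have "s = v \<Longrightarrow> t \<in> nbrs (rest_edges q k) v" "t = v \<Longrightarrow> s \<in> nbrs (rest_edges q k) v"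
              by (simp_all add: nbrs_def)
            moreover have "s \<noteq> v \<Longrightarrow> t \<noteq> v \<Longrightarrow> {s, t} \<in> F"
              using st by (simp add: F)
            ultimately show "{s, t} \<in> F \<or> s = v \<and> t \<in> {a, b} \<or> t = v \<and> s \<in> {a, b}"
              unfolding nb by blast
          qed
          have "(\<lambda>u. (?x u, ?y u)) ` rest q k = insert (fst C, snd C) (pos ` S)"
            unfolding S(1) using S(2) by (auto simp: image_iff)
          with s3(4) show "marks n ((\<lambda>u. (?x u, ?y u)) ` rest q k) s3"
            by simp
          show "\<bar>?x u\<bar> < int n - int k \<and> \<bar>?y u\<bar> < int n - int k" if "u \<in> rest q k" for u
            using that bound[of u] bound'[OF C] unfolding S(1) by (auto simp: S_def)
        qed (use kn in simp)
        then show "placing q f g k s3 \<or> failed s3" ..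
      qed
    qed
  qed
qed

lemma wp_prepare:
  assumes "frame s" "ordered q f g s"
  shows "wp prepare (placing q f g (n - 2)) s"
proof -
  define a b where "a = q (n - 1)" and "b = q (n - 2)"
  have fr: "vars s vN = real n" "vars s vL = w" "outp s = []"
    "arrs s aX = (\<lambda>_. 0)" "arrs s aY = (\<lambda>_. 0)" "arrs s aGrid = (\<lambda>_. 0)"
    using assms(1) by (simp_all add: frame_def)
  have nat1: "real n - 1 = real (n - 1)" "real n - 2 = real (n - 2)"
    using n3 by (simp_all add: of_nat_diff)
  have qs: "arrs s aQueue (n - 1) = real a" "arrs s aQueue (n - 2) = real b"
    using assms(2) n3 by (simp_all add: ordered_def a_def b_def)
  have inj: "inj_on q {..<n}" and im: "q ` {..<n} = {0..<n}"
    using assms(2) by (simp_all add: ordered_def)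
  have ab: "a \<noteq> b"
    using inj_onD[OF inj, of "n - 1" "n - 2"] n3 by (auto simp: a_def b_def)
  have "{..<n} = insert (n - 1) (insert (n - 2) {..<n - 2})"
    using n3 by auto
  then have "{0..<n} = insert a (insert b (q ` {..<n - 2}))"
    unfolding im[symmetric] by (simp add: a_def b_def)
  moreover have "q j \<notin> q ` {..<n - 2}" if "n - 2 \<le> j" "j < n" for j
    using that by (subst inj_on_image_mem_iff[OF inj]) auto
  from this[of "n - 1"] this[of "n - 2"] n3
  have "a \<notin> q ` {..<n - 2}" "b \<notin> q ` {..<n - 2}"
    by (simp_all add: a_def b_def)
  ultimately have rest: "rest q (n - 2) = {a, b}"
    by auto
  have "peeling {0..<n} E q f g (n - 2)"
    using assms(2) by (simp add: ordered_def ordering_def)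
  from peeling_edge_tree[OF tree this] n3 have T: "edge_tree {a, b} (rest_edges q (n - 2))"
    unfolding rest by simp
  moreover have "card {a, b} = 2"
    using ab by simp
  ultimately obtain c d where "{a, b} = {c, d}" "rest_edges q (n - 2) = {{c, d}}"
    by (rule edge_tree_two)
  then have edges: "rest_edges q (n - 2) = {{a, b}}"
    by simp
  let ?x = "\<lambda>s. if s = b then 1 else 0 :: int" and ?y = "\<lambda>_ :: nat. 0 :: int"
  have grid: "in_grid n (0, 0)" "in_grid n (1, 0)"
    using n3 by (simp_all add: in_grid_def)
  \<comment> \<open>One rewrite rule for both evaluations of the key, at \<open>(0, 0)\<close> and
    at \<open>(1, 0)\<close>.\<close>
  have key: "eval grid_key s' = real (grid_index n (of_bool (vars s' vX = 1)) 0)" "safe grid_key s'"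
    if "vars s' vN = real n" "vars s' vX = 0 \<or> vars s' vX = 1" "vars s' vY = 0" for s'
    using that eval_grid_key[OF that(1), of 0 0] eval_grid_key[OF that(1), of 1 0] grid by auto
  let ?g = "(arrs s aGrid)(grid_index n 0 0 := 1, grid_index n 1 0 := 1)"
  have marks: "marks n {(1, 0), (0, 0)} s'" if "arrs s' aGrid = ?g" for s'
  proof (rule marks_insert[OF _ grid(2)])
    show "marks n {(0, 0)} (s\<lparr>arrs := (arrs s)(aGrid := (arrs s aGrid)(grid_index n 0 0 := 1))\<rparr>)"
      by (rule marks_insert[where s = s, OF _ grid(1)]) (simp_all add: marks_def fr)
  qed (simp add: that)
  have result: "placing q f g (n - 2) s'"
    if "same s s' {vA, vB, vX, vY, vI, vOk} {aX, aGrid}" "vars s' vI = real (n - 2)" "vars s' vOk = 1"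
      "arrs s' aX = (arrs s aX)(b := 1)" "arrs s' aGrid = ?g" for s'
  proof (rule placingI[where x = ?x and y = ?y])
    show "ordered q f g s'"
      using ordered_same[OF assms(2) that(1)] by simp
    show "vars s' vN = real n" "vars s' vL = w" "outp s' = []"
      using that(1) fr by (simp_all add: same_def)
    show "arrs s' aX v = of_int (?x v)" "arrs s' aY v = of_int (?y v)" for v
      using that(1,4) fr by (simp_all add: same_def)
    show "placement {0..<n} E w (rest q (n - 2)) (rest_edges q (n - 2)) ?x ?y"
      unfolding rest edges by (rule placement_edge[OF ab w])
    show "marks n ((\<lambda>v. (?x v, ?y v)) ` rest q (n - 2)) s'"
      unfolding rest using marks[OF that(5)] ab by (simp add: insert_commute)
    show "\<bar>?x v\<bar> < int n - int (n - 2) \<and> \<bar>?y v\<bar> < int n - int (n - 2)" for v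
      using n3 by (auto simp: of_nat_diff)
  qed (use that in simp_all)
  show ?thesis
    by (simp add: prepare_def key fr(1) nat1 qs[simplified] del: One_nat_def)
      (rule result; simp add: same_def)
qed

definition "place_time = cost prepare +
  ((n - 2) * (cost place_step + guard_cost (Lit 0) (Var vI)) + guard_cost (Lit 0) (Var vI))"

text \<open>The loop counts down and may stop early, so the rule for counting loops does not fit;
  the measure is \<open>vI\<close> itself, which a collision sends straight to 0.\<close>

lemma reaches_place:
  assumes "frame s" "ordered q f g s"
  shows "reaches place place_time s (\<lambda>s. placing q f g 0 s \<or> failed s)"
  unfolding place_def place_time_def
proof (rule reaches_Seq, rule reaches_mono[OF reaches_wp[OF wp_prepare[OF assms]] order_refl])
  fix s
  assume s: "placing q f g (n - 2) s"
  let ?g = "guard_cost (Lit 0) (Var vI)"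
  have "reaches (WhileLess (Lit 0) (Var vI) place_step)
      (nat \<lfloor>vars s vI\<rfloor> * (cost place_step + ?g) + ?g) s (\<lambda>s. placing q f g 0 s \<or> failed s)"
  proof (rule reaches_WhileLess[where I = "\<lambda>s. (\<exists>k. placing q f g k s) \<or> failed s"
        and r = "\<lambda>s. nat \<lfloor>vars s vI\<rfloor>"])
    show "(\<exists>k. placing q f g k s) \<or> failed s"
      using s by blast
  next
    fix s assume I: "(\<exists>k. placing q f g k s) \<or> failed s" and lt: "eval (Lit 0) s < eval (Var vI) s"
    from lt have "\<not> failed s"
      by (auto simp: failed_def)
    with I obtain k' where k': "placing q f g k' s"
      by blast
    then have "vars s vI = real k'"
      by (simp add: placing_def)
    with lt obtain k where k: "k' = Suc k"
      by (cases k') auto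
    show "reaches place_step (cost place_step) s
        (\<lambda>s'. ((\<exists>k. placing q f g k s') \<or> failed s') \<and> nat \<lfloor>vars s' vI\<rfloor> < nat \<lfloor>vars s vI\<rfloor>)"
    proof (rule reaches_mono[OF reaches_wp[OF wp_place_step[OF k'[unfolded k]]] order_refl])
      fix s'
      assume s': "placing q f g k s' \<or> failed s'"
      then have "nat \<lfloor>vars s' vI\<rfloor> \<le> k"
        by (auto simp: placing_def failed_def)
      with s' show "((\<exists>k. placing q f g k s') \<or> failed s') \<and> nat \<lfloor>vars s' vI\<rfloor> < nat \<lfloor>vars s vI\<rfloor>"
        using \<open>vars s vI = real k'\<close> k by auto
    qed
  next
    fix s assume "(\<exists>k. placing q f g k s) \<or> failed s" and ge: "\<not> eval (Lit 0) s < eval (Var vI) s"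
    then show "placing q f g 0 s \<or> failed s"
    proof (elim disjE exE)
      fix k assume k: "placing q f g k s"
      then have "vars s vI = real k"
        by (simp add: placing_def)
      with ge have "k = 0"
        by simp
      with k show ?thesis
        by simp
    qed simp
  qed simp
  moreover have "nat \<lfloor>vars s vI\<rfloor> = n - 2"
    using s by (simp add: placing_def)
  ultimately show "reaches (WhileLess (Lit 0) (Var vI) place_step)
      ((n - 2) * (cost place_step + ?g) + ?g) s (\<lambda>s. placing q f g 0 s \<or> failed s)"
    by simp
qed

end


subsection \<open>The answer\<close>

text \<open>Program constants are integers, so \<open>sqrt 3\<close> is computed by the machine at
  each point.\<close>

definition print_point :: com where
  "print_point =
     Output (Var vL [*] (At aX (Var vI) [+] At aY (Var vI) [/] Lit 2)) ;;
     Output (Var vL [*] At aY (Var vI) [*] (Root (Lit 3) [/] Lit 2)) ;;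
     incr vI"

definition print_drawing :: com where
  "print_drawing = (Output (Lit 1) ;; Set vI (Lit 0)) ;; WhileLess (Var vI) (Var vN) print_point"

definition answer :: com where
  "answer = IfEq (Var vOk) (Lit 0) (Output (Lit 0)) print_drawing"

definition solve :: com where
  "solve = read_graph ;; enqueue_leaves ;; eliminate ;; place ;; answer"

context uniform_two_tree
begin

definition printing :: "(nat \<Rightarrow> int) \<Rightarrow> (nat \<Rightarrow> int) \<Rightarrow> nat \<Rightarrow> state \<Rightarrow> bool" where
  "printing x y k s \<longleftrightarrow> k \<le> n \<and> vars s vI = real k \<and> vars s vN = real n \<and> vars s vL = w \<and>
     (\<forall>v. arrs s aX v = of_int (x v) \<and> arrs s aY v = of_int (y v)) \<and>
     outp s = answer_yes k (\<lambda>v. lattice_point w (of_int (x v)) (of_int (y v)))"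

lemma wp_print_point:
  assumes "printing x y k s" "k < n"
  shows "wp print_point (printing x y (Suc k)) s"
  using assms by (simp add: print_point_def incr_def printing_def answer_yes_def lattice_point_def)

definition "print_time = cost (Output (Lit 1) ;; Set vI (Lit 0)) +
  (n * (cost print_point + guard_cost (Var vI) (Var vN)) + guard_cost (Var vI) (Var vN))"

text \<open>\<open>reaches_IfEq\<close> asks for one bound on both branches; the sum of their costs
  serves.\<close>

definition "answer_time = length (comp_expr (Var vOk) 0) + length (comp_expr (Lit 0) 1) +
  (cost (Output (Lit 0)) + print_time) + 2"

definition solved :: "state \<Rightarrow> bool" where
  "solved s \<longleftrightarrow> (if \<exists>p. planar_realization {0..<n} E len p
     then \<exists>p. planar_realization {0..<n} E len p \<and> outp s = answer_yes n p
     else outp s = answer_no)"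

lemma reaches_print_drawing:
  assumes "vars s vN = real n" "vars s vL = w" "outp s = []"
    and "\<forall>v. arrs s aX v = of_int (x v) \<and> arrs s aY v = of_int (y v)"
  shows "reaches print_drawing print_time s (printing x y n)"
  unfolding print_drawing_def print_time_def
proof (rule reaches_Seq)
  have "wp (Output (Lit 1) ;; Set vI (Lit 0)) (printing x y 0) s"
    using assms by (simp add: printing_def answer_yes_def)
  from reaches_wp[OF this]
  show "reaches (Output (Lit 1) ;; Set vI (Lit 0)) (cost (Output (Lit 1) ;; Set vI (Lit 0))) s
      (\<lambda>s. reaches (WhileLess (Var vI) (Var vN) print_point)
        (n * (cost print_point + guard_cost (Var vI) (Var vN)) + guard_cost (Var vI) (Var vN)) s
        (printing x y n))"
    by (rule reaches_mono, simp, intro reaches_for wp_print_point) (simp_all add: printing_def)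
qed

lemma reaches_answer:
  assumes "placing q f g 0 s \<or> failed s"
  shows "reaches answer answer_time s solved"
  unfolding answer_def answer_time_def
proof (rule reaches_IfEq)
  assume "eval (Var vOk) s = eval (Lit 0) s"
  with assms have s: "failed s"
    by (auto simp: placing_def)
  then have "\<not> planar_realization {0..<n} E len p" for p
    using planar_realization_unit_map[OF _ len] by (auto simp: failed_def)
  then have "wp (Output (Lit 0)) solved s"
    using s by (simp add: solved_def failed_def answer_no_def)
  then show "reaches (Output (Lit 0)) (cost (Output (Lit 0)) + print_time) s solved"
    by (rule reaches_mono[OF reaches_wp]) simp_all
next
  assume "eval (Var vOk) s \<noteq> eval (Lit 0) s"
  with assms have s: "placing q f g 0 s"
    by (auto simp: failed_def)
  \<comment> \<open>At \<open>k = 0\<close> no vertex is missing, so the placement covers the whole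
    graph.\<close>
  then obtain x y where xy: "\<forall>v. arrs s aX v = of_int (x v) \<and> arrs s aY v = of_int (y v)"
    and pl: "placement {0..<n} E w {0..<n} E x y"
    unfolding placing_def by auto
  have "planar_realization {0..<n} E len (\<lambda>v. lattice_point w (of_int (x v)) (of_int (y v)))"
    using pl w edge_tree_edge[OF tree] len
    by (intro lattice_drawing_planar_realization) (auto simp: placement_def)
  then have "solved s'" if "printing x y n s'" for s'
    using that by (auto simp: solved_def printing_def)
  moreover have "reaches print_drawing print_time s (printing x y n)"
    using s xy by (intro reaches_print_drawing) (auto simp: placing_def)
  ultimately show "reaches print_drawing (cost (Output (Lit 0)) + print_time) s solved"
    by (auto elim!: reaches_mono)
qed simp_all

lemma reaches_solve:
  "reaches solve (read_time + (enqueue_time + (eliminate_time + (place_time + answer_time))))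
    (start (encode_graph n len es)) solved"
  unfolding solve_def
proof (rule reaches_Seq, rule reaches_mono[OF reaches_read_graph order_refl])
  fix s assume "reading (length es) s"
  then show "reaches (enqueue_leaves ;; eliminate ;; place ;; answer)
      (enqueue_time + (eliminate_time + (place_time + answer_time))) s solved"
  proof (rule reaches_Seq[OF reaches_mono[OF reaches_enqueue_leaves order_refl]])
    fix s assume "enqueuing n s"
    then show "reaches (eliminate ;; place ;; answer) (eliminate_time + (place_time + answer_time)) s solved"
    proof (rule reaches_Seq[OF reaches_mono[OF reaches_eliminate order_refl]])
      fix s assume "frame s \<and> (\<exists>q f g. ordered q f g s)"
      then obtain q f g where "frame s" "ordered q f g s"
        by blast
      then show "reaches (place ;; answer) (place_time + answer_time) s solved"
        by (rule reaches_Seq[OF reaches_mono[OF reaches_place order_refl reaches_answer]])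
    qed
  qed
qed

end

text \<open>A 2-tree with \<open>n\<close> vertices has \<open>2 n - 3\<close> edges, so \<open>2 n\<close> bounds the length of the input loop.\<close>

definition solve_time :: "nat \<Rightarrow> nat" where
  "solve_time n =
     (2 * (cost read_edge + guard_cost (Var vI) (Var vM)) +
      (cost enqueue_step + guard_cost (Var vI) (Var vN)) +
      (cost remove_step + guard_cost (Var vI) (Var vN [-] Lit 2)) +
      (cost place_step + guard_cost (Lit 0) (Var vI)) +
      (cost print_point + guard_cost (Var vI) (Var vN))) * n +
     (2 + guard_cost (Var vI) (Var vM) +
      cost (Set vI (Lit 0)) + guard_cost (Var vI) (Var vN) +
      cost (Set vI (Lit 0)) + guard_cost (Var vI) (Var vN [-] Lit 2) +
      cost prepare + guard_cost (Lit 0) (Var vI) +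
      length (comp_expr (Var vOk) 0) + length (comp_expr (Lit 0) 1) + cost (Output (Lit 0)) +
      cost (Output (Lit 1) ;; Set vI (Lit 0)) + guard_cost (Var vI) (Var vN) + 2)"

text \<open>Stated over variables, so that the arithmetic never unfolds the concrete costs of the
  code.\<close>

lemma sum_of_loops_le:
  fixes m n k :: nat
  assumes "m \<le> 2 * n" "k \<le> n"
  shows "2 + (m * A + a) + (p + (n * B + b) + (p + (k * C + c) + (q + (k * D + d) +
      (t + u + (v + (r + (n * F + b))) + 2)))) \<le>
    (2 * A + B + C + D + F) * n + (2 + a + p + b + p + c + q + d + t + u + v + r + b + 2)"
proof -
  have "m * A \<le> 2 * n * A" "k * C \<le> n * C" "k * D \<le> n * D"
    using assms by (intro mult_right_mono; simp)+
  moreover have "(2 * A + B + C + D + F) * n = 2 * n * A + n * B + n * C + n * D + n * F"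
    by (simp add: algebra_simps)
  ultimately show ?thesis
    by linarith
qed

lemma (in uniform_two_tree) total_time:
  "read_time + (enqueue_time + (eliminate_time + (place_time + answer_time))) \<le> solve_time n"
proof -
  have "length es \<le> 2 * n" "n - 2 \<le> n"
    using length_es by linarith+
  then show ?thesis
    unfolding read_time_def enqueue_time_def eliminate_time_def place_time_def answer_time_def
      print_time_def solve_time_def
    by (rule sum_of_loops_le)
qed

lemma linear_bigo: "(\<lambda>n. real (a * n + b)) \<in> O(\<lambda>n. real n)"
proof (rule bigoI)
  show "\<forall>\<^sub>F n in at_top. norm (real (a * n + b)) \<le> real (a + b) * norm (real n)"
    using eventually_ge_at_top[of 1]
  proof eventually_elim
    case (elim n)
    then have "b * 1 \<le> b * n"
      by (intro mult_left_mono) auto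
    then have "a * n + b \<le> (a + b) * n"
      by (simp add: distrib_right)
    then have "real (a * n + b) \<le> real ((a + b) * n)"
      by (rule of_nat_mono)
    then show ?case
      by (simp only: norm_of_nat of_nat_mult)
  qed
qed

theorem theorem6:
  shows "\<exists>(P :: program) (T :: nat \<Rightarrow> nat).
    (\<lambda>n. real (T n)) \<in> O(\<lambda>n. real n) \<and>
    (\<forall>(n :: nat) (E :: nat set set) (len :: nat set \<Rightarrow> real) (w :: real) (es :: (nat \<times> nat) list).
       two_tree {0..<n} E \<longrightarrow> w > 0 \<longrightarrow> (\<forall>e\<in>E. len e = w) \<longrightarrow> edge_listing E es \<longrightarrow>
       (\<exists>t ys. t \<le> T n \<and> computes_in P (encode_graph n len es) t ys \<and>
          (if \<exists>p. planar_realization {0..<n} E len p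
           then \<exists>p. planar_realization {0..<n} E len p \<and> ys = answer_yes n p
           else ys = answer_no)))"
proof (intro exI[of _ "comp_com solve 0 @ [Halt]"] exI[of _ solve_time] conjI allI impI)
  show "(\<lambda>n. real (solve_time n)) \<in> O(\<lambda>n. real n)"
    unfolding solve_time_def by (rule linear_bigo)
next
  fix n :: nat and E len and w :: real and es
  assume *: "two_tree {0..<n} E" "w > 0" "\<forall>e\<in>E. len e = w" "edge_listing E es"
  interpret uniform_two_tree n E len w es
    using * two_tree_edge_tree[OF *(1)] by unfold_locales auto
  from reaches_computes_in[OF reaches_mono[OF reaches_solve total_time]]
  obtain t s where "t \<le> solve_time n"
    "computes_in (comp_com solve 0 @ [Halt]) (encode_graph n len es) t (outp s)" "solved s"
    by blast
  then show "\<exists>t ys. t \<le> solve_time n \<and>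
      computes_in (comp_com solve 0 @ [Halt]) (encode_graph n len es) t ys \<and>
      (if \<exists>p. planar_realization {0..<n} E len p
       then \<exists>p. planar_realization {0..<n} E len p \<and> ys = answer_yes n p
       else ys = answer_no)"
    unfolding solved_def by blast
qed

end
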